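(* Let $n\ge1$, $1<p\le 2$, and let $F\in C^{2,\beta}_{loc}(\mathbb{R})$ for some $\beta>0$, with $F\ge0$. For some $0<T\le\infty$ let $u\in H_T$ be a viscosity solution of $$|Du|^{2-p}\left\{\operatorname{div}(|Du|^{p-2}Du)-F'(u)\right\}=u_t\quad\text{in }\mathbb{R}^n\times(0,T).$$ Suppose that at some time level $t_0$ with $0\le t_0\le T$ ($t_0<\infty$ if $T=\infty$) one has $$|Du(x,t_0)|^p\le\frac{p}{p-1}F(u(x,t_0))\quad\text{for a.e. }x\in\mathbb{R}^n.$$ Then for every $t$ with $t_0\le t\le T$ ($t<\infty$ if $T=\infty$) one has $$|Du(x,t)|^p\le\frac{p}{p-1}F(u(x,t))\quad\text{for a.e. }x\in\mathbb{R}^n.$$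
   Context: $D$ denotes the gradient in the space variable $x$ (which exists a.e. for Lipschitz functions), and subscripts $i,j$ denote partial derivatives in $x$; repeated indices are summed. Write $f=F'$. The class $H_T$: the set of all $u\in C(\mathbb{R}^n\times[0,T])$ such that $x\mapsto u(x,t)$ is Lipschitz continuous on $\mathbb{R}^n$ for each $t$, and $\|u\|_{L^\infty(\mathbb{R}^n\times[0,T])}<\infty$, $\|Du\|_{L^\infty(\mathbb{R}^n\times[0,T])}<\infty$. When $T=\infty$ the interval $[0,T]$ is read as $[0,\infty)$. Viscosity solution: the equation is understood through its non-divergence form $$\left(\delta_{ij}+(p-2)\frac{u_iu_j}{|Du|^2}\right)u_{ij}=|Du|^{2-p}f(u)+u_t .$$ Convention: $|0|^{2-p}=0$ if $p<2$ and $|0|^{2-p}=1$ if $p=2$. A bounded continuous $u$ is a viscosity subsolution if, whenever $\phi\in C^2(\mathbb{R}^n\times(0,T))$ and $u-\phi$ has a local maximum at $z_0\in\mathbb{R}^n\times(0,T)$, then at $z_0$: (i) if $D\phi(z_0)\ne0$, $\ \phi_t+|D\phi|^{2-p}f(u)\le\left(\delta_{ij}+(p-2)\frac{\phi_i\phi_j}{|D\phi|^2}\right)\phi_{ij}$; (ii) if $D\phi(z_0)=0$, $\ \inf_{|a|=1}\left\{\phi_t+|D\phi|^{2-p}f(u)-(\delta_{ij}+(p-2)a_ia_j)\phi_{ij}\right\}\le 0$. A viscosity supersolution is defined symmetrically: local maximum is replaced by local minimum, the inequality in (i) is reversed, and in (ii) the condition becomes $\sup_{|a|=1}\{\dots\}\ge0$.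 A viscosity solution is both a subsolution and a supersolution. *)

theory Defs
  imports "HOL-Analysis.Analysis"
begin

text \<open>Space-time points are pairs \<open>(x, t)\<close> with \<open>x :: real ^ 'n\<close> and \<open>t :: real\<close>;
  the final time is an extended real, so that infinity is allowed.\<close>

definition closed_times :: "ereal \<Rightarrow> real set" where
  "closed_times T = {t. 0 \<le> t \<and> ereal t \<le> T}"

definition open_times :: "ereal \<Rightarrow> real set" where
  "open_times T = {t. 0 < t \<and> ereal t < T}"

text \<open>Asking for a Hoelder bound on every compact set makes the second derivative continuous.\<close>

definition C2_Hoelder_loc :: "real \<Rightarrow> (real \<Rightarrow> real) \<Rightarrow> bool" where
  "C2_Hoelder_loc \<beta> F \<longleftrightarrow>
     (\<forall>s. F differentiable (at s)) \<and>
     (\<forall>s. deriv F differentiable (at s)) \<and>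
     (\<forall>K. compact K \<longrightarrow>
        (\<exists>C. \<forall>r\<in>K. \<forall>s\<in>K.
           \<bar>deriv (deriv F) r - deriv (deriv F) s\<bar> \<le> C * \<bar>r - s\<bar> powr \<beta>))"

text \<open>The spatial gradient of \<open>u\<close> at \<open>(x, t)\<close> is the vector \<open>D\<close> with
  \<open>GDERIV (\<lambda>y. u (y, t)) x :> D\<close>; a bound on it almost everywhere includes its existence
  almost everywhere.\<close>

definition class_H :: "ereal \<Rightarrow> ((real ^ 'n) \<times> real \<Rightarrow> real) set" where
  "class_H T = {u.
     continuous_on (UNIV \<times> closed_times T) u \<and>
     (\<forall>t\<in>closed_times T. \<exists>L. L-lipschitz_on UNIV (\<lambda>x. u (x, t))) \<and>
     (\<exists>C. AE (x, t) in lebesgue_on (UNIV \<times> closed_times T). \<bar>u (x, t)\<bar> \<le> C) \<and>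
     (\<exists>C. AE (x, t) in lebesgue_on (UNIV \<times> closed_times T).
        \<exists>D. GDERIV (\<lambda>y. u (y, t)) x :> D \<and> norm D \<le> C)}"

text \<open>Twice continuously (Frechet) differentiable; intended for open sets \<open>S\<close>.\<close>

definition C2_on :: "'a::real_normed_vector set \<Rightarrow> ('a \<Rightarrow> real) \<Rightarrow> bool" where
  "C2_on S \<phi> \<longleftrightarrow>
     (\<exists>(\<phi>' :: 'a \<Rightarrow> 'a \<Rightarrow>\<^sub>L real) (\<phi>'' :: 'a \<Rightarrow> 'a \<Rightarrow>\<^sub>L ('a \<Rightarrow>\<^sub>L real)).
        (\<forall>z\<in>S. (\<phi> has_derivative blinfun_apply (\<phi>' z)) (at z)) \<and>
        (\<forall>z\<in>S. (\<phi>' has_derivative blinfun_apply (\<phi>'' z)) (at z)) \<and>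
        continuous_on S \<phi>'')"

definition dir_deriv :: "'a::real_normed_vector \<Rightarrow> ('a \<Rightarrow> real) \<Rightarrow> 'a \<Rightarrow> real" where
  "dir_deriv v \<phi> z = deriv (\<lambda>h. \<phi> (z + h *\<^sub>R v)) 0"

definition partial_t :: "((real ^ 'n) \<times> real \<Rightarrow> real) \<Rightarrow> (real ^ 'n) \<times> real \<Rightarrow> real" where
  "partial_t \<phi> z = dir_deriv (0, 1) \<phi> z"

definition partial_x :: "'n \<Rightarrow> ((real ^ 'n) \<times> real \<Rightarrow> real) \<Rightarrow> (real ^ 'n) \<times> real \<Rightarrow> real" where
  "partial_x i \<phi> z = dir_deriv (axis i 1, 0) \<phi> z"

definition grad_x :: "((real ^ 'n) \<times> real \<Rightarrow> real) \<Rightarrow> (real ^ 'n) \<times> real \<Rightarrow> real ^ 'n" where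
  "grad_x \<phi> z = (\<chi> i. partial_x i \<phi> z)"

text \<open>The power \<open>r\<^sup>2\<^sup>-\<^sup>p\<close>, with the convention that \<open>r = 0\<close> gives 1 for \<open>p = 2\<close>
  (whereas \<open>0 powr 0 = 0\<close>) and 0 for \<open>p < 2\<close>.\<close>

definition pow_2mp :: "real \<Rightarrow> real \<Rightarrow> real" where
  "pow_2mp p r = (if p = 2 then 1 else r powr (2 - p))"

text \<open>The sum over \<open>i, j\<close> of \<open>(\<delta>\<^sub>i\<^sub>j + (p - 2) B\<^sub>i\<^sub>j) \<phi>\<^sub>i\<^sub>j\<close>.\<close>

definition second_order_op ::
    "real \<Rightarrow> ('n \<Rightarrow> 'n \<Rightarrow> real) \<Rightarrow> ((real ^ 'n) \<times> real \<Rightarrow> real) \<Rightarrow> (real ^ 'n) \<times> real \<Rightarrow> real" where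
  "second_order_op p B \<phi> z =
     (\<Sum>i\<in>UNIV. \<Sum>j\<in>UNIV.
        ((if i = j then 1 else 0) + (p - 2) * B i j) * partial_x j (partial_x i \<phi>) z)"

text \<open>Viscosity sub- and supersolutions, on the space-time strip over \<open>open_times T\<close>, of
  \<open>|Du|\<^sup>2\<^sup>-\<^sup>p (div (|Du|\<^sup>p\<^sup>-\<^sup>2 Du) - f(u)) = u\<^sub>t\<close>, understood in non-divergence form.\<close>

definition viscosity_subsolution ::
    "real \<Rightarrow> (real \<Rightarrow> real) \<Rightarrow> ereal \<Rightarrow> ((real ^ 'n) \<times> real \<Rightarrow> real) \<Rightarrow> bool" where
  "viscosity_subsolution p f T u \<longleftrightarrow>
     continuous_on (UNIV \<times> open_times T) u \<and>
     bounded (u ` (UNIV \<times> open_times T)) \<and>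
     (\<forall>\<phi>. \<forall>z\<in>UNIV \<times> open_times T.
        C2_on (UNIV \<times> open_times T) \<phi> \<and>
        (\<forall>\<^sub>F y in nhds z. u y - \<phi> y \<le> u z - \<phi> z) \<longrightarrow>
        (grad_x \<phi> z \<noteq> 0 \<longrightarrow>
           partial_t \<phi> z + pow_2mp p (norm (grad_x \<phi> z)) * f (u z)
             \<le> second_order_op p
                  (\<lambda>i j. partial_x i \<phi> z * partial_x j \<phi> z / (norm (grad_x \<phi> z))\<^sup>2) \<phi> z) \<and>
        (grad_x \<phi> z = 0 \<longrightarrow>
           (INF a\<in>{a :: real ^ 'n. norm a = 1}.
              partial_t \<phi> z + pow_2mp p (norm (grad_x \<phi> z)) * f (u z)
                - second_order_op p (\<lambda>i j. a $ i * a $ j) \<phi> z) \<le> 0))"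

definition viscosity_supersolution ::
    "real \<Rightarrow> (real \<Rightarrow> real) \<Rightarrow> ereal \<Rightarrow> ((real ^ 'n) \<times> real \<Rightarrow> real) \<Rightarrow> bool" where
  "viscosity_supersolution p f T u \<longleftrightarrow>
     continuous_on (UNIV \<times> open_times T) u \<and>
     bounded (u ` (UNIV \<times> open_times T)) \<and>
     (\<forall>\<phi>. \<forall>z\<in>UNIV \<times> open_times T.
        C2_on (UNIV \<times> open_times T) \<phi> \<and>
        (\<forall>\<^sub>F y in nhds z. u y - \<phi> y \<ge> u z - \<phi> z) \<longrightarrow>
        (grad_x \<phi> z \<noteq> 0 \<longrightarrow>
           partial_t \<phi> z + pow_2mp p (norm (grad_x \<phi> z)) * f (u z)
             \<ge> second_order_op p
                  (\<lambda>i j. partial_x i \<phi> z * partial_x j \<phi> z / (norm (grad_x \<phi> z))\<^sup>2) \<phi> z) \<and>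
        (grad_x \<phi> z = 0 \<longrightarrow>
           (SUP a\<in>{a :: real ^ 'n. norm a = 1}.
              partial_t \<phi> z + pow_2mp p (norm (grad_x \<phi> z)) * f (u z)
                - second_order_op p (\<lambda>i j. a $ i * a $ j) \<phi> z) \<ge> 0))"

definition viscosity_solution ::
    "real \<Rightarrow> (real \<Rightarrow> real) \<Rightarrow> ereal \<Rightarrow> ((real ^ 'n) \<times> real \<Rightarrow> real) \<Rightarrow> bool" where
  "viscosity_solution p f T u \<longleftrightarrow>
     viscosity_subsolution p f T u \<and> viscosity_supersolution p f T u"

end

theory Submission
  imports Defs
begin

text \<open>Replacing \<open>F\<close> by \<open>F + \<delta>\<close> changes neither the equation nor the hypothesis, so \<open>F\<close> may be taken positive.
  Then \<open>v = \<Phi>(u)\<close> with \<open>\<Phi>' = (p/(p-1) F)\<^sup>-\<^sup>1\<^sup>/\<^sup>p\<close> is bounded, the gradient bound reads \<open>|Dv| \<le> 1\<close>, and the equation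
  becomes \<open>v\<^sub>t = (\<delta>\<^sub>i\<^sub>j + (p-2) v\<^sub>i v\<^sub>j/|Dv|\<^sup>2) v\<^sub>i\<^sub>j + h (|Dv|\<^sup>2 - |Dv|\<^sup>2\<^sup>-\<^sup>p)\<close> with \<open>h\<close> bounded, whose first-order term vanishes
  where \<open>|Dv| = 1\<close>. Doubling the variables in \<open>v(x,t) - v(y,t) - |x - y|\<close> shows that \<open>v(\<cdot>,t)\<close> stays
  1-Lipschitz. At a penalised maximum both slopes are close to the same unit vector, so only the second-order parts remain,
  and these are compared by the theorem on sums. Almost everywhere gradient bounds and
  Lipschitz bounds are exchanged by Rademacher's theorem and Fubini's theorem on lines. The second-order expansions
  in the theorem on sums also come from Rademacher's theorem, applied to the gradient of a convex conjugate.\<close>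

section \<open>Lipschitz functions on the real line\<close>

text \<open>The shift by \<delta> is forced by the zeros of \<open>F\<close>, where the derivative
  of \<Phi> would be infinite; the final bound carries an error \<open>p/(p-1) * \<delta>\<close>,
  which is sent to 0. The factor \<open>p/(p-1)\<close> is what makes the two first-order powers of
  \<open>|Dv|\<close> share one coefficient, so that they cancel at slope 1. In the doubling, the
  cone \<open>|x - y|\<close> is singular on the diagonal and the diffusion matrix is singular at
  slope 0. Neither is met: a violation of the contraction forces \<open>|x - y| \<ge> r0\<close> at
  the maximum, with \<open>r0\<close> chosen before the spatial penalty \<kappa>, and small \<kappa>
  keeps both slopes near unit vectors. The singular part of the second-order error is then of the
  order of the squared slope error divided by \<open>r0\<close>; the other errors also vanish with
  \<kappa>, and the strict gain \<open>\<sigma>/(T1 - t)^2\<close> from the time penalty beats them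
  all. Time is doubled as well, and the theorem on sums is applied in all space-time variables at
  once; one fixed \<mu> suffices, since \<open>|t - s|\<close> only has to fall below a modulus of
  continuity.\<close>

text \<open>The balls with controlled image cover \<open>S\<close> finely, so Vitali's theorem picks
  countably many disjoint ones that miss only a null part of \<open>S\<close>. Disjointness inside
  \<open>U\<close> turns the sum of the image bounds into \<open>k\<close> times the measure of
  \<open>U\<close>, and the missed part is harmless because \<open>g\<close> preserves null sets.
  \<open>S\<close> may be nonmeasurable, hence the measurable superset \<open>T\<close> in the
  conclusion.\<close>

lemma Vitali_image_bound:
  fixes g :: "'a::euclidean_space \<Rightarrow> 'a"
  assumes U: "U \<in> lmeasurable" and k: "k \<ge> 0"
    and neg: "\<And>N. negligible N \<Longrightarrow> negligible (g ` N)"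
    and cov: "\<And>x d. x \<in> S \<Longrightarrow> d > 0 \<Longrightarrow> \<exists>a r V. 0 < r \<and> r < d \<and> x \<in> cball a r \<and> cball a r \<subseteq> U \<and>
                g ` (S \<inter> cball a r) \<subseteq> V \<and> V \<in> lmeasurable \<and> measure lebesgue V \<le> k * measure lebesgue (cball a r)"
  shows "\<exists>T. g ` S \<subseteq> T \<and> T \<in> lmeasurable \<and> measure lebesgue T \<le> k * measure lebesgue U"
proof -
  let ?\<mu> = "measure lebesgue"
  let ?P = "\<lambda>p V. g ` (S \<inter> cball (fst p) (snd p)) \<subseteq> V \<and> V \<in> lmeasurable \<and> ?\<mu> V \<le> k * ?\<mu> (cball (fst p) (snd p))"
  let ?K = "{p :: 'a \<times> real. 0 < snd p \<and> cball (fst p) (snd p) \<subseteq> U \<and> (\<exists>V. ?P p V)}"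
  obtain C where "countable C" and Csub: "C \<subseteq> ?K"
    and pwC: "pairwise (\<lambda>i j. disjnt (cball (fst i) (snd i)) (cball (fst j) (snd j))) C"
    and negC: "negligible (S - (\<Union>i \<in> C. cball (fst i) (snd i)))"
  proof (rule Vitali_covering_theorem_cballs [of ?K snd S fst])
    fix x and d :: real assume "x \<in> S" "0 < d"
    from cov[OF this] obtain a r V where "0 < r" "r < d" "x \<in> cball a r" "cball a r \<subseteq> U" "?P (a, r) V"
      by auto
    then show "\<exists>i. i \<in> ?K \<and> x \<in> cball (fst i) (snd i) \<and> snd i < d"
      by (intro exI[of _ "(a, r)"]) auto
  qed auto
  have "\<forall>p\<in>C. \<exists>V. ?P p V" using Csub by blast
  then obtain V where V: "\<And>p. p \<in> C \<Longrightarrow> ?P p (V p)" by metis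
  have bnd: "?\<mu> (\<Union>i\<in>I. V i) \<le> k * ?\<mu> U" if "I \<subseteq> C" "finite I" for I
  proof -
    have "?\<mu> (\<Union>i\<in>I. V i) \<le> (\<Sum>i\<in>I. ?\<mu> (V i))"
      using that V by (blast intro: measure_UNION_le)
    also have "\<dots> \<le> (\<Sum>i\<in>I. k * ?\<mu> (cball (fst i) (snd i)))"
      by (rule sum_mono) (use that V in force)
    also have "\<dots> = k * (\<Sum>i\<in>I. ?\<mu> (cball (fst i) (snd i)))"
      by (simp add: sum_distrib_left)
    also have "(\<Sum>i\<in>I. ?\<mu> (cball (fst i) (snd i))) = ?\<mu> (\<Union>i\<in>I. cball (fst i) (snd i))"
      by (rule measure_UNION'[symmetric]) (use that pwC in \<open>auto elim: pairwise_mono\<close>)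
    also have "\<dots> \<le> ?\<mu> U"
      by (rule measure_mono_fmeasurable) (use that Csub U in \<open>force simp: sets.finite_UN\<close>)+
    finally show ?thesis using k by (simp add: mult_left_mono)
  qed
  have "\<Union>(V ` C) \<in> lmeasurable" and le: "?\<mu> (\<Union>(V ` C)) \<le> k * ?\<mu> U"
    using V bnd by (auto intro!: fmeasurable_UN_bound [OF \<open>countable C\<close>] measure_UN_bound [OF \<open>countable C\<close>])
  let ?N = "g ` (S - (\<Union>i \<in> C. cball (fst i) (snd i)))"
  have "negligible ?N" using neg negC by blast
  moreover have "g ` S \<subseteq> \<Union>(V ` C) \<union> ?N"
    using V by blast
  ultimately show ?thesis
    using \<open>\<Union>(V ` C) \<in> lmeasurable\<close> le
    by (intro exI[of _ "\<Union>(V ` C) \<union> ?N"])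
      (simp add: fmeasurable.Un negligible_imp_measurable measure_Un_null_set negligible_iff_null_sets[symmetric] fmeasurableD)
qed

lemma lmeasurable_outer_open_le:
  assumes "T \<in> lmeasurable" "e > 0"
  shows "\<exists>U. open U \<and> T \<subseteq> U \<and> U \<in> lmeasurable \<and> measure lebesgue U \<le> measure lebesgue T + e"
proof -
  obtain U where U: "open U" "T \<subseteq> U" "U - T \<in> lmeasurable" "emeasure lebesgue (U - T) < ennreal e"
    using sets_lebesgue_outer_open assms by (metis fmeasurableD)
  have "U = T \<union> (U - T)" using U by auto
  then have m: "U \<in> lmeasurable" using U assms by (metis fmeasurable.Un)
  have "measure lebesgue (U - T) < e"
    using U assms by (simp add: emeasure_eq_measure2 ennreal_less_iff)
  moreover have "measure lebesgue U \<le> measure lebesgue T + measure lebesgue (U - T)"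
    by (metis \<open>U = T \<union> (U - T)\<close> U(3) assms(1) fmeasurableD measure_Un_le)
  ultimately show ?thesis using U m by (intro exI[of _ U]) auto
qed

text \<open>The infimum \<open>s\<close> over open supersets is the outer measure of
  \<open>S\<close>. Applying the contraction to a nearly optimal \<open>U\<close> gives
  \<open>s \<le> k * s\<close> up to arbitrarily small errors, so \<open>s = 0\<close>.\<close>

lemma negligible_outer_contraction:
  assumes k: "k < 1" and U0: "open U0" "U0 \<in> lmeasurable" "S \<subseteq> U0"
    and step: "\<And>U e. open U \<Longrightarrow> U \<in> lmeasurable \<Longrightarrow> S \<subseteq> U \<Longrightarrow> 0 < e \<Longrightarrow>
       \<exists>T. S \<subseteq> T \<and> T \<in> lmeasurable \<and> measure lebesgue T \<le> k * measure lebesgue U + e"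
  shows "negligible S"
proof -
  define M where "M = {measure lebesgue U |U. open U \<and> U \<in> lmeasurable \<and> S \<subseteq> U}"
  define s where "s = Inf M"
  have ne: "M \<noteq> {}" and bd: "bdd_below M"
    using U0 by (auto simp: M_def intro!: bdd_belowI[of _ 0])
  have s: "s \<le> m" if "m \<in> M" for m unfolding s_def by (rule cInf_lower[OF that bd])
  have apx: "\<exists>m\<in>M. m < s + e" if "e > 0" for e
    using cInf_lessD[OF ne, of "s + e"] that unfolding s_def by auto
  have "s \<ge> 0" unfolding s_def by (rule cInf_greatest[OF ne]) (auto simp: M_def)
  have key: "s \<le> k * m + e" if "m \<in> M" "e > 0" for m e
  proof -
    from that(1)[unfolded M_def mem_Collect_eq]
    obtain U where U: "m = measure lebesgue U \<and> open U \<and> U \<in> lmeasurable \<and> S \<subseteq> U" ..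
    have "e / 2 > 0" using that(2) by simp
    then obtain T where T: "S \<subseteq> T \<and> T \<in> lmeasurable \<and> measure lebesgue T \<le> k * measure lebesgue U + e / 2"
      using step[of U "e / 2"] U by metis
    obtain U' where U': "open U' \<and> T \<subseteq> U' \<and> U' \<in> lmeasurable \<and> measure lebesgue U' \<le> measure lebesgue T + e / 2"
      using lmeasurable_outer_open_le[of T "e / 2"] T \<open>e / 2 > 0\<close> by metis
    have "measure lebesgue U' \<in> M" unfolding M_def mem_Collect_eq using U' T by (intro exI[of _ U']) auto
    from s[OF this] have "s \<le> measure lebesgue T + e / 2" using U' by linarith
    then have "s \<le> k * measure lebesgue U + e" using T by linarith
    then show ?thesis using U by simp
  qed
  have "s \<le> 0"
  proof (rule ccontr)
    assume "\<not> s \<le> 0"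
    then have sp: "s > 0" by simp
    \<comment> \<open>The two errors below cost \<open>2 * e\<close> together, whereas
      \<open>s - k * s = 3 * e\<close>.\<close>
    define e where "e = s * (1 - k) / 3"
    have e: "e > 0" using sp k by (simp add: e_def)
    obtain m where m: "m \<in> M" "m < s + e" using apx[OF e] by blast
    have m0: "m \<ge> s" using s m by blast
    have "s \<le> k * m + e" by (rule key[OF m(1) e])
    also have "k * m \<le> k * s + e"
    proof (cases "k \<ge> 0")
      case True
      then have "k * m \<le> k * (s + e)" using m by (intro mult_left_mono) auto
      moreover have "k * e \<le> 1 * e" using k e by (intro mult_right_mono) auto
      ultimately show ?thesis by (simp add: algebra_simps)
    next
      case False
      then have "k * m \<le> k * s" using m0 by (intro mult_left_mono_neg) auto
      then show ?thesis using e by simp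
    qed
    finally have "s \<le> k * s + 2 * e" by simp
    moreover have "3 * e = s * (1 - k)" by (simp add: e_def)
    then have "3 * e = s - k * s" by (simp add: algebra_simps)
    ultimately show False using e by linarith
  qed
  show ?thesis unfolding negligible_outer_le
  proof (intro allI impI)
    fix e :: real assume "e > 0"
    from apx[OF this] obtain m where m: "m \<in> M" "m < s + e" by blast
    from m(1)[unfolded M_def mem_Collect_eq]
    obtain U where U: "m = measure lebesgue U \<and> open U \<and> U \<in> lmeasurable \<and> S \<subseteq> U" ..
    with \<open>s \<le> 0\<close> m(2) show "\<exists>T. S \<subseteq> T \<and> T \<in> lmeasurable \<and> measure lebesgue T \<le> e"
      by (intro exI[of _ U]) auto
  qed
qed

text \<open>Each slope condition compares the outer measures of \<open>S\<close> and \<open>f ` S\<close>, the second one through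
  the inverse of \<open>f\<close>; together they contract the outer measure of \<open>S\<close> by \<open>a / b\<close>.\<close>

lemma negligible_two_slopes:
  fixes f g :: "real \<Rightarrow> real"
  assumes lf: "L-lipschitz_on UNIV f" and lg: "1-lipschitz_on UNIV g"
    and gf: "\<And>x. g (f x) = x" and fg: "\<And>x. f (g x) = x"
    and mono: "strict_mono f"
    and ab: "0 < a" "a < b" and S: "bounded S"
    and low: "\<And>x d. x \<in> S \<Longrightarrow> d > 0 \<Longrightarrow> \<exists>y. y \<noteq> x \<and> \<bar>y - x\<bar> < d \<and> (f y - f x) / (y - x) < a"
    and up: "\<And>x d. x \<in> S \<Longrightarrow> d > 0 \<Longrightarrow> \<exists>y. y \<noteq> x \<and> \<bar>y - x\<bar> < d \<and> (f y - f x) / (y - x) > b"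
  shows "negligible S"
proof -
  have cb: "cball ((x + y) / 2) (\<bar>y - x\<bar> / 2) = {min x y..max x y}" for x y :: real
    by (cases "x \<le> y") (simp_all add: cball_eq_atLeastAtMost min_def max_def field_simps)
  have mi: "f x < f y \<longleftrightarrow> x < y" "f x \<le> f y \<longleftrightarrow> x \<le> y" for x y
    using mono by (auto simp: strict_mono_less strict_mono_less_eq)
  have gmi: "g x < g y \<longleftrightarrow> x < y" "g x \<le> g y \<longleftrightarrow> x \<le> y" for x y
    using mi[of "g x" "g y"] by (auto simp: fg)
  \<comment> \<open>Applied to \<open>f\<close> with factor \<open>a\<close> and to \<open>g\<close>
    with factor \<open>1 / b\<close>. The interval between \<open>x\<close> and \<open>y\<close> is
    a ball around the midpoint, and by monotonicity its image stays in the interval between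
    \<open>h x\<close> and \<open>h y\<close>.\<close>
  have image: "\<exists>T. h ` A \<subseteq> T \<and> T \<in> lmeasurable \<and> measure lebesgue T \<le> k * measure lebesgue U"
    if U: "open U" "U \<in> lmeasurable" "A \<subseteq> U" and k: "k > 0"
      and lh: "\<exists>L. L-lipschitz_on UNIV h" and hm: "\<And>x y. h x < h y \<longleftrightarrow> x < y" "\<And>x y. h x \<le> h y \<longleftrightarrow> x \<le> y"
      and sl: "\<And>x d. x \<in> A \<Longrightarrow> d > 0 \<Longrightarrow> \<exists>y. y \<noteq> x \<and> \<bar>y - x\<bar> < d \<and> \<bar>h y - h x\<bar> \<le> k * \<bar>y - x\<bar>"
    for U A k and h :: "real \<Rightarrow> real"
  proof (rule Vitali_image_bound)
    show "U \<in> lmeasurable" "0 \<le> k" using U k by auto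
    show "negligible (h ` N)" if "negligible N" for N
    proof (rule negligible_locally_Lipschitz_image[OF _ that])
      obtain L where L: "L-lipschitz_on UNIV h" using lh by blast
      show "\<exists>T B. open T \<and> x \<in> T \<and> (\<forall>y\<in>N \<inter> T. norm (h y - h x) \<le> B * norm (y - x))" for x
        using lipschitz_onD[OF L] by (intro exI[of _ UNIV] exI[of _ L]) (auto simp: dist_norm)
    qed auto
    fix x d :: real assume x: "x \<in> A" and d: "d > 0"
    obtain r where r: "r > 0" "cball x r \<subseteq> U" using U x open_contains_cball by blast
    obtain y where y: "y \<noteq> x" "\<bar>y - x\<bar> < min d r" "\<bar>h y - h x\<bar> \<le> k * \<bar>y - x\<bar>"
      using sl[OF x, of "min d r"] d r by auto
    have 1: "cball ((x + y) / 2) (\<bar>y - x\<bar> / 2) \<subseteq> U"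
      using r(2) y(2) unfolding cb by (auto simp: dist_real_def subset_eq)
    have 2: "x \<in> cball ((x + y) / 2) (\<bar>y - x\<bar> / 2)" unfolding cb by auto
    have 3: "h ` (A \<inter> cball ((x + y) / 2) (\<bar>y - x\<bar> / 2)) \<subseteq> {min (h x) (h y)..max (h x) (h y)}"
      unfolding cb by (auto simp: hm min_def max_def)
    have "measure lebesgue {min (h x) (h y)..max (h x) (h y)} = \<bar>h y - h x\<bar>"
      by (auto simp: min_def max_def)
    also have "\<dots> \<le> k * measure lebesgue (cball ((x + y) / 2) (\<bar>y - x\<bar> / 2))"
      unfolding cb using y(3) by (auto simp: min_def max_def abs_if split: if_splits)
    finally have 4: "measure lebesgue {min (h x) (h y)..max (h x) (h y)}
       \<le> k * measure lebesgue (cball ((x + y) / 2) (\<bar>y - x\<bar> / 2))" .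
    have 5: "0 < \<bar>y - x\<bar> / 2" "\<bar>y - x\<bar> / 2 < d" using y by auto
    have 6: "{min (h x) (h y)..max (h x) (h y)} \<in> lmeasurable" by (rule lmeasurable_interval)
    show "\<exists>a r V. 0 < r \<and> r < d \<and> x \<in> cball a r \<and> cball a r \<subseteq> U \<and> h ` (A \<inter> cball a r) \<subseteq> V \<and>
          V \<in> lmeasurable \<and> measure lebesgue V \<le> k * measure lebesgue (cball a r)"
      by (rule exI, rule exI, rule exI, intro conjI) (rule 5 2 1 3 6 4)+
  qed
  obtain R where R: "R > 0" "S \<subseteq> ball 0 R" using S by (meson bounded_subset_ballD)
  show ?thesis
  proof (rule negligible_outer_contraction[of "a/b" "ball 0 R"])
    fix U :: "real set" and e :: real assume U: "open U" "U \<in> lmeasurable" "S \<subseteq> U" and e: "e > 0"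
    have "\<exists>T. f ` S \<subseteq> T \<and> T \<in> lmeasurable \<and> measure lebesgue T \<le> a * measure lebesgue U"
    proof (rule image[OF U ab(1)])
      show "\<exists>L. L-lipschitz_on UNIV f" using lf by blast
      fix x y show "f x < f y \<longleftrightarrow> x < y" "f x \<le> f y \<longleftrightarrow> x \<le> y" by (fact mi)+
    next
      fix x d :: real assume "x \<in> S" "d > 0"
      from low[OF this] obtain y where y: "y \<noteq> x" "\<bar>y - x\<bar> < d" "(f y - f x) / (y - x) < a" by blast
      moreover have "\<bar>f y - f x\<bar> = (f y - f x) / (y - x) * \<bar>y - x\<bar>"
        using y(1) mi(1)[of x y] mi(1)[of y x] by (cases "x < y") (auto simp: abs_if field_simps)
      moreover have "(f y - f x) / (y - x) * \<bar>y - x\<bar> \<le> a * \<bar>y - x\<bar>"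
        using y(3) by (intro mult_right_mono) auto
      ultimately show "\<exists>y. y \<noteq> x \<and> \<bar>y - x\<bar> < d \<and> \<bar>f y - f x\<bar> \<le> a * \<bar>y - x\<bar>"
        by metis
    qed
    then obtain T where T: "f ` S \<subseteq> T" "T \<in> lmeasurable" "measure lebesgue T \<le> a * measure lebesgue U" by blast
    obtain U' where U': "open U'" "T \<subseteq> U'" "U' \<in> lmeasurable" "measure lebesgue U' \<le> measure lebesgue T + b * e"
      using lmeasurable_outer_open_le[OF T(2), of "b * e"] e ab by auto
    have "\<exists>T. g ` f ` S \<subseteq> T \<and> T \<in> lmeasurable \<and> measure lebesgue T \<le> 1/b * measure lebesgue U'"
    proof (rule image[OF U'(1,3) order.trans[OF T(1) U'(2)]])
      show "0 < 1 / b" using ab by simp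
      show "\<exists>L. L-lipschitz_on UNIV g" using lg by blast
      fix x y show "g x < g y \<longleftrightarrow> x < y" "g x \<le> g y \<longleftrightarrow> x \<le> y" by (fact gmi)+
    next
      fix z d :: real assume z: "z \<in> f ` S" and d: "d > 0"
      then obtain x where x: "x \<in> S" "z = f x" by auto
      have Lp: "L \<ge> 0" using lf lipschitz_on_nonneg by blast
      \<comment> \<open>The radius \<open>d / (L + 1)\<close> keeps \<open>f y\<close> within
        \<open>d\<close> of \<open>f x\<close>; the summand 1 covers \<open>L = 0\<close>.\<close>
      obtain y where y: "y \<noteq> x" "\<bar>y - x\<bar> < d / (L + 1)" "(f y - f x) / (y - x) > b"
        using up[OF x(1), of "d / (L + 1)"] d Lp by auto
      have 1: "\<bar>f y - f x\<bar> = (f y - f x) / (y - x) * \<bar>y - x\<bar>"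
        using y(1) mi(1)[of x y] mi(1)[of y x] by (cases "x < y") (auto simp: abs_if field_simps)
      have "b * \<bar>y - x\<bar> \<le> \<bar>f y - f x\<bar>" unfolding 1 using y by (intro mult_right_mono) auto
      then have "\<bar>y - x\<bar> \<le> 1/b * \<bar>f y - f x\<bar>" using ab by (simp add: pos_le_divide_eq mult.commute)
      then have 2: "\<bar>g (f y) - g z\<bar> \<le> 1/b * \<bar>f y - z\<bar>" by (simp only: gf x)
      have "\<bar>f y - f x\<bar> \<le> L * \<bar>y - x\<bar>" using lipschitz_onD[OF lf, of y x] by (simp add: dist_real_def)
      also have "\<dots> \<le> (L + 1) * \<bar>y - x\<bar>" by (intro mult_right_mono) auto
      also have "\<dots> < d" using y(2) Lp by (simp add: pos_less_divide_eq mult.commute)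
      finally have 3: "\<bar>f y - z\<bar> < d" using x by simp
      have "f y \<noteq> z" using y x gf by metis
      with 2 3 show "\<exists>y. y \<noteq> z \<and> \<bar>y - z\<bar> < d \<and> \<bar>g y - g z\<bar> \<le> 1/b * \<bar>y - z\<bar>" by blast
    qed
    then obtain V where V: "g ` f ` S \<subseteq> V" "V \<in> lmeasurable" "measure lebesgue V \<le> 1/b * measure lebesgue U'" by blast
    have "measure lebesgue V \<le> 1/b * (a * measure lebesgue U + b * e)"
      using V(3) mult_left_mono[of "measure lebesgue U'" "a * measure lebesgue U + b * e" "1/b"] U'(4) T(3) ab by simp
    then have "measure lebesgue V \<le> a / b * measure lebesgue U + e" using ab by (simp add: field_simps)
    moreover have "S \<subseteq> V" using V(1) by (simp add: image_image gf)
    ultimately show "\<exists>T. S \<subseteq> T \<and> T \<in> lmeasurable \<and> measure lebesgue T \<le> a / b * measure lebesgue U + e"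
      using V(2) by blast
  qed (use R ab in simp_all)
qed

section \<open>Derivatives almost everywhere and the mean value inequality on the line\<close>

text \<open>Where the lower and upper derivates differ, a rational pair fits strictly between them;
  each pair gives a null set by \<open>negligible_two_slopes\<close>, and there are countably many
  pairs.\<close>

lemma negligible_nondifferentiable_lipschitz_real:
  fixes f :: "real \<Rightarrow> real"
  assumes L: "L-lipschitz_on UNIV f"
  shows "negligible {x. \<not> f differentiable (at x)}"
proof -
  \<comment> \<open>The linear term forces slopes of at least 1, so \<open>f1\<close> is a bijection
    of the line with 1-Lipschitz inverse; differentiability is unaffected.\<close>
  define f1 where "f1 x = f x + (L + 1) * x" for x
  have L0: "L \<ge> 0" using L lipschitz_on_nonneg by blast
  have fl: "\<bar>f y - f x\<bar> \<le> L * \<bar>y - x\<bar>" for x y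
    using lipschitz_onD[OF L, of y x] by (simp add: dist_real_def)
  have low: "f1 y - f1 x \<ge> y - x" if "x \<le> y" for x y
  proof -
    have "f x - f y \<le> L * (y - x)" using fl[of y x] that by simp
    then show ?thesis by (simp add: f1_def algebra_simps)
  qed
  have sm: "strict_mono f1"
  proof (rule strict_monoI)
    fix x y :: real assume "x < y"
    then show "f1 x < f1 y" using low[of x y] by simp
  qed
  have lf1: "(2 * L + 1)-lipschitz_on UNIV f1"
  proof (rule lipschitz_onI)
    fix x y :: real
    have "\<bar>f1 x - f1 y\<bar> \<le> \<bar>f x - f y\<bar> + \<bar>(L + 1) * (x - y)\<bar>" by (simp add: f1_def algebra_simps)
    also have "\<bar>(L + 1) * (x - y)\<bar> = (L + 1) * \<bar>x - y\<bar>" using L0 by (simp add: abs_mult)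
    also have "\<bar>f x - f y\<bar> + (L + 1) * \<bar>x - y\<bar> \<le> (2 * L + 1) * \<bar>x - y\<bar>"
      using fl[of x y] fl[of y x] by (simp add: ring_distribs)
    finally show "dist (f1 x) (f1 y) \<le> (2 * L + 1) * dist x y" by (simp add: dist_real_def)
  qed (use L0 in auto)
  have cont: "continuous_on UNIV f1" using lipschitz_on_continuous_on lf1 by blast
  have surj: "\<exists>x. f1 x = y" for y
  proof -
    let ?R = "\<bar>y - f1 0\<bar>"
    have "f1 (- ?R) \<le> y" "y \<le> f1 ?R" using low[of 0 ?R] low[of "- ?R" 0] by auto
    then have "\<exists>x. - ?R \<le> x \<and> x \<le> ?R \<and> f1 x = y"
      by (intro IVT' continuous_on_subset[OF cont]) auto
    then show ?thesis by blast
  qed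
  define g where "g = inv f1"
  have gf: "g (f1 x) = x" for x unfolding g_def using sm by (simp add: strict_mono_imp_inj_on)
  have fg: "f1 (g y) = y" for y unfolding g_def using surj by (metis f_inv_into_f rangeI)
  have lg: "1-lipschitz_on UNIV g"
  proof (rule lipschitz_onI)
    fix x y
    show "dist (g x) (g y) \<le> 1 * dist x y"
      using low[of "g x" "g y"] low[of "g y" "g x"] by (cases "g x \<le> g y") (auto simp: dist_real_def fg)
  qed simp
  define q where "q x y = (f1 y - f1 x) / (y - x)" for x y
  define E where "E a b = {x. (\<forall>d>0. \<exists>y. y \<noteq> x \<and> \<bar>y - x\<bar> < d \<and> q x y < a) \<and> (\<forall>d>0. \<exists>y. y \<noteq> x \<and> \<bar>y - x\<bar> < d \<and> q x y > b)}" for a b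
  have negE: "negligible (E a b \<inter> ball 0 (real n))" if "a < b" "0 < a" for a b n
    by (rule negligible_two_slopes[OF lf1 lg gf fg sm that(2,1)]) (auto simp: E_def q_def bounded_Int)
  have q1: "1 \<le> q x y \<and> q x y \<le> 2 * L + 1" if "y \<noteq> x" for x y
  proof (cases "x < y")
    case True
    have "f1 y - f1 x \<le> (2 * L + 1) * (y - x)" using lipschitz_onD[OF lf1, of y x] True by (auto simp: dist_real_def)
    then show ?thesis using low[of x y] True by (simp add: q_def pos_divide_le_eq)
  next
    case False
    then have lt: "y < x" using that by simp
    have eq: "q x y = (f1 x - f1 y) / (x - y)" unfolding q_def by (metis minus_diff_eq minus_divide_divide)
    have "f1 x - f1 y \<le> (2 * L + 1) * (x - y)" using lipschitz_onD[OF lf1, of x y] lt by (auto simp: dist_real_def)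
    then show ?thesis using low[of y x] lt by (simp add: eq pos_divide_le_eq)
  qed
  let ?I = "{ab \<in> \<rat> \<times> \<rat>. 0 < fst ab \<and> fst ab < snd ab}"
  have "{x. \<not> f differentiable (at x)} \<subseteq> (\<Union>ab\<in>?I. \<Union>n. E (fst ab) (snd ab) \<inter> ball 0 (real n))"
  proof
    fix x assume "x \<in> {x. \<not> f differentiable (at x)}"
    then have nd: "\<not> f differentiable (at x)" by simp
    \<comment> \<open>\<open>l\<close> is the upper derivate of \<open>f1\<close> at
      \<open>x\<close>, written as the infimum of the eventual upper bounds of the quotients. If no
      pair separates the quotients, every positive \<open>a < l\<close> is eventually a lower bound,
      so they converge to \<open>l\<close>.\<close>
    define B where "B = {b. \<exists>d>0. \<forall>y. y \<noteq> x \<and> \<bar>y - x\<bar> < d \<longrightarrow> q x y \<le> b}"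
    define l where "l = Inf B"
    have Bne: "2 * L + 1 \<in> B" unfolding B_def using q1 by (auto intro!: exI[of _ 1])
    have B1: "1 \<le> b" if b: "b \<in> B" for b
    proof -
      obtain d where d: "d > 0" "\<forall>y. y \<noteq> x \<and> \<bar>y - x\<bar> < d \<longrightarrow> q x y \<le> b" using b by (auto simp: B_def)
      then have "q x (x + d/2) \<le> b" by auto
      moreover have "x + d/2 \<noteq> x" using d by simp
      ultimately show ?thesis using q1 by (meson order_trans)
    qed
    have l1: "1 \<le> l" unfolding l_def using Bne B1 by (intro cInf_greatest) auto
    have lB: "l \<le> b" if "b \<in> B" for b unfolding l_def using B1 by (intro cInf_lower[OF that]) (auto intro!: bdd_belowI[of _ 1])
    show "x \<in> (\<Union>ab\<in>?I. \<Union>n. E (fst ab) (snd ab) \<inter> ball 0 (real n))"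
    proof (cases "\<exists>a b. 0 < a \<and> a < b \<and> x \<in> E a b")
      case True
      then obtain a b where ab: "0 < a" "a < b" "x \<in> E a b" by blast
      obtain r s where rs: "r \<in> \<rat>" "s \<in> \<rat>" "a < r" "r < s" "s < b"
        by (metis Rats_dense_in_real ab(2))
      have "x \<in> E r s" unfolding E_def mem_Collect_eq
      proof (intro conjI allI impI)
        fix d :: real assume "d > 0"
        with ab(3) obtain y where "y \<noteq> x" "\<bar>y - x\<bar> < d" "q x y < a" by (auto simp: E_def)
        with rs show "\<exists>y. y \<noteq> x \<and> \<bar>y - x\<bar> < d \<and> q x y < r" by (intro exI[of _ y]) auto
      next
        fix d :: real assume "d > 0"
        with ab(3) obtain y where "y \<noteq> x" "\<bar>y - x\<bar> < d" "q x y > b" unfolding E_def by blast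
        with rs show "\<exists>y. y \<noteq> x \<and> \<bar>y - x\<bar> < d \<and> q x y > s" by (intro exI[of _ y]) auto
      qed
      moreover obtain n where "\<bar>x\<bar> < real n" using reals_Archimedean2 by blast
      ultimately show ?thesis using rs ab by (intro UN_I[of "(r, s)"] UN_I[of n]) (auto simp: dist_real_def)
    next
      case False
      have lower: "\<exists>d>0. \<forall>y. y \<noteq> x \<and> \<bar>y - x\<bar> < d \<longrightarrow> q x y \<ge> a" if a: "0 < a" "a < l" for a
      proof -
        define a' where "a' = (a + l) / 2"
        have aa: "a < a'" "a' < l" using a by (auto simp: a'_def)
        have "a' \<notin> B" using lB[of a'] aa by linarith
        then have "\<forall>d>0. \<exists>y. y \<noteq> x \<and> \<bar>y - x\<bar> < d \<and> q x y > a'" unfolding B_def by (simp add: not_le)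
        moreover have "x \<notin> E a a'" using False aa a by blast
        ultimately have "\<not> (\<forall>d>0. \<exists>y. y \<noteq> x \<and> \<bar>y - x\<bar> < d \<and> q x y < a)" unfolding E_def by blast
        then show ?thesis by (meson not_le)
      qed
      have "(q x \<longlongrightarrow> l) (at x)"
      proof (rule order_tendstoI)
        fix c assume c: "c < l"
        define a where "a = max ((c + l) / 2) (1/2)"
        have a: "0 < a" "a < l" "c < a" using c l1 by (auto simp: a_def less_max_iff_disj)
        obtain d where d: "d > 0" "\<forall>y. y \<noteq> x \<and> \<bar>y - x\<bar> < d \<longrightarrow> q x y \<ge> a" using lower[OF a(1,2)] by blast
        have "\<forall>y. y \<noteq> x \<and> dist y x < d \<longrightarrow> c < q x y"
          using d(2) a(3) unfolding dist_real_def by (meson less_le_trans)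
        then show "\<forall>\<^sub>F y in at x. c < q x y" unfolding eventually_at using d(1) by blast
      next
        fix c assume "l < c"
        then obtain b where b: "b \<in> B" "b < c" using cInf_lessD[of B c] Bne unfolding l_def by auto
        obtain d where d: "d > 0" "\<forall>y. y \<noteq> x \<and> \<bar>y - x\<bar> < d \<longrightarrow> q x y \<le> b" using b(1) unfolding B_def by blast
        have "\<forall>y. y \<noteq> x \<and> dist y x < d \<longrightarrow> q x y < c"
          using d(2) b(2) unfolding dist_real_def by (meson le_less_trans)
        then show "\<forall>\<^sub>F y in at x. q x y < c" unfolding eventually_at using d(1) by blast
      qed
      then have "(f1 has_field_derivative l) (at x)" unfolding has_field_derivative_iff q_def by simp
      then have "((\<lambda>x. f1 x - (L + 1) * x) has_field_derivative l - (L + 1)) (at x)"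
        by (auto intro!: derivative_eq_intros)
      then have "(f has_field_derivative l - (L + 1)) (at x)" by (simp add: f1_def)
      then show ?thesis using nd real_differentiable_def by blast
    qed
  qed
  moreover have "negligible (\<Union>ab\<in>?I. \<Union>n. E (fst ab) (snd ab) \<inter> ball 0 (real n))"
  proof (rule negligible_countable_Union)
    have "countable ?I" by (rule countable_subset[of _ "\<rat> \<times> \<rat>"]) (auto intro: countable_rat)
    then show "countable ((\<lambda>ab. \<Union>n. E (fst ab) (snd ab) \<inter> ball 0 (real n)) ` ?I)" by (rule countable_image)
    fix X assume "X \<in> (\<lambda>ab. \<Union>n. E (fst ab) (snd ab) \<inter> ball 0 (real n)) ` ?I"
    then show "negligible X" by (force intro!: negligible_Union_nat negE)
  qed
  ultimately show ?thesis by (rule negligible_subset[rotated])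
qed

text \<open>Replaces the fundamental theorem of calculus without integrating the derivative. The
  measure \<open>m\<close> of a small open neighbourhood of \<open>N\<close> pays for the
  exceptional points: after subtraction of \<open>(L + |K|) * m\<close> the function can no longer
  start to increase, and the total payment is at most \<open>(L + |K|) * \<epsilon>\<close>.\<close>

lemma lipschitz_derivative_le_imp_le:
  fixes f :: "real \<Rightarrow> real"
  assumes L: "L-lipschitz_on UNIV f" and N: "negligible N" and ab: "a \<le> b"
    and der: "\<And>x. a \<le> x \<Longrightarrow> x < b \<Longrightarrow> x \<notin> N \<Longrightarrow> \<exists>D. (f has_field_derivative D) (at x) \<and> D \<le> K"
  shows "f b - f a \<le> K * (b - a)"
proof (rule field_le_epsilon)
  fix e :: real assume e: "e > 0"
  have L0: "L \<ge> 0" using L lipschitz_on_nonneg by blast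
  \<comment> \<open>Each of the errors \<open>\<eta> * (b - a)\<close> and
    \<open>(L + |K|) * \<epsilon>\<close> is at most \<open>e / 2\<close>; the summands 1 avoid
    division by zero.\<close>
  define \<eta> where "\<eta> = e / (2 * (b - a + 1))"
  define \<epsilon> where "\<epsilon> = e / (2 * (L + \<bar>K\<bar> + 1))"
  have ee: "\<eta> > 0" "\<epsilon> > 0" using e ab L0 by (auto simp: \<eta>_def \<epsilon>_def)
  obtain U where U: "open U" "N \<subseteq> U" "U \<in> lmeasurable" "measure lebesgue U \<le> \<epsilon>"
    using lmeasurable_outer_open_le[of N \<epsilon>] N ee by (auto simp: negligible_imp_measurable negligible_imp_measure0)
  define m where "m x = measure lebesgue (U \<inter> {a..x})" for x
  have Um: "U \<inter> {a..x} \<in> lmeasurable" for x using U by (simp add: fmeasurable.Int fmeasurableD)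
  have mm: "m x \<le> m y" if "x \<le> y" for x y
    unfolding m_def by (rule measure_mono_fmeasurable) (use that Um in \<open>auto simp: fmeasurableD\<close>)
  define h where "h x = f x - (K + \<eta>) * x - (L + \<bar>K\<bar>) * m x" for x
  text \<open>Off \<open>N\<close> the derivative bound makes \<open>h\<close> locally nonincreasing to the right, and near \<open>N\<close>
    the function \<open>m\<close> grows at unit rate.\<close>
  have loc: "\<exists>d>0. \<forall>y. x \<le> y \<and> y < x + d \<longrightarrow> h y \<le> h x" if x: "a \<le> x" "x < b" for x
  proof (cases "x \<in> N")
    case False
    then obtain D where D: "(f has_field_derivative D) (at x)" "D \<le> K" using der x by blast
    then have "((\<lambda>y. (f y - f x) / (y - x)) \<longlongrightarrow> D) (at x)" by (simp add: has_field_derivative_iff)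
    then have "\<forall>\<^sub>F y in at x. (f y - f x) / (y - x) < K + \<eta>"
      by (rule order_tendstoD) (use D ee in auto)
    then obtain d where d: "d > 0" "\<forall>y. y \<noteq> x \<and> \<bar>y - x\<bar> < d \<longrightarrow> (f y - f x) / (y - x) < K + \<eta>"
      unfolding eventually_at by (auto simp: dist_real_def)
    show ?thesis
    proof (intro exI conjI allI impI)
      fix y assume y: "x \<le> y \<and> y < x + d"
      show "h y \<le> h x"
      proof (cases "y = x")
        case False
        then have "(f y - f x) / (y - x) < K + \<eta>" "y > x" using d y by auto
        then have "f y - f x \<le> (K + \<eta>) * (y - x)" by (simp add: pos_divide_less_eq)
        moreover have "(L + \<bar>K\<bar>) * m x \<le> (L + \<bar>K\<bar>) * m y" using mm[of x y] y L0 by (intro mult_left_mono) auto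
        ultimately show ?thesis by (simp add: h_def algebra_simps)
      qed simp
    qed (use d in simp)
  next
    case True
    then obtain d where d: "d > 0" "cball x d \<subseteq> U" using U open_contains_cball by blast
    show ?thesis
    proof (intro exI conjI allI impI)
      fix y assume y: "x \<le> y \<and> y < x + d"
      have "{x<..y} \<subseteq> cball x d" using y by (auto simp: dist_real_def)
      then have "U \<inter> {a..y} = U \<inter> {a..x} \<union> {x<..y}" using d(2) y x by auto
      then have "m y = measure lebesgue (U \<inter> {a..x} \<union> {x<..y})" by (simp only: m_def)
      also have "\<dots> = m x + measure lebesgue {x<..y}"
        unfolding m_def using Um[of x] by (intro measure_Un_AE) (auto intro!: lmeasurable_interval bounded_set_imp_lmeasurable)
      finally have my: "m y = m x + (y - x)" using y by simp
      have "f y - f x \<le> L * (y - x)" using lipschitz_onD[OF L, of y x] y by (auto simp: dist_real_def)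
      moreover have "- K * (y - x) \<le> \<bar>K\<bar> * (y - x)" using y by (intro mult_right_mono) auto
      moreover have "0 \<le> \<eta> * (y - x)" using ee y by simp
      ultimately show "h y \<le> h x" unfolding h_def my by (simp add: algebra_simps)
    qed (use d in simp)
  qed
  \<comment> \<open>Continuous induction: the supremum of the points with
    \<open>h x \<le> h a\<close> is such a point itself by the one-sided bound
    \<open>h s - h x \<le> C * (s - x)\<close>, and \<open>loc\<close> would carry it further unless
    it is \<open>b\<close>.\<close>
  have hb: "h b \<le> h a"
  proof -
    define X where "X = {x. a \<le> x \<and> x \<le> b \<and> h x \<le> h a}"
    define s where "s = Sup X"
    have aX: "a \<in> X" using ab by (simp add: X_def)
    have bd: "bdd_above X" by (auto simp: X_def intro!: bdd_aboveI[of _ b])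
    have sX: "x \<le> s" if "x \<in> X" for x unfolding s_def by (rule cSup_upper[OF that bd])
    have s: "a \<le> s" "s \<le> b" using sX[OF aX] aX unfolding s_def by (auto intro!: cSup_least simp: X_def)
    have "h s \<le> h a"
    proof (rule field_le_epsilon)
      fix \<delta> :: real assume \<delta>: "\<delta> > 0"
      define C where "C = L + \<bar>K\<bar> + \<eta> + 1"
      have C: "C > 0" using L0 ee by (simp add: C_def)
      obtain x where x: "x \<in> X" "s - \<delta> / C < x" using less_cSupD[of X "s - \<delta> / C"] aX \<delta> C unfolding s_def by auto
      have xs: "x \<le> s" by (rule sX[OF x(1)])
      have "f s - f x \<le> L * (s - x)" using lipschitz_onD[OF L, of s x] xs by (auto simp: dist_real_def)
      moreover have "(L + \<bar>K\<bar>) * m x \<le> (L + \<bar>K\<bar>) * m s" using mm[OF xs] L0 by (intro mult_left_mono) auto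
      moreover have "- K * (s - x) \<le> \<bar>K\<bar> * (s - x)" using xs by (intro mult_right_mono) auto
      moreover have "0 \<le> \<eta> * (s - x)" using ee xs by simp
      ultimately have "h s - h x \<le> C * (s - x)" using xs unfolding h_def C_def ring_distribs by linarith
      also have "\<dots> \<le> \<delta>" using x C by (simp add: pos_divide_less_eq field_simps)
      finally show "h s \<le> h a + \<delta>" using x by (simp add: X_def)
    qed
    have "s = b"
    proof (rule ccontr)
      assume "s \<noteq> b"
      then obtain d where d: "d > 0" "\<forall>y. s \<le> y \<and> y < s + d \<longrightarrow> h y \<le> h s" using loc[of s] s by auto
      define y where "y = min b (s + d / 2)"
      have "s \<le> y" "y < s + d" "y \<le> b" using d s by (auto simp: y_def)
      then have "h y \<le> h s" using d by blast
      then have "y \<in> X" using \<open>h s \<le> h a\<close> \<open>s \<le> y\<close> \<open>y \<le> b\<close> s by (simp add: X_def)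
      then show False using sX[of y] d s \<open>s \<noteq> b\<close> by (auto simp: y_def)
    qed
    with \<open>h s \<le> h a\<close> show ?thesis by simp
  qed
  have "m b \<le> measure lebesgue U" unfolding m_def by (rule measure_mono_fmeasurable) (use Um U in \<open>auto simp: fmeasurableD\<close>)
  then have mb: "m b \<le> \<epsilon>" using U by simp
  have "m a \<ge> 0" by (simp add: m_def)
  have "f b - f a \<le> (K + \<eta>) * (b - a) + (L + \<bar>K\<bar>) * (m b - m a)" using hb by (simp add: h_def algebra_simps)
  also have "(L + \<bar>K\<bar>) * (m b - m a) \<le> (L + \<bar>K\<bar> + 1) * \<epsilon>" using mb \<open>m a \<ge> 0\<close> L0 mm[OF ab] by (intro mult_mono) auto
  also have "(L + \<bar>K\<bar> + 1) * \<epsilon> = e / 2" using L0 by (simp add: \<epsilon>_def field_simps)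
  also have "(K + \<eta>) * (b - a) = K * (b - a) + \<eta> * (b - a)" by (simp add: algebra_simps)
  also have "\<eta> * (b - a) \<le> \<eta> * (b - a + 1)" using ee by (intro mult_left_mono) auto
  also have "\<eta> * (b - a + 1) = e / 2" using ab by (simp add: \<eta>_def field_simps)
  finally show "f b - f a \<le> K * (b - a) + e" by simp
qed

section \<open>Rademacher's theorem\<close>

text \<open>Tonelli for the set of pairs \<open>(x, \<tau>)\<close> with
  \<open>x + \<tau> *\<^sub>R d \<in> B\<close>: for fixed \<tau> the slice is a translate of
  \<open>B\<close>, so the other order of integration gives the measure of \<open>B\<close> times
  infinity. This treats every direction \<open>d\<close> without rotating coordinates, and the value
  is 0 exactly when \<open>B\<close> is null.\<close>

lemma emeasure_lines:
  fixes B :: "'a::euclidean_space set"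
  assumes B: "B \<in> sets borel"
  shows "(\<integral>\<^sup>+x. emeasure lborel {\<tau>::real. x + \<tau> *\<^sub>R d \<in> B} \<partial>lborel) = emeasure lborel B * \<infinity>"
    and "(\<lambda>x. emeasure lborel {\<tau>::real. x + \<tau> *\<^sub>R d \<in> B}) \<in> borel_measurable lborel"
proof -
  define M where "M = {z. fst z + snd z *\<^sub>R d \<in> B}" for z :: "'a \<times> real"
  have "(\<lambda>z::'a \<times> real. fst z + snd z *\<^sub>R d) \<in> borel_measurable borel"
    by (intro borel_measurable_continuous_onI continuous_intros)
  from measurable_sets[OF this B] have "{z::'a \<times> real. fst z + snd z *\<^sub>R d \<in> B} \<in> sets borel"
    by (simp add: vimage_def)
  then have M: "{z::'a \<times> real. fst z + snd z *\<^sub>R d \<in> B} \<in> sets (lborel \<Otimes>\<^sub>M lborel)"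
    by (metis lborel_prod sets_lborel)
  have 1: "Pair x -` {z::'a \<times> real. fst z + snd z *\<^sub>R d \<in> B} = {\<tau>. x + \<tau> *\<^sub>R d \<in> B}" for x by auto
  show "(\<lambda>x. emeasure lborel {\<tau>::real. x + \<tau> *\<^sub>R d \<in> B}) \<in> borel_measurable lborel"
    using lborel.measurable_emeasure_Pair[OF M] unfolding 1 .
  have 2: "emeasure lborel ((\<lambda>x. (x, \<tau>)) -` {z::'a \<times> real. fst z + snd z *\<^sub>R d \<in> B}) = emeasure lborel B" for \<tau>
  proof -
    have "emeasure lborel B = emeasure (distr lborel borel ((+) (\<tau> *\<^sub>R d))) B" by (simp add: lborel_distr_plus)
    also have "\<dots> = emeasure lborel ((+) (\<tau> *\<^sub>R d) -` B)"
      by (subst emeasure_distr) (auto simp: B)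
    also have "(+) (\<tau> *\<^sub>R d) -` B = (\<lambda>x. (x, \<tau>)) -` {z::'a \<times> real. fst z + snd z *\<^sub>R d \<in> B}"
      by (auto simp: add.commute)
    finally show ?thesis by simp
  qed
  have "emeasure (lborel \<Otimes>\<^sub>M lborel) {z::'a \<times> real. fst z + snd z *\<^sub>R d \<in> B} = emeasure lborel B * \<infinity>"
    unfolding lborel_pair.emeasure_pair_measure_alt2[OF M] 2 by simp
  then show "(\<integral>\<^sup>+x. emeasure lborel {\<tau>::real. x + \<tau> *\<^sub>R d \<in> B} \<partial>lborel) = emeasure lborel B * \<infinity>"
    unfolding lborel.emeasure_pair_measure_alt[OF M] 1 .
qed

lemma negligible_if_negligible_lines:
  fixes B :: "'a::euclidean_space set"
  assumes B: "B \<in> sets borel" and neg: "\<And>x. negligible {\<tau>::real. x + \<tau> *\<^sub>R d \<in> B}"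
  shows "negligible B"
proof -
  have "emeasure lborel {\<tau>::real. x + \<tau> *\<^sub>R d \<in> B} = 0" for x
  proof -
    have "(\<lambda>\<tau>::real. x + \<tau> *\<^sub>R d) \<in> borel_measurable borel"
      by (intro borel_measurable_continuous_onI continuous_intros)
    from measurable_sets[OF this B] have "{\<tau>::real. x + \<tau> *\<^sub>R d \<in> B} \<in> sets borel" by (simp add: vimage_def)
    then show ?thesis using neg[of x] unfolding negligible_iff_null_sets by (auto simp: null_sets_def)
  qed
  with emeasure_lines(1)[OF B, of d] have "emeasure lborel B * \<infinity> = 0" by simp
  then show ?thesis using B unfolding negligible_iff_null_sets by (auto simp: null_sets_def)
qed

lemma negligible_Borel_superset:
  fixes N :: "'a::euclidean_space set"
  assumes "negligible N"
  shows "\<exists>B. N \<subseteq> B \<and> B \<in> sets borel \<and> negligible B"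
proof -
  have N: "N \<in> sets lebesgue" using assms by (simp add: negligible_imp_sets)
  then have "\<exists>B. N \<subseteq> B \<and> B \<in> sets lborel \<and> emeasure lebesgue N = emeasure lborel B"
    by (metis completion_upper)
  then obtain B where B: "N \<subseteq> B" "B \<in> sets lborel" "emeasure lebesgue N = emeasure lborel B" by (elim exE conjE)
  have "emeasure lborel B = 0" using B(3) assms by (simp add: negligible_iff_emeasure0 N)
  then have "negligible B" using B(2) unfolding negligible_iff_null_sets by (auto simp: null_sets_def)
  then show ?thesis using B by auto
qed

lemma AE_negligible_lines:
  fixes N :: "'a::euclidean_space set"
  assumes "negligible N"
  shows "AE x in lborel. negligible {\<tau>::real. x + \<tau> *\<^sub>R d \<in> N}"
proof -
  obtain B where B: "N \<subseteq> B" "B \<in> sets borel" "negligible B" using negligible_Borel_superset[OF assms] by blast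
  then have "emeasure lborel B = 0" unfolding negligible_iff_null_sets by (auto simp: null_sets_def)
  then have "(\<integral>\<^sup>+x. emeasure lborel {\<tau>::real. x + \<tau> *\<^sub>R d \<in> B} \<partial>lborel) = 0"
    unfolding emeasure_lines(1)[OF B(2)] by simp
  then have "AE x in lborel. emeasure lborel {\<tau>::real. x + \<tau> *\<^sub>R d \<in> B} = 0"
    unfolding nn_integral_0_iff_AE[OF emeasure_lines(2)[OF B(2), of d]] .
  then show ?thesis
  proof (rule AE_mp, intro AE_I2 impI)
    fix x assume 0: "emeasure lborel {\<tau>::real. x + \<tau> *\<^sub>R d \<in> B} = 0"
    have "(\<lambda>\<tau>::real. x + \<tau> *\<^sub>R d) \<in> borel_measurable borel"
      by (intro borel_measurable_continuous_onI continuous_intros)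
    from measurable_sets[OF this B(2)] have "{\<tau>::real. x + \<tau> *\<^sub>R d \<in> B} \<in> sets borel" by (simp add: vimage_def)
    with 0 have "negligible {\<tau>::real. x + \<tau> *\<^sub>R d \<in> B}" unfolding negligible_iff_null_sets by (auto simp: null_sets_def)
    then show "negligible {\<tau>::real. x + \<tau> *\<^sub>R d \<in> N}" by (rule negligible_subset) (use B in auto)
  qed
qed

section \<open>Porous sets and directional derivatives\<close>

text \<open>Arbitrarily small balls around a point of \<open>S\<close> have a hole free of
  \<open>S\<close> that occupies the fraction \<open>\<theta> ^ DIM('a)\<close> of their measure.
  Covering by balls without their holes, i.e. \<open>Vitali_image_bound\<close> for the identity,
  contracts the outer measure by the factor \<open>1 - \<theta> ^ DIM('a)\<close>.\<close>

lemma negligible_porous: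
  fixes S :: "'a::euclidean_space set"
  assumes th: "0 < \<theta>" "\<theta> \<le> 1"
    and por: "\<And>x d. x \<in> S \<Longrightarrow> d > 0 \<Longrightarrow> \<exists>r b. 0 < r \<and> r < d \<and> ball b (\<theta> * r) \<subseteq> cball x r \<and> ball b (\<theta> * r) \<inter> S = {}"
  shows "negligible S"
proof -
  let ?c = "1 - \<theta> ^ DIM('a)"
  have c: "0 \<le> ?c" "?c < 1" using th by (auto simp: power_le_one)
  have "negligible (S \<inter> ball 0 (real n))" for n
  proof (rule negligible_outer_contraction[OF c(2), of "ball 0 (real n)"])
    fix U :: "'a set" and e :: real assume U: "open U" "U \<in> lmeasurable" "S \<inter> ball 0 (real n) \<subseteq> U" and e: "0 < e"
    have "\<exists>T. id ` (S \<inter> ball 0 (real n)) \<subseteq> T \<and> T \<in> lmeasurable \<and> measure lebesgue T \<le> ?c * measure lebesgue U"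
    proof (rule Vitali_image_bound[OF U(2) c(1)])
      fix x d assume x: "x \<in> S \<inter> ball 0 (real n)" and d: "d > (0::real)"
      then have "x \<in> U" using U by auto
      then obtain e where e: "e > 0" "cball x e \<subseteq> U" using U(1) open_contains_cball by blast
      from x d e por[of x "min d e"] obtain r b where r: "0 < r" "r < min d e" "ball b (\<theta> * r) \<subseteq> cball x r" "ball b (\<theta> * r) \<inter> S = {}"
        by auto
      have "measure lebesgue (cball x r - ball b (\<theta> * r)) = measure lebesgue (cball x r) - measure lebesgue (ball b (\<theta> * r))"
        by (rule measurable_measure_Diff) (use r in auto)
      also have "measure lebesgue (ball b (\<theta> * r)) = \<theta> ^ DIM('a) * measure lebesgue (cball x r)"
        using r th content_ball_conv_unit_ball[of "\<theta> * r" b] content_ball_conv_unit_ball[of r x]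
        by (simp add: content_cball_conv_ball power_mult_distrib)
      finally have m: "measure lebesgue (cball x r - ball b (\<theta> * r)) = ?c * measure lebesgue (cball x r)"
        by (simp add: algebra_simps)
      have "id ` (S \<inter> ball 0 (real n) \<inter> cball x r) \<subseteq> cball x r - ball b (\<theta> * r)" using r by auto
      moreover have "cball x r - ball b (\<theta> * r) \<in> lmeasurable" by (intro fmeasurable.Diff) auto
      moreover have "cball x r \<subseteq> U" using r e by auto
      moreover have "x \<in> cball x r" "r < d" using r by auto
      ultimately show "\<exists>a r V. 0 < r \<and> r < d \<and> x \<in> cball a r \<and> cball a r \<subseteq> U \<and> id ` (S \<inter> ball 0 (real n) \<inter> cball a r) \<subseteq> V \<and>
          V \<in> lmeasurable \<and> measure lebesgue V \<le> ?c * measure lebesgue (cball a r)"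
        using r(1) m by (intro exI[of _ x] exI[of _ r] exI[of _ "cball x r - ball b (\<theta> * r)"]) simp
    qed simp
    with e show "\<exists>T. S \<inter> ball 0 (real n) \<subseteq> T \<and> T \<in> lmeasurable \<and> measure lebesgue T \<le> ?c * measure lebesgue U + e"
      by (metis add_increasing2 id_apply image_id less_eq_real_def)
  qed auto
  then have "negligible (\<Union>n. S \<inter> ball 0 (real n))" by (rule negligible_Union_nat)
  moreover have "(\<Union>n. S \<inter> ball 0 (real n)) = S"
    by (auto simp: reals_Archimedean2)
  ultimately show ?thesis by simp
qed

lemma lipschitz_on_line:
  fixes f :: "'a::real_normed_vector \<Rightarrow> real"
  assumes L: "L-lipschitz_on UNIV f"
  shows "(L * norm d)-lipschitz_on UNIV (\<lambda>t. f (x + t *\<^sub>R d))"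
proof (rule lipschitz_onI)
  fix s t :: real
  have "dist (f (x + s *\<^sub>R d)) (f (x + t *\<^sub>R d)) \<le> L * dist (x + s *\<^sub>R d) (x + t *\<^sub>R d)"
    by (rule lipschitz_onD[OF L]) auto
  also have "dist (x + s *\<^sub>R d) (x + t *\<^sub>R d) = norm d * dist s t"
    by (simp add: dist_norm flip: scaleR_diff_left)
  finally show "dist (f (x + s *\<^sub>R d)) (f (x + t *\<^sub>R d)) \<le> L * norm d * dist s t" by (simp add: mult.assoc)
qed (use lipschitz_on_nonneg[OF L] in simp)

text \<open>On every line the one-dimensional theorem applies; the obstacle is measurability in
  \<open>x\<close>. Existence of the derivative is therefore written as a Cauchy condition on the
  quotients, which exhibits the good set as a countable intersection of countable unions of closed
  sets.\<close>

lemma negligible_no_directional_derivative: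
  fixes f :: "'a::euclidean_space \<Rightarrow> real"
  assumes L: "L-lipschitz_on UNIV f"
  shows "negligible {x. \<nexists>D. ((\<lambda>t. f (x + t *\<^sub>R d)) has_field_derivative D) (at 0)}"
proof -
  have cf: "continuous_on UNIV f" using L lipschitz_on_continuous_on by blast
  define q where "q r x = (f (x + r *\<^sub>R d) - f x) / r" for r x
  define A where "A k j = {x. \<forall>r1 r2. r1 \<noteq> 0 \<longrightarrow> \<bar>r1\<bar> < 1 / real (Suc j) \<longrightarrow> r2 \<noteq> 0 \<longrightarrow> \<bar>r2\<bar> < 1 / real (Suc j) \<longrightarrow>
       \<bar>q r1 x - q r2 x\<bar> \<le> 1 / real (Suc k)}" for k j :: nat
  \<comment> \<open>For \<open>r = 0\<close> division by zero makes \<open>q r\<close> the zero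
    function.\<close>
  have cq: "continuous_on UNIV (q r)" for r
    unfolding q_def by (cases "r = 0") (auto intro!: continuous_intros continuous_on_compose2[OF cf])
  have "closed (A k j)" for k j
    unfolding A_def by (intro closed_Collect_all closed_Collect_imp closed_Collect_le continuous_intros cq) auto
  then have meas: "- (\<Inter>k. \<Union>j. A k j) \<in> sets borel" by (intro borel_comp sets.countable_INT sets.countable_UN) auto
  have good: "x \<in> (\<Inter>k. \<Union>j. A k j) \<longleftrightarrow> (\<exists>D. ((\<lambda>t. f (x + t *\<^sub>R d)) has_field_derivative D) (at 0))" for x
  proof
    assume "\<exists>D. ((\<lambda>t. f (x + t *\<^sub>R d)) has_field_derivative D) (at 0)"
    then obtain D where "((\<lambda>t. f (x + t *\<^sub>R d)) has_field_derivative D) (at 0)" by blast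
    then have lim: "((\<lambda>r. q r x) \<longlongrightarrow> D) (at 0)" by (simp add: has_field_derivative_iff q_def)
    show "x \<in> (\<Inter>k. \<Union>j. A k j)"
    proof
      fix k
      have "1 / (2 * real (Suc k)) > 0" by simp
      from tendstoD[OF lim this] obtain e where e: "e > 0" "\<And>r. r \<noteq> 0 \<Longrightarrow> \<bar>r\<bar> < e \<Longrightarrow> dist (q r x) D < 1 / (2 * real (Suc k))"
        unfolding eventually_at by auto
      obtain j where j: "1 / real (Suc j) < e" using e(1) nat_approx_posE by blast
      have "x \<in> A k j" unfolding A_def mem_Collect_eq
      proof (intro allI impI)
        fix r1 r2 :: real assume "r1 \<noteq> 0" "\<bar>r1\<bar> < 1 / real (Suc j)" "r2 \<noteq> 0" "\<bar>r2\<bar> < 1 / real (Suc j)"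
        then have "dist (q r1 x) D < 1 / (2 * real (Suc k))" "dist (q r2 x) D < 1 / (2 * real (Suc k))"
          using e(2) j by auto
        then have "\<bar>q r1 x - q r2 x\<bar> < 1 / (2 * real (Suc k)) + 1 / (2 * real (Suc k))" by (simp add: dist_real_def)
        then show "\<bar>q r1 x - q r2 x\<bar> \<le> 1 / real (Suc k)" by (simp add: field_simps)
      qed
      then show "x \<in> (\<Union>j. A k j)" by blast
    qed
  next
    assume x: "x \<in> (\<Inter>k. \<Union>j. A k j)"
    have ex: "\<exists>\<delta>>0. \<forall>r1 r2. r1 \<noteq> 0 \<longrightarrow> \<bar>r1\<bar> < \<delta> \<longrightarrow> r2 \<noteq> 0 \<longrightarrow> \<bar>r2\<bar> < \<delta> \<longrightarrow> \<bar>q r1 x - q r2 x\<bar> < e" if "e > 0" for e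
    proof -
      obtain k where k: "1 / real (Suc k) < e" using \<open>e > 0\<close> nat_approx_posE by blast
      obtain j where "x \<in> A k j" using x by blast
      then show ?thesis using k unfolding A_def
        by (intro exI[of _ "1 / real (Suc j)"]) (auto intro: le_less_trans)
    qed
    have "Cauchy (\<lambda>n. q (1 / real (Suc n)) x)" unfolding Cauchy_def
    proof (intro allI impI)
      fix e :: real assume "e > 0"
      from ex[OF this] obtain \<delta> where \<delta>: "\<delta> > 0" "\<And>r1 r2. r1 \<noteq> 0 \<Longrightarrow> \<bar>r1\<bar> < \<delta> \<Longrightarrow> r2 \<noteq> 0 \<Longrightarrow> \<bar>r2\<bar> < \<delta> \<Longrightarrow> \<bar>q r1 x - q r2 x\<bar> < e" by blast
      obtain M where M: "1 / real (Suc M) < \<delta>" using \<delta>(1) nat_approx_posE by blast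
      have sm: "\<bar>1 / real (Suc m)\<bar> < \<delta>" if "m \<ge> M" for m
      proof -
        have "1 / real (Suc m) \<le> 1 / real (Suc M)" using that by (simp add: frac_le)
        then show ?thesis using M by simp
      qed
      show "\<exists>M. \<forall>m\<ge>M. \<forall>n\<ge>M. dist (q (1 / real (Suc m)) x) (q (1 / real (Suc n)) x) < e"
        unfolding dist_real_def by (intro exI[of _ M] allI impI \<delta>(2) sm) auto
    qed
    then obtain D where D: "(\<lambda>n. q (1 / real (Suc n)) x) \<longlonglongrightarrow> D" using Cauchy_convergent convergentD by blast
    have "((\<lambda>r. q r x) \<longlongrightarrow> D) (at 0)"
    proof (rule tendstoI)
      fix e :: real assume "e > 0"
      then have "e / 2 > 0" by simp
      from ex[OF this] obtain \<delta> where \<delta>: "\<delta> > 0" "\<And>r1 r2. r1 \<noteq> 0 \<Longrightarrow> \<bar>r1\<bar> < \<delta> \<Longrightarrow> r2 \<noteq> 0 \<Longrightarrow> \<bar>r2\<bar> < \<delta> \<Longrightarrow> \<bar>q r1 x - q r2 x\<bar> < e / 2" by blast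
      have "\<forall>\<^sub>F n in sequentially. dist (q (1 / real (Suc n)) x) D < e / 2" using tendstoD[OF D] \<open>e / 2 > 0\<close> by blast
      moreover have "\<forall>\<^sub>F n in sequentially. 1 / real (Suc n) < \<delta>"
        using order_tendstoD(2)[OF LIMSEQ_inverse_real_of_nat \<delta>(1)] by (simp only: inverse_eq_divide)
      ultimately have "\<forall>\<^sub>F n in sequentially. dist (q (1 / real (Suc n)) x) D < e / 2 \<and> 1 / real (Suc n) < \<delta>"
        by eventually_elim blast
      then have "\<exists>n. dist (q (1 / real (Suc n)) x) D < e / 2 \<and> 1 / real (Suc n) < \<delta>"
        by (rule eventually_happens'[OF sequentially_bot])
      then obtain n where n: "dist (q (1 / real (Suc n)) x) D < e / 2" "1 / real (Suc n) < \<delta>"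
        by (elim exE conjE)
      have "dist (q r x) D < e" if "r \<noteq> 0" "\<bar>r\<bar> < \<delta>" for r
      proof -
        have "\<bar>q r x - q (1 / real (Suc n)) x\<bar> < e / 2" by (rule \<delta>(2)) (use that n in auto)
        with n(1) show ?thesis unfolding dist_real_def by linarith
      qed
      then show "\<forall>\<^sub>F r in at 0. dist (q r x) D < e" unfolding eventually_at using \<delta>(1) by (auto simp: dist_real_def)
    qed
    then show "\<exists>D. ((\<lambda>t. f (x + t *\<^sub>R d)) has_field_derivative D) (at 0)"
      unfolding has_field_derivative_iff q_def by auto
  qed
  have "negligible (- (\<Inter>k. \<Union>j. A k j))"
  proof (rule negligible_if_negligible_lines[OF meas])
    fix x
    from negligible_nondifferentiable_lipschitz_real[OF lipschitz_on_line[OF L, of d x]]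
    show "negligible {\<tau>. x + \<tau> *\<^sub>R d \<in> - (\<Inter>k. \<Union>j. A k j)}"
    proof (rule negligible_subset, intro subsetI CollectI notI)
      fix \<tau> assume ni: "\<tau> \<in> {\<tau>. x + \<tau> *\<^sub>R d \<in> - (\<Inter>k. \<Union>j. A k j)}" and dt: "(\<lambda>t. f (x + t *\<^sub>R d)) differentiable at \<tau>"
      from dt[unfolded real_differentiable_def] obtain D where "((\<lambda>t. f (x + t *\<^sub>R d)) has_field_derivative D) (at \<tau>)" ..
      then have "((\<lambda>t. f (x + (\<tau> + t) *\<^sub>R d)) has_field_derivative D) (at 0)"
        using DERIV_shift[of "\<lambda>t. f (x + t *\<^sub>R d)" D 0 \<tau>] by (simp add: add.commute)
      then have "((\<lambda>t. f (x + \<tau> *\<^sub>R d + t *\<^sub>R d)) has_field_derivative D) (at 0)"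
        by (simp add: algebra_simps)
      then have "x + \<tau> *\<^sub>R d \<in> (\<Inter>k. \<Union>j. A k j)" using good[of "x + \<tau> *\<^sub>R d"] by metis
      with ni show False by (simp only: mem_Collect_eq Compl_iff not_True_eq_False)
    qed
  qed
  moreover have "{x. \<nexists>D. ((\<lambda>t. f (x + t *\<^sub>R d)) has_field_derivative D) (at 0)} = - (\<Inter>k. \<Union>j. A k j)"
    using good by blast
  ultimately show ?thesis by simp
qed

lemma directional_derivative_expansion:
  fixes f :: "'a::real_normed_vector \<Rightarrow> real"
  assumes D: "((\<lambda>t. f (x + t *\<^sub>R w)) has_field_derivative m) (at 0)" and e: "e > 0"
  shows "\<exists>k>0. \<forall>t. \<bar>t\<bar> < k \<longrightarrow> \<bar>f (x + t *\<^sub>R w) - f x - t * m\<bar> \<le> e * \<bar>t\<bar>"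
proof -
  have "((\<lambda>t. (f (x + t *\<^sub>R w) - f x) / t) \<longlongrightarrow> m) (at 0)" using D by (simp add: has_field_derivative_iff)
  from tendstoD[OF this e] obtain k where k: "k > 0" "\<And>t. t \<noteq> 0 \<Longrightarrow> \<bar>t\<bar> < k \<Longrightarrow> \<bar>(f (x + t *\<^sub>R w) - f x) / t - m\<bar> < e"
    unfolding eventually_at dist_real_def by auto
  have "\<bar>f (x + t *\<^sub>R w) - f x - t * m\<bar> \<le> e * \<bar>t\<bar>" if "\<bar>t\<bar> < k" for t
  proof (cases "t = 0")
    case False
    have "f (x + t *\<^sub>R w) - f x - t * m = ((f (x + t *\<^sub>R w) - f x) / t - m) * t" using False by (simp add: field_simps)
    then have "\<bar>f (x + t *\<^sub>R w) - f x - t * m\<bar> = \<bar>(f (x + t *\<^sub>R w) - f x) / t - m\<bar> * \<bar>t\<bar>" by (simp add: abs_mult)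
    then show ?thesis using mult_right_mono[OF less_imp_le[OF k(2)[OF False that]] abs_ge_zero[of t]] by simp
  qed simp
  then show ?thesis using k by blast
qed

text \<open>Near a point \<open>x\<close> where the derivatives along \<open>u\<close>, \<open>v\<close>, \<open>u + v\<close> are not additive, a point \<open>y\<close> of
  the same kind cannot lie near \<open>x + t u\<close>, since \<open>f (y + t v)\<close> would approximate \<open>f (x + t (u + v))\<close>.\<close>

lemma negligible_nonadditive:
  fixes f :: "'a::euclidean_space \<Rightarrow> real"
  assumes L: "L-lipschitz_on UNIV f"
  shows "negligible {x. \<exists>a b c. ((\<lambda>t. f (x + t *\<^sub>R u)) has_field_derivative a) (at 0) \<and>
      ((\<lambda>t. f (x + t *\<^sub>R v)) has_field_derivative b) (at 0) \<and>
      ((\<lambda>t. f (x + t *\<^sub>R (u + v))) has_field_derivative c) (at 0) \<and> c \<noteq> a + b}" (is "negligible ?S")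
proof -
  have L0: "L \<ge> 0" by (rule lipschitz_on_nonneg[OF L])
  have fl: "\<bar>f y - f x\<bar> \<le> L * norm (y - x)" for x y
    using lipschitz_onD[OF L, of y x] by (simp add: dist_norm)
  \<comment> \<open>\<open>r\<close> and \<open>s\<close> are rational approximations of the
    derivatives along \<open>u\<close> and \<open>v\<close>; the last clause demands a defect of
    three times the error allowed in the first two. Fixing \<open>r\<close>, \<open>s\<close>,
    \<open>e\<close>, \<open>k\<close> makes the condition uniform over the set.\<close>
  define P where "P r s e k = {x. \<forall>t. \<bar>t\<bar> < k \<longrightarrow>
      \<bar>f (x + t *\<^sub>R u) - f x - t * r\<bar> \<le> e * \<bar>t\<bar> \<and>
      \<bar>f (x + t *\<^sub>R v) - f x - t * s\<bar> \<le> e * \<bar>t\<bar> \<and>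
      \<bar>f (x + t *\<^sub>R (u + v)) - f x - t * (r + s)\<bar> \<ge> 3 * e * \<bar>t\<bar>}" for r s e k :: real
  have negP: "negligible (P r s e k)" if ek: "e > 0" "k > 0" for r s e k
  proof -
    \<comment> \<open>The Lipschitz error \<open>L * (\<eta> * t)\<close> occurs twice, at
      \<open>y\<close> and at \<open>y + t *\<^sub>R v\<close>; this choice keeps the sum below
      \<open>e * t\<close>.\<close>
    define \<eta> where "\<eta> = e / (4 * (L + 1))"
    have \<eta>: "\<eta> > 0" using ek L0 by (simp add: \<eta>_def)
    have L\<eta>: "2 * (L * \<eta>) < e"
    proof -
      have "2 * (L * \<eta>) \<le> 2 * ((L + 1) * \<eta>)" using \<eta> by (simp add: mult_right_mono)
      also have "\<dots> = e / 2" using L0 by (simp add: \<eta>_def field_simps)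
      finally show ?thesis using ek by simp
    qed
    define R where "R = norm u + \<eta>"
    have R: "R > 0" "\<eta> \<le> R" using \<eta> by (auto simp: R_def add_nonneg_pos)
    show ?thesis
    proof (rule negligible_porous[of "\<eta> / R"])
      show "0 < \<eta> / R" "\<eta> / R \<le> 1" using R \<eta> by auto
      fix x and d :: real assume x: "x \<in> P r s e k" and d: "d > 0"
      define X where "X = d / R"
      define t where "t = min k X / 2"
      have "X > 0" using d R by (simp add: X_def)
      then have "0 < t" "t < k" "t < X" using ek by (auto simp: t_def min_def)
      then have t: "0 < t" "t < k" "t < d / R" by (simp_all add: X_def)
      have "ball (x + t *\<^sub>R u) (\<eta> / R * (R * t)) \<subseteq> cball x (R * t)"
      proof
        fix y assume "y \<in> ball (x + t *\<^sub>R u) (\<eta> / R * (R * t))"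
        then have "norm (y - (x + t *\<^sub>R u)) < \<eta> * t" using R by (simp add: dist_norm norm_minus_commute)
        moreover have "norm (y - x) \<le> norm (y - (x + t *\<^sub>R u)) + norm (t *\<^sub>R u)"
          using norm_triangle_ineq[of "y - (x + t *\<^sub>R u)" "t *\<^sub>R u"] by simp
        moreover have "norm (t *\<^sub>R u) = norm u * t" using t by simp
        moreover have "R * t = norm u * t + \<eta> * t" by (simp add: R_def algebra_simps)
        ultimately have "norm (y - x) \<le> R * t" by linarith
        then show "y \<in> cball x (R * t)" by (simp add: dist_norm norm_minus_commute)
      qed
      moreover have "ball (x + t *\<^sub>R u) (\<eta> / R * (R * t)) \<inter> P r s e k = {}"
      proof (rule ccontr)
        assume "ball (x + t *\<^sub>R u) (\<eta> / R * (R * t)) \<inter> P r s e k \<noteq> {}"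
        then obtain y where y: "y \<in> P r s e k" "norm (y - (x + t *\<^sub>R u)) < \<eta> * t"
          using R by (auto simp: dist_norm norm_minus_commute)
        have n: "L * norm (y - (x + t *\<^sub>R u)) \<le> L * (\<eta> * t)" using y L0 by (intro mult_left_mono) auto
        have "\<bar>f (y + t *\<^sub>R v) - f (x + t *\<^sub>R (u + v))\<bar> \<le> L * norm (y + t *\<^sub>R v - (x + t *\<^sub>R (u + v)))" by (rule fl)
        also have "y + t *\<^sub>R v - (x + t *\<^sub>R (u + v)) = y - (x + t *\<^sub>R u)" by (simp add: algebra_simps)
        finally have 1: "\<bar>f (y + t *\<^sub>R v) - f (x + t *\<^sub>R (u + v))\<bar> \<le> L * (\<eta> * t)" using n by linarith
        have 2: "\<bar>f y - f (x + t *\<^sub>R u)\<bar> \<le> L * (\<eta> * t)" using fl[of y "x + t *\<^sub>R u"] n by linarith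
        have "\<bar>t\<bar> < k" using t by simp
        then have 3: "\<bar>f (x + t *\<^sub>R u) - f x - t * r\<bar> \<le> e * \<bar>t\<bar>"
            "\<bar>f (x + t *\<^sub>R (u + v)) - f x - t * (r + s)\<bar> \<ge> 3 * e * \<bar>t\<bar>" "\<bar>f (y + t *\<^sub>R v) - f y - t * s\<bar> \<le> e * \<bar>t\<bar>"
          using x y(1) unfolding P_def by blast+
        have "3 * e * t \<le> \<bar>f (x + t *\<^sub>R (u + v)) - f x - t * (r + s)\<bar>" using 3(2) t by simp
        also have "t * (r + s) = t * r + t * s" by (simp add: algebra_simps)
        also have "\<bar>f (x + t *\<^sub>R (u + v)) - f x - (t * r + t * s)\<bar> \<le> 2 * (L * (\<eta> * t)) + 2 * (e * t)"
          using 1 2 3(1) 3(3) t(1) by (simp only: abs_of_pos)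
        finally have "e * t \<le> 2 * (L * \<eta>) * t" by (simp add: algebra_simps)
        then show False using L\<eta> t(1) by simp
      qed
      moreover have "0 < R * t" "R * t < d" using R t by (auto simp: pos_less_divide_eq mult.commute)
      ultimately show "\<exists>r' b. 0 < r' \<and> r' < d \<and> ball b (\<eta> / R * r') \<subseteq> cball x r' \<and> ball b (\<eta> / R * r') \<inter> P r s e k = {}"
        by blast
    qed
  qed
  let ?I = "{i :: real \<times> real \<times> real \<times> nat. i \<in> \<rat> \<times> \<rat> \<times> \<rat> \<times> UNIV \<and> fst (snd (snd i)) > 0}"
  let ?Q = "\<lambda>i. P (fst i) (fst (snd i)) (fst (snd (snd i))) (1 / real (Suc (snd (snd (snd i)))))"
  have "?S \<subseteq> \<Union> (?Q ` ?I)"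
  proof
    fix x assume "x \<in> ?S"
    then obtain a b c where abc: "((\<lambda>t. f (x + t *\<^sub>R u)) has_field_derivative a) (at 0)"
      "((\<lambda>t. f (x + t *\<^sub>R v)) has_field_derivative b) (at 0)"
      "((\<lambda>t. f (x + t *\<^sub>R (u + v))) has_field_derivative c) (at 0)" "c \<noteq> a + b" by blast
    \<comment> \<open>Rounding \<open>a\<close> and \<open>b\<close> moves their sum by at most
      \<open>e\<close>, so of a defect above \<open>10 * e\<close> at least \<open>9 * e\<close>
      remains, more than \<open>3 * e\<close> plus the expansion error \<open>e / 2\<close>.\<close>
    have "\<bar>c - (a + b)\<bar> / 10 > 0" using abc by simp
    then obtain e where e: "e \<in> \<rat>" "0 < e" "e < \<bar>c - (a + b)\<bar> / 10" using Rats_dense_in_real by blast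
    obtain r where r: "r \<in> \<rat>" "a - e / 2 < r" "r < a + e / 2" using Rats_dense_in_real[of "a - e/2" "a + e/2"] e by auto
    obtain s where s: "s \<in> \<rat>" "b - e / 2 < s" "s < b + e / 2" using Rats_dense_in_real[of "b - e/2" "b + e/2"] e by auto
    have e2: "e / 2 > 0" using e by simp
    obtain k1 where k1: "k1 > 0" "\<And>t. \<bar>t\<bar> < k1 \<Longrightarrow> \<bar>f (x + t *\<^sub>R u) - f x - t * a\<bar> \<le> e / 2 * \<bar>t\<bar>" using directional_derivative_expansion[OF abc(1) e2] by blast
    obtain k2 where k2: "k2 > 0" "\<And>t. \<bar>t\<bar> < k2 \<Longrightarrow> \<bar>f (x + t *\<^sub>R v) - f x - t * b\<bar> \<le> e / 2 * \<bar>t\<bar>" using directional_derivative_expansion[OF abc(2) e2] by blast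
    obtain k3 where k3: "k3 > 0" "\<And>t. \<bar>t\<bar> < k3 \<Longrightarrow> \<bar>f (x + t *\<^sub>R (u + v)) - f x - t * c\<bar> \<le> e / 2 * \<bar>t\<bar>" using directional_derivative_expansion[OF abc(3) e2] by blast
    have "min k1 (min k2 k3) > 0" using k1 k2 k3 by simp
    then obtain n where n: "1 / real (Suc n) < min k1 (min k2 k3)" using nat_approx_posE by blast
    have "x \<in> P r s e (1 / real (Suc n))" unfolding P_def mem_Collect_eq
    proof (intro allI impI)
      fix t :: real assume "\<bar>t\<bar> < 1 / real (Suc n)"
      then have t: "\<bar>t\<bar> < k1" "\<bar>t\<bar> < k2" "\<bar>t\<bar> < k3" using n by auto
      have cmp: "\<bar>t * m - t * m'\<bar> \<le> e / 2 * \<bar>t\<bar>" if "m - e / 2 < m'" "m' < m + e / 2" for m m'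
      proof -
        have "\<bar>t * m - t * m'\<bar> = \<bar>m - m'\<bar> * \<bar>t\<bar>" by (metis abs_mult mult.commute right_diff_distrib)
        moreover have "\<bar>m - m'\<bar> \<le> e / 2" using that unfolding abs_le_iff by linarith
        ultimately show ?thesis using mult_right_mono[OF _ abs_ge_zero[of t]] by metis
      qed
      have 1: "\<bar>f (x + t *\<^sub>R u) - f x - t * r\<bar> \<le> e * \<bar>t\<bar>" using k1(2)[OF t(1)] cmp[OF r(2,3)] by linarith
      have 2: "\<bar>f (x + t *\<^sub>R v) - f x - t * s\<bar> \<le> e * \<bar>t\<bar>" using k2(2)[OF t(2)] cmp[OF s(2,3)] by linarith
      have "\<bar>c - (r + s)\<bar> \<ge> 9 * e"
      proof -
        have "\<bar>(r + s) - (a + b)\<bar> \<le> e" using r(2,3) s(2,3) unfolding abs_le_iff by linarith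
        moreover have "\<bar>c - (a + b)\<bar> \<le> \<bar>c - (r + s)\<bar> + \<bar>(r + s) - (a + b)\<bar>" by linarith
        moreover have "10 * e < \<bar>c - (a + b)\<bar>" using e(3) by simp
        ultimately show ?thesis by linarith
      qed
      then have "9 * e * \<bar>t\<bar> \<le> \<bar>c - (r + s)\<bar> * \<bar>t\<bar>" by (intro mult_right_mono) auto
      also have "\<dots> = \<bar>t * c - t * (r + s)\<bar>" by (metis abs_mult mult.commute right_diff_distrib)
      finally have 3: "3 * e * \<bar>t\<bar> \<le> \<bar>f (x + t *\<^sub>R (u + v)) - f x - t * (r + s)\<bar>" using k3(2)[OF t(3)] e(2) by linarith
      show "\<bar>f (x + t *\<^sub>R u) - f x - t * r\<bar> \<le> e * \<bar>t\<bar> \<and> \<bar>f (x + t *\<^sub>R v) - f x - t * s\<bar> \<le> e * \<bar>t\<bar> \<and>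
         \<bar>f (x + t *\<^sub>R (u + v)) - f x - t * (r + s)\<bar> \<ge> 3 * e * \<bar>t\<bar>" using 1 2 3 by blast
    qed
    then show "x \<in> \<Union> (?Q ` ?I)" using e r s by (intro UN_I[of "(r, s, e, n)"]) auto
  qed
  moreover have "negligible (\<Union> (?Q ` ?I))"
  proof (rule negligible_countable_Union)
    have "countable ?I" by (rule countable_subset[of _ "\<rat> \<times> \<rat> \<times> \<rat> \<times> UNIV"]) (auto intro: countable_rat)
    then show "countable (?Q ` ?I)" by (rule countable_image)
    fix X assume "X \<in> ?Q ` ?I"
    then obtain i where i: "i \<in> ?I" "X = ?Q i" by blast
    show "negligible X" unfolding i(2) by (rule negP) (use i(1) in auto)
  qed
  ultimately show ?thesis by (rule negligible_subset[rotated])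
qed

text \<open>Finitely many directions \<open>d\<close> from \<open>Q\<close> approximate all unit vectors, and the Lipschitz bound
  controls the error.\<close>

lemma lipschitz_has_derivative_dense:
  fixes f :: "'a::euclidean_space \<Rightarrow> real"
  assumes L: "L-lipschitz_on UNIV f" and lin: "bounded_linear l"
    and dense: "closure Q = UNIV"
    and der: "\<And>d. d \<in> Q \<Longrightarrow> ((\<lambda>t. f (x + t *\<^sub>R d)) has_field_derivative l d) (at 0)"
  shows "(f has_derivative l) (at x)"
  unfolding has_derivative_at_alt
proof (intro conjI lin allI impI)
  fix e :: real assume e: "e > 0"
  have L0: "L \<ge> 0" by (rule lipschitz_on_nonneg[OF L])
  have lin': "linear l" by (rule bounded_linear.linear[OF lin])
  obtain K where K: "K > 0" "\<And>h. norm (l h) \<le> norm h * K" using bounded_linear.pos_bounded[OF lin] by blast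
  \<comment> \<open>Three errors are proportional to \<epsilon>: the expansion along
    \<open>d\<close> with factor 1, the Lipschitz bound with factor \<open>L\<close>, the linear map
    with factor \<open>K\<close>.\<close>
  define \<epsilon> where "\<epsilon> = e / (L + K + 1)"
  have \<epsilon>: "\<epsilon> > 0" using e L0 K by (simp add: \<epsilon>_def)
  have "compact (sphere (0::'a) 1)" by simp
  moreover have "\<forall>B\<in>(\<lambda>d. ball d \<epsilon>) ` Q. open B" by auto
  moreover have "sphere 0 1 \<subseteq> \<Union> ((\<lambda>d. ball d \<epsilon>) ` Q)"
  proof
    fix s :: 'a
    have "s \<in> closure Q" using dense by simp
    then obtain d where "d \<in> Q" "dist d s < \<epsilon>" using \<epsilon> closure_approachable by blast
    then show "s \<in> \<Union> ((\<lambda>d. ball d \<epsilon>) ` Q)" by (auto)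
  qed
  ultimately obtain C' where C': "C' \<subseteq> (\<lambda>d. ball d \<epsilon>) ` Q" "finite C'" "sphere 0 1 \<subseteq> \<Union> C'" by (meson compactE)
  then obtain C where C: "C \<subseteq> Q" "finite C" "sphere 0 1 \<subseteq> (\<Union>d\<in>C. ball d \<epsilon>)"
    by (metis finite_subset_image)
  have "\<exists>k>0. \<forall>t. \<bar>t\<bar> < k \<longrightarrow> \<bar>f (x + t *\<^sub>R d) - f x - t * l d\<bar> \<le> \<epsilon> * \<bar>t\<bar>" if "d \<in> C" for d
    using directional_derivative_expansion[OF der \<epsilon>, of d] that C(1) by blast
  then obtain k where k: "\<And>d. d \<in> C \<Longrightarrow> k d > 0"
    "\<And>d t. d \<in> C \<Longrightarrow> \<bar>t\<bar> < k d \<Longrightarrow> \<bar>f (x + t *\<^sub>R d) - f x - t * l d\<bar> \<le> \<epsilon> * \<bar>t\<bar>" by metis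
  define \<delta> where "\<delta> = Min (insert 1 (k ` C))"
  have \<delta>: "\<delta> > 0" "\<And>d. d \<in> C \<Longrightarrow> \<delta> \<le> k d" using C(2) k(1) by (auto simp: \<delta>_def)
  show "\<exists>d>0. \<forall>y. norm (y - x) < d \<longrightarrow> norm (f y - f x - l (y - x)) \<le> e * norm (y - x)"
  proof (intro exI conjI allI impI)
    show "\<delta> > 0" by (rule \<delta>)
    fix y assume y: "norm (y - x) < \<delta>"
    show "norm (f y - f x - l (y - x)) \<le> e * norm (y - x)"
    proof (cases "y = x")
      case True
      then show ?thesis using linear_0[OF lin'] by simp
    next
      case False
      define t where "t = norm (y - x)"
      define s where "s = (y - x) /\<^sub>R t"
      have t: "t > 0" using False by (simp add: t_def)
      have ys: "y = x + t *\<^sub>R s" using t by (simp add: s_def)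
      have "norm s = 1" using t by (simp add: s_def t_def)
      then obtain d where d: "d \<in> C" "dist d s < \<epsilon>" using C(3) by force
      have "\<bar>t\<bar> < k d" using y \<delta>(2)[OF d(1)] by (simp add: t_def)
      from k(2)[OF d(1) this] t have 1: "\<bar>f (x + t *\<^sub>R d) - f x - t * l d\<bar> \<le> \<epsilon> * t" by simp
      have ds: "norm (d - s) \<le> \<epsilon>" using d(2) by (simp add: dist_norm)
      have "\<bar>f (x + t *\<^sub>R s) - f (x + t *\<^sub>R d)\<bar> \<le> L * norm (t *\<^sub>R (s - d))"
        using lipschitz_onD[OF L, of "x + t *\<^sub>R s" "x + t *\<^sub>R d"] by (simp add: dist_norm algebra_simps)
      also have "\<dots> = L * (t * norm (d - s))" using t by (simp add: norm_minus_commute)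
      also have "\<dots> \<le> L * (t * \<epsilon>)" using L0 t ds by (intro mult_left_mono) auto
      finally have 2: "\<bar>f (x + t *\<^sub>R s) - f (x + t *\<^sub>R d)\<bar> \<le> L * (t * \<epsilon>)" .
      have "\<bar>t * l d - t * l s\<bar> = t * \<bar>l (d - s)\<bar>"
        using t by (simp add: abs_mult linear_diff[OF lin'] flip: right_diff_distrib)
      also have "\<dots> \<le> t * (\<epsilon> * K)" using K(2)[of "d - s"] ds K(1) t
        by (intro mult_left_mono) (auto intro: order_trans mult_right_mono)
      finally have 3: "\<bar>t * l d - t * l s\<bar> \<le> t * (\<epsilon> * K)" .
      have "\<bar>f (x + t *\<^sub>R s) - f x - t * l s\<bar> \<le> \<epsilon> * t + L * (t * \<epsilon>) + t * (\<epsilon> * K)" using 1 2 3 by linarith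
      also have "\<dots> = \<epsilon> * (L + K + 1) * t" by (simp add: algebra_simps)
      also have "\<epsilon> * (L + K + 1) = e" using L0 K(1) by (simp add: \<epsilon>_def)
      finally have "\<bar>f (x + t *\<^sub>R s) - f x - t * l s\<bar> \<le> e * t" .
      moreover have "f y - f x - l (y - x) = f (x + t *\<^sub>R s) - f x - t * l s"
        by (simp add: ys linear_cmul[OF lin'])
      ultimately show ?thesis by (simp only: t_def[symmetric] real_norm_def)
    qed
  qed
qed

text \<open>Off countably many null sets, the derivatives along the countable dense set
  \<open>Q\<close> of vectors with rational coordinates exist and are additive. Homogeneity over the
  rationals is automatic, so they agree on \<open>Q\<close> with the linear map \<open>l\<close>
  fixed by the basis, and density upgrades this to differentiability.\<close>

theorem Rademacher:
  fixes f :: "'a::euclidean_space \<Rightarrow> real"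
  assumes L: "L-lipschitz_on UNIV f"
  shows "negligible {x. \<not> f differentiable (at x)}"
proof -
  define Q :: "'a set" where "Q = {d. \<forall>b\<in>Basis. d \<bullet> b \<in> \<rat>}"
  have cQ: "countable Q"
  proof -
    have "Q \<subseteq> (\<lambda>g. \<Sum>b\<in>Basis. g b *\<^sub>R b) ` (\<Pi>\<^sub>E b\<in>(Basis::'a set). (\<rat>::real set))"
    proof
      fix d assume d: "d \<in> Q"
      have "d = (\<Sum>b\<in>Basis. restrict ((\<bullet>) d) Basis b *\<^sub>R b)" by (simp add: euclidean_representation)
      then show "d \<in> (\<lambda>g. \<Sum>b\<in>Basis. g b *\<^sub>R b) ` (\<Pi>\<^sub>E b\<in>(Basis::'a set). (\<rat>::real set))"
        using d by (intro image_eqI[of _ _ "restrict ((\<bullet>) d) Basis"]) (auto simp: Q_def)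
    qed
    then show ?thesis by (rule countable_subset) (intro countable_image countable_PiE, auto intro: countable_rat)
  qed
  have dQ: "closure Q = UNIV"
  proof -
    have "x \<in> closure Q" for x
      unfolding closure_approachable
    proof (intro allI impI)
      fix e :: real assume e: "e > 0"
      define \<epsilon> where "\<epsilon> = e / real (DIM('a) + 1)"
      have \<epsilon>: "\<epsilon> > 0" using e by (simp add: \<epsilon>_def)
      have "\<forall>b. \<exists>q\<in>\<rat>. \<bar>q - x \<bullet> b\<bar> < \<epsilon>"
      proof
        fix b
        obtain q where "q \<in> \<rat>" "x \<bullet> b - \<epsilon> < q" "q < x \<bullet> b + \<epsilon>" using Rats_dense_in_real[of "x \<bullet> b - \<epsilon>" "x \<bullet> b + \<epsilon>"] \<epsilon> by auto
        then show "\<exists>q\<in>\<rat>. \<bar>q - x \<bullet> b\<bar> < \<epsilon>" by (intro bexI[of _ q]) auto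
      qed
      then obtain q where q: "\<And>b. q b \<in> \<rat>" "\<And>b. \<bar>q b - x \<bullet> b\<bar> < \<epsilon>" by metis
      define y where "y = (\<Sum>b\<in>Basis. q b *\<^sub>R b)"
      have yb: "y \<bullet> b = q b" if "b \<in> Basis" for b using that by (simp add: y_def)
      have "norm (y - x) \<le> (\<Sum>b\<in>Basis. \<bar>(y - x) \<bullet> b\<bar>)" by (rule norm_le_l1)
      also have "\<dots> \<le> (\<Sum>b\<in>(Basis::'a set). \<epsilon>)" using q(2) by (intro sum_mono) (auto simp: inner_diff_left yb less_imp_le)
      also have "\<dots> = real DIM('a) * \<epsilon>" by simp
      also have "\<dots> < e" using e by (simp add: \<epsilon>_def field_simps)
      finally show "\<exists>y\<in>Q. dist y x < e" using q(1) by (intro bexI[of _ y]) (auto simp: Q_def yb dist_norm)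
    qed
    then show ?thesis by blast
  qed
  define N1 where "N1 d = {x. \<nexists>D. ((\<lambda>t. f (x + t *\<^sub>R d)) has_field_derivative D) (at 0)}" for d
  define N2 where "N2 u v = {x. \<exists>a b c. ((\<lambda>t. f (x + t *\<^sub>R u)) has_field_derivative a) (at 0) \<and>
      ((\<lambda>t. f (x + t *\<^sub>R v)) has_field_derivative b) (at 0) \<and>
      ((\<lambda>t. f (x + t *\<^sub>R (u + v))) has_field_derivative c) (at 0) \<and> c \<noteq> a + b}" for u v
  have "negligible (\<Union> (N1 ` Q))"
    by (rule negligible_countable_Union) (use cQ negligible_no_directional_derivative[OF L] in \<open>auto simp: N1_def\<close>)
  moreover have "negligible (\<Union> (case_prod N2 ` (Q \<times> Q)))"
    by (rule negligible_countable_Union) (use cQ negligible_nonadditive[OF L] in \<open>auto simp: N2_def\<close>)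
  ultimately have "negligible (\<Union> (N1 ` Q) \<union> \<Union> (case_prod N2 ` (Q \<times> Q)))" by (rule negligible_Un)
  moreover have "{x. \<not> f differentiable (at x)} \<subseteq> \<Union> (N1 ` Q) \<union> \<Union> (case_prod N2 ` (Q \<times> Q))"
  proof (rule subsetI, rule ccontr)
    fix x assume x: "x \<in> {x. \<not> f differentiable (at x)}" and nx: "x \<notin> \<Union> (N1 ` Q) \<union> \<Union> (case_prod N2 ` (Q \<times> Q))"
    have "\<forall>d\<in>Q. \<exists>D. ((\<lambda>t. f (x + t *\<^sub>R d)) has_field_derivative D) (at 0)" using nx by (auto simp: N1_def)
    then obtain D where D: "\<And>d. d \<in> Q \<Longrightarrow> ((\<lambda>t. f (x + t *\<^sub>R d)) has_field_derivative D d) (at 0)" by metis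
    have Q_add: "u + v \<in> Q" if "u \<in> Q" "v \<in> Q" for u v using that by (auto simp: Q_def inner_add_left)
    have D_add: "D (u + v) = D u + D v" if uv: "u \<in> Q" "v \<in> Q" for u v
    proof -
      have "x \<notin> N2 u v" using nx uv by auto
      then show ?thesis using D[OF uv(1)] D[OF uv(2)] D[OF Q_add[OF uv]] unfolding N2_def by blast
    qed
    have Q_scale: "r *\<^sub>R u \<in> Q" if "r \<in> \<rat>" "u \<in> Q" for r u using that by (auto simp: Q_def)
    have D_scale: "D (r *\<^sub>R u) = r * D u" if ru: "r \<in> \<rat>" "u \<in> Q" for r u
    proof -
      have "((\<lambda>t. f (x + (t * r) *\<^sub>R u)) has_field_derivative D u * r) (at 0)"
        by (rule DERIV_chain2[of "\<lambda>t. f (x + t *\<^sub>R u)"]) (use D[OF ru(2)] in \<open>auto intro!: derivative_eq_intros\<close>)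
      then have "((\<lambda>t. f (x + t *\<^sub>R (r *\<^sub>R u))) has_field_derivative D u * r) (at 0)" by simp
      from DERIV_unique[OF this D[OF Q_scale[OF ru]]] show ?thesis by (metis mult.commute)
    qed
    have BQ: "Basis \<subseteq> Q" by (auto simp: Q_def inner_Basis)
    have Q0: "0 \<in> Q" by (simp add: Q_def)
    define l where "l h = (\<Sum>b\<in>Basis. (h \<bullet> b) * D b)" for h
    have Dl: "D d = l d" if d: "d \<in> Q" for d
    proof -
      have "(\<Sum>b\<in>A. (d \<bullet> b) *\<^sub>R b) \<in> Q \<and> D (\<Sum>b\<in>A. (d \<bullet> b) *\<^sub>R b) = (\<Sum>b\<in>A. (d \<bullet> b) * D b)" if "finite A" "A \<subseteq> Basis" for A
        using that
      proof (induction A rule: finite_induct)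
        case empty
        have "D 0 = 0 * D 0" using D_scale[of 0 0] Q0 by simp
        then show ?case using Q0 by simp
      next
        case (insert b A)
        have b: "b \<in> Q" "d \<bullet> b \<in> \<rat>" using insert.prems BQ d by (auto simp: Q_def)
        show ?case using insert b by (auto simp: D_add D_scale Q_scale intro!: Q_add)
      qed
      from this[of Basis] show ?thesis by (simp add: euclidean_representation l_def)
    qed
    have "bounded_linear l" unfolding l_def
      by (intro bounded_linear_sum bounded_linear_mult_left[THEN bounded_linear_compose] bounded_linear_inner_left)
    then have "(f has_derivative l) (at x)"
      by (rule lipschitz_has_derivative_dense[OF L _ dQ]) (use D Dl in auto)
    then show False using x differentiableI by blast
  qed
  ultimately show ?thesis by (rule negligible_subset)
qed

corollary Rademacher_vector:
  fixes f :: "'a::euclidean_space \<Rightarrow> 'b::euclidean_space"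
  assumes L: "L-lipschitz_on UNIV f"
  shows "negligible {x. \<not> f differentiable (at x)}"
proof -
  have "negligible {x. \<not> (\<lambda>x. f x \<bullet> b) differentiable (at x)}" if "b \<in> Basis" for b
  proof (rule Rademacher[of L], rule lipschitz_onI)
    fix x y
    have "dist (f x \<bullet> b) (f y \<bullet> b) \<le> dist (f x) (f y)"
      using Basis_le_norm[OF that, of "f x - f y"] by (simp add: dist_norm inner_diff_left)
    also have "\<dots> \<le> L * dist x y" by (rule lipschitz_onD[OF L]) auto
    finally show "dist (f x \<bullet> b) (f y \<bullet> b) \<le> L * dist x y" .
  qed (rule lipschitz_on_nonneg[OF L])
  then have "negligible (\<Union>b\<in>Basis. {x. \<not> (\<lambda>x. f x \<bullet> b) differentiable (at x)})"
    by (intro negligible_Union) auto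
  then show ?thesis
    by (rule negligible_subset) (auto simp: differentiable_componentwise_within[of f _ UNIV])
qed

section \<open>The theorem on sums\<close>

lemma quadratic_le_of_asymptotic:
  fixes q1 q2 :: "'a::real_normed_vector \<Rightarrow> real"
  assumes hom: "\<And>t h. q1 (t *\<^sub>R h) = t\<^sup>2 * q1 h" "\<And>t h. q2 (t *\<^sub>R h) = t\<^sup>2 * q2 h"
    and le: "\<And>\<epsilon>. \<epsilon> > 0 \<Longrightarrow> \<exists>s>0. \<forall>h. norm h < s \<longrightarrow> q1 h \<le> q2 h + \<epsilon> * (norm h)\<^sup>2"
  shows "q1 h \<le> q2 h"
proof (rule field_le_epsilon)
  fix e :: real assume e: "e > 0"
  define \<epsilon> where "\<epsilon> = e / ((norm h)\<^sup>2 + 1)"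
  have n: "(norm h)\<^sup>2 + 1 > 0" by (simp add: add_nonneg_pos)
  then have "\<epsilon> > 0" using e by (simp add: \<epsilon>_def)
  from le[OF this] obtain s where s: "s > 0" "\<And>h. norm h < s \<Longrightarrow> q1 h \<le> q2 h + \<epsilon> * (norm h)\<^sup>2" by blast
  define t where "t = s / 2 / (norm h + 1)"
  have h1: "norm h + 1 > 0" by (simp add: add_nonneg_pos)
  have t: "t > 0" using s(1) h1 by (simp add: t_def)
  have "norm (t *\<^sub>R h) \<le> t * (norm h + 1)" using t by simp
  also have "\<dots> = s / 2" unfolding t_def times_divide_eq_left[of "s / 2"]
    by (rule nonzero_mult_div_cancel_right) (use h1 in simp)
  also have "\<dots> < s" using s(1) by simp
  finally have "q1 (t *\<^sub>R h) \<le> q2 (t *\<^sub>R h) + \<epsilon> * (norm (t *\<^sub>R h))\<^sup>2" by (rule s(2))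
  then have "t\<^sup>2 * q1 h \<le> t\<^sup>2 * (q2 h + \<epsilon> * (norm h)\<^sup>2)"
    by (simp add: hom power_mult_distrib algebra_simps)
  then have "q1 h \<le> q2 h + \<epsilon> * (norm h)\<^sup>2" using t by simp
  also have "\<epsilon> * (norm h)\<^sup>2 \<le> \<epsilon> * ((norm h)\<^sup>2 + 1)" using \<open>\<epsilon> > 0\<close> by (intro mult_left_mono) auto
  also have "\<dots> = e" using n by (simp add: \<epsilon>_def)
  finally show "q1 h \<le> q2 h + e" by simp
qed

text \<open>The gradient \<open>g\<close> is only known to be differentiable at the single point
  \<open>x\<close>. The mean value theorem along the segment uses just first derivatives of
  \<open>f\<close>, and the increment of \<open>g\<close> is compared with \<open>M\<close> from the
  base point only.\<close>

lemma second_order_expansion: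
  fixes f :: "'a::real_inner \<Rightarrow> real" and g :: "'a \<Rightarrow> 'a"
  assumes r: "r > 0" and f: "\<And>y. norm (y - x) < r \<Longrightarrow> (f has_derivative (\<lambda>d. g y \<bullet> d)) (at y)"
    and g: "(g has_derivative M) (at x)" and \<eta>: "\<eta> > 0"
  shows "\<exists>s>0. \<forall>d. norm d < s \<longrightarrow> \<bar>f (x + d) - f x - g x \<bullet> d - (M d \<bullet> d) / 2\<bar> \<le> \<eta> * (norm d)\<^sup>2"
proof -
  have lin: "linear M" using g has_derivative_linear by blast
  obtain s where s: "s > 0" "\<And>y. norm (y - x) < s \<Longrightarrow> norm (g y - g x - M (y - x)) \<le> \<eta> * norm (y - x)"
    using g \<eta> unfolding has_derivative_at_alt by blast
  have "\<bar>f (x + d) - f x - g x \<bullet> d - (M d \<bullet> d) / 2\<bar> \<le> \<eta> * (norm d)\<^sup>2" if d: "norm d < min r s" for d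
  proof -
    define \<phi> where "\<phi> t = f (x + t *\<^sub>R d) - t * (g x \<bullet> d) - t\<^sup>2 / 2 * (M d \<bullet> d)" for t
    have td: "norm (t *\<^sub>R d) < min r s" if "0 \<le> t" "t \<le> 1" for t
    proof -
      have "norm (t *\<^sub>R d) \<le> norm d" using that by (simp add: mult_left_le_one_le)
      then show ?thesis using d by simp
    qed
    have "\<exists>z>0. z < 1 \<and> \<phi> 1 - \<phi> 0 = (1 - 0) * (g (x + z *\<^sub>R d) \<bullet> d - g x \<bullet> d - z * (M d \<bullet> d))"
    proof (rule MVT2)
      fix t :: real assume t: "0 \<le> t" "t \<le> 1"
      have "(f has_derivative (\<lambda>e. g (x + t *\<^sub>R d) \<bullet> e)) (at (x + t *\<^sub>R d))"
        by (rule f) (use td[OF t] in simp)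
      moreover have "((\<lambda>t. x + t *\<^sub>R d) has_derivative (\<lambda>e. e *\<^sub>R d)) (at t)"
        by (auto intro!: derivative_eq_intros)
      ultimately have "((\<lambda>t. f (x + t *\<^sub>R d)) has_derivative (\<lambda>e. g (x + t *\<^sub>R d) \<bullet> (e *\<^sub>R d))) (at t)"
        by (rule has_derivative_compose[rotated])
      then have "((\<lambda>t. f (x + t *\<^sub>R d)) has_field_derivative (g (x + t *\<^sub>R d) \<bullet> d)) (at t)"
        unfolding has_field_derivative_def inner_scaleR_right mult_commute_abs .
      then show "(\<phi> has_field_derivative (g (x + t *\<^sub>R d) \<bullet> d - g x \<bullet> d - t * (M d \<bullet> d))) (at t)"
        unfolding \<phi>_def by (auto intro!: derivative_eq_intros)
    qed simp
    then obtain z where z: "0 < z" "z < 1" "\<phi> 1 - \<phi> 0 = g (x + z *\<^sub>R d) \<bullet> d - g x \<bullet> d - z * (M d \<bullet> d)" by auto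
    have "f (x + d) - f x - g x \<bullet> d - (M d \<bullet> d) / 2 = \<phi> 1 - \<phi> 0" by (simp add: \<phi>_def)
    also have "\<dots> = (g (x + z *\<^sub>R d) - g x - M (z *\<^sub>R d)) \<bullet> d" using z(3) by (simp add: linear_cmul[OF lin] inner_diff_left)
    finally have "\<bar>f (x + d) - f x - g x \<bullet> d - (M d \<bullet> d) / 2\<bar> \<le> norm (g (x + z *\<^sub>R d) - g x - M (z *\<^sub>R d)) * norm d"
      by (simp add: Cauchy_Schwarz_ineq2)
    also have "\<dots> \<le> (\<eta> * norm (z *\<^sub>R d)) * norm d"
      using s(2)[of "x + z *\<^sub>R d"] td[of z] z by (intro mult_right_mono) auto
    also have "\<dots> \<le> (\<eta> * norm d) * norm d" using z \<eta> by (intro mult_right_mono mult_left_mono) (auto simp: mult_left_le_one_le)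
    finally show ?thesis by (simp add: power2_eq_square mult.assoc)
  qed
  then show ?thesis using r s by (intro exI[of _ "min r s"]) auto
qed

section \<open>Strongly convex functions and their conjugates\<close>

text \<open>\<open>S\<close> is a strongly convex function; \<open>J\<close> is the inverse of its subdifferential, i.e. the gradient
  of its convex conjugate \<open>T\<close>.\<close>

locale max_affine =
  fixes A :: "'a::euclidean_space set" and c m :: "'a \<Rightarrow> real"
  assumes bdd: "bounded A"
    and attained: "\<And>Y. \<exists>a\<in>A. m Y = Y \<bullet> a + c a"
    and upper: "\<And>a Y. a \<in> A \<Longrightarrow> Y \<bullet> a + c a \<le> m Y"
begin

definition S where "S Y = (norm Y)\<^sup>2 / 2 + m Y"

lemma continuous_S: "continuous_on UNIV S"
proof -
  obtain R where R: "\<And>a. a \<in> A \<Longrightarrow> norm a \<le> R" using bdd bounded_iff by blast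
  obtain a0 where "a0 \<in> A" using attained by blast
  then have R0: "R \<ge> 0" using R norm_ge_zero order_trans by blast
  have one: "m x - m y \<le> R * norm (x - y)" for x y
  proof -
    obtain a where a: "a \<in> A" "m x = x \<bullet> a + c a" using attained by blast
    have "m x - m y \<le> (x - y) \<bullet> a" using upper[OF a(1), of y] a(2) by (simp add: inner_diff_left)
    also have "\<dots> \<le> norm (x - y) * norm a" by (rule norm_cauchy_schwarz)
    also have "\<dots> \<le> norm (x - y) * R" using R[OF a(1)] by (intro mult_left_mono) auto
    finally show ?thesis by (simp add: mult.commute)
  qed
  have "R-lipschitz_on UNIV m"
  proof (rule lipschitz_onI)
    fix x y show "dist (m x) (m y) \<le> R * dist x y"
      using one[of x y] one[of y x] by (simp add: dist_norm norm_minus_commute abs_le_iff)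
  qed (rule R0)
  then have "continuous_on UNIV m" by (rule lipschitz_on_continuous_on)
  then show ?thesis unfolding S_def by (intro continuous_intros) auto
qed

lemma S_strongly_convex:
  assumes t: "0 \<le> t" "t \<le> 1"
  shows "S (x + t *\<^sub>R (y - x)) \<le> (1 - t) * S x + t * S y - t * (1 - t) * (norm (y - x))\<^sup>2 / 2"
proof -
  let ?z = "x + t *\<^sub>R (y - x)"
  obtain a where a: "a \<in> A" "m ?z = ?z \<bullet> a + c a" using attained by blast
  have "(1 - t) * (x \<bullet> a + c a) + t * (y \<bullet> a + c a) \<le> (1 - t) * m x + t * m y"
    using upper[OF a(1)] t by (intro add_mono mult_left_mono) auto
  moreover have "?z \<bullet> a = (1 - t) * (x \<bullet> a) + t * (y \<bullet> a)"
    by (simp add: inner_add_left inner_diff_left algebra_simps)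
  then have "m ?z = (1 - t) * (x \<bullet> a + c a) + t * (y \<bullet> a + c a)"
    unfolding a(2) by (simp add: algebra_simps)
  moreover have "(norm ?z)\<^sup>2 / 2 = (1 - t) * ((norm x)\<^sup>2 / 2) + t * ((norm y)\<^sup>2 / 2) - t * (1 - t) * (norm (y - x))\<^sup>2 / 2"
  proof -
    define w where "w = y - x"
    have y: "y = x + w" by (simp add: w_def)
    have "(norm (x + t *\<^sub>R w))\<^sup>2 = (norm x)\<^sup>2 + 2 * t * (x \<bullet> w) + t\<^sup>2 * (norm w)\<^sup>2"
      unfolding power2_norm_eq_inner by (simp add: inner_add_left inner_add_right inner_commute power2_eq_square algebra_simps)
    moreover have "(norm y)\<^sup>2 = (norm x)\<^sup>2 + 2 * (x \<bullet> w) + (norm w)\<^sup>2"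
      unfolding power2_norm_eq_inner y by (simp add: inner_add_left inner_add_right inner_commute)
    ultimately show ?thesis unfolding w_def[symmetric] by (simp add: field_simps power2_eq_square)
  qed
  ultimately show ?thesis by (simp add: S_def algebra_simps)
qed

lemma ex_minimum: "\<exists>Z. \<forall>Y. S Z - P \<bullet> Z \<le> S Y - P \<bullet> Y"
proof -
  obtain a where a: "a \<in> A" using attained by blast
  define k where "k = norm (a - P)"
  \<comment> \<open>For \<open>norm Y > \<rho>\<close> one gets
    \<open>norm Y / 2 - k \<ge> 1 + |m 0 - c a|\<close>; the lower bound of \<open>S\<close> by the
    single affine function of slope \<open>a\<close> then exceeds the value \<open>m 0\<close> at
    the origin.\<close>
  define \<rho> where "\<rho> = 2 * k + 2 * (1 + \<bar>m 0 - c a\<bar>)"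
  have k0: "k \<ge> 0" by (simp add: k_def)
  have \<rho>: "\<rho> \<ge> 1" using k0 by (simp add: \<rho>_def)
  have "\<exists>Z\<in>cball 0 \<rho>. \<forall>Y\<in>cball 0 \<rho>. S Z - P \<bullet> Z \<le> S Y - P \<bullet> Y"
    by (rule continuous_attains_inf) (use \<rho> in \<open>auto intro!: continuous_intros continuous_on_subset[OF continuous_S]\<close>)
  then obtain Z where "\<forall>Y\<in>cball 0 \<rho>. S Z - P \<bullet> Z \<le> S Y - P \<bullet> Y" by blast
  then have Z: "\<And>Y. norm Y \<le> \<rho> \<Longrightarrow> S Z - P \<bullet> Z \<le> S Y - P \<bullet> Y" by simp
  have "S Z - P \<bullet> Z \<le> S Y - P \<bullet> Y" if Y: "norm Y > \<rho>" for Y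
  proof -
    have "S Z - P \<bullet> Z \<le> m 0" using Z[of 0] \<rho> by (simp add: S_def)
    also have "m 0 \<le> c a + (1 + \<bar>m 0 - c a\<bar>)" by simp
    also have "1 + \<bar>m 0 - c a\<bar> \<le> norm Y * (norm Y / 2 - k)"
    proof -
      have 1: "1 + \<bar>m 0 - c a\<bar> \<le> norm Y / 2 - k" using Y by (simp add: \<rho>_def)
      then have "1 * (norm Y / 2 - k) \<le> norm Y * (norm Y / 2 - k)" using Y \<rho> by (intro mult_right_mono) auto
      with 1 show ?thesis by simp
    qed
    also have "c a + norm Y * (norm Y / 2 - k) = (norm Y)\<^sup>2 / 2 - norm Y * k + c a"
      by (simp add: power2_eq_square algebra_simps)
    also have "- (norm Y * k) \<le> Y \<bullet> (a - P)" using Cauchy_Schwarz_ineq2[of Y "a - P"] by (simp add: k_def abs_le_iff)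
    then have "(norm Y)\<^sup>2 / 2 - norm Y * k + c a \<le> (norm Y)\<^sup>2 / 2 + Y \<bullet> (a - P) + c a" by simp
    also have "\<dots> \<le> S Y - P \<bullet> Y" using upper[OF a, of Y] by (simp add: S_def inner_diff_right inner_commute)
    finally show ?thesis by simp
  qed
  then have "\<forall>Y. S Z - P \<bullet> Z \<le> S Y - P \<bullet> Y" using Z by (meson not_le)
  then show ?thesis by blast
qed

definition J where "J P = (SOME Z. \<forall>Y. S Z - P \<bullet> Z \<le> S Y - P \<bullet> Y)"

text \<open>Strong convexity improves minimality to quadratic growth: compare with the point at
  fraction \<open>t\<close> of the segment, divide by \<open>t\<close> and let \<open>t\<close> tend
  to 0. The growth makes the minimiser unique, so the choice in \<open>J\<close> is
  harmless.\<close>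

lemma J_min: "S (J P) - P \<bullet> J P + (norm (Y - J P))\<^sup>2 / 2 \<le> S Y - P \<bullet> Y"
proof -
  have min: "S (J P) - P \<bullet> J P \<le> S Y - P \<bullet> Y" for Y
    using someI_ex[OF ex_minimum[of P]] unfolding J_def by blast
  have "(norm (Y - J P))\<^sup>2 / 2 \<le> (S Y - P \<bullet> Y) - (S (J P) - P \<bullet> J P)"
  proof (rule field_le_mult_one_interval)
    fix z :: real assume z: "0 < z" "z < 1"
    define t where "t = 1 - z"
    have t: "0 < t" "t < 1" "z = 1 - t" using z by (auto simp: t_def)
    have "S (J P) - P \<bullet> J P \<le> S (J P + t *\<^sub>R (Y - J P)) - P \<bullet> (J P + t *\<^sub>R (Y - J P))" by (rule min)
    also have "\<dots> \<le> (1 - t) * S (J P) + t * S Y - t * (1 - t) * (norm (Y - J P))\<^sup>2 / 2 - P \<bullet> (J P + t *\<^sub>R (Y - J P))"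
      using S_strongly_convex[of t "J P" Y] t by simp
    finally have "t * (z * ((norm (Y - J P))\<^sup>2 / 2)) \<le> t * ((S Y - P \<bullet> Y) - (S (J P) - P \<bullet> J P))"
      unfolding t(3) by (simp add: algebra_simps)
    then show "z * ((norm (Y - J P))\<^sup>2 / 2) \<le> (S Y - P \<bullet> Y) - (S (J P) - P \<bullet> J P)" using t(1) by simp
  qed
  then show ?thesis by simp
qed

text \<open>The sum of the growth inequalities at the two minimisers; \<open>J\<close> is firmly
  nonexpansive.\<close>

lemma J_monotone: "(norm (J P - J P'))\<^sup>2 \<le> (P - P') \<bullet> (J P - J P')"
  using J_min[of P "J P'"] J_min[of P' "J P"]
  by (simp add: algebra_simps norm_minus_commute inner_commute)

lemma J_lipschitz: "1-lipschitz_on UNIV J"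
proof (rule lipschitz_onI)
  fix P P'
  have "norm (J P - J P') * norm (J P - J P') \<le> norm (P - P') * norm (J P - J P')"
    using J_monotone[of P P'] norm_cauchy_schwarz[of "P - P'" "J P - J P'"] by (simp add: power2_eq_square)
  then have "norm (J P - J P') \<le> norm (P - P')"
    using mult_right_le_imp_le by (cases "norm (J P - J P') = 0") force+
  then show "dist (J P) (J P') \<le> 1 * dist P P'" by (simp add: dist_norm)
qed simp

lemma J_unique: assumes "\<And>Y. S Z + P \<bullet> (Y - Z) \<le> S Y" shows "J P = Z"
proof -
  have "(norm (Z - J P))\<^sup>2 \<le> 0" using J_min[of P Z] assms[of "J P"] unfolding inner_diff_right by linarith
  then show ?thesis by simp
qed

lemma S_subgradient: "J P = Z \<Longrightarrow> S Z + P \<bullet> (Y - Z) \<le> S Y"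
proof -
  assume "J P = Z"
  then have "S Z - P \<bullet> Z + (norm (Y - Z))\<^sup>2 / 2 \<le> S Y - P \<bullet> Y" using J_min[of P Y] by simp
  then show ?thesis unfolding inner_diff_right using zero_le_power2[of "norm (Y - Z)"] by linarith
qed

text \<open>If the slope \<open>a\<close> is active at \<open>Y\<close>, then \<open>a + Y\<close>
  is a subgradient of \<open>S\<close> at \<open>Y\<close>.\<close>

lemma J_surj: "\<exists>P. J P = Y"
proof -
  obtain a where a: "a \<in> A" "m Y = Y \<bullet> a + c a" using attained by blast
  have "J (a + Y) = Y"
  proof (rule J_unique)
    fix Y'
    have "0 \<le> (norm (Y' - Y))\<^sup>2" by simp
    then have "Y \<bullet> Y' - (norm Y)\<^sup>2 / 2 \<le> (norm Y')\<^sup>2 / 2"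
      by (simp add: power2_norm_eq_inner algebra_simps inner_commute)
    then show "S Y + (a + Y) \<bullet> (Y' - Y) \<le> S Y'"
      using upper[OF a(1), of Y'] a(2) by (simp add: S_def algebra_simps inner_commute power2_norm_eq_inner)
  qed
  then show ?thesis by blast
qed

definition T where "T P = P \<bullet> J P - S (J P)"

lemma T_ge: "P \<bullet> Y - S Y \<le> T P"
  unfolding T_def using J_min[of P Y] zero_le_power2[of "norm (Y - J P)"] by linarith

text \<open>\<open>T_ge\<close> used at both points squeezes the increment between
  \<open>J P \<bullet> (y - P)\<close> and \<open>J y \<bullet> (y - P)\<close>; these differ by at
  most the squared distance because \<open>J\<close> is 1-Lipschitz.\<close>

lemma T_has_derivative: "(T has_derivative (\<lambda>d. J P \<bullet> d)) (at P)"
  unfolding has_derivative_at_alt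
proof (intro conjI allI impI)
  show "bounded_linear ((\<bullet>) (J P))" by (rule bounded_linear_inner_right)
  fix e :: real assume e: "e > 0"
  have "norm (T y - T P - J P \<bullet> (y - P)) \<le> e * norm (y - P)" if y: "norm (y - P) < e" for y
  proof -
    have 1: "J P \<bullet> (y - P) \<le> T y - T P" using T_ge[of y "J P"] by (simp add: T_def algebra_simps inner_commute)
    have "T y - T P \<le> J y \<bullet> (y - P)" using T_ge[of P "J y"] by (simp add: T_def algebra_simps inner_commute)
    then have "T y - T P - J P \<bullet> (y - P) \<le> (J y - J P) \<bullet> (y - P)" by (simp add: inner_diff_left)
    also have "\<dots> \<le> norm (J y - J P) * norm (y - P)" by (rule norm_cauchy_schwarz)
    also have "\<dots> \<le> norm (y - P) * norm (y - P)"
      using lipschitz_onD[OF J_lipschitz, of y P] by (intro mult_right_mono) (auto simp: dist_norm)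
    also have "\<dots> \<le> e * norm (y - P)" using y by (intro mult_right_mono) auto
    finally show ?thesis using 1 by simp
  qed
  then show "\<exists>d>0. \<forall>y. norm (y - P) < d \<longrightarrow> norm (T y - T P - J P \<bullet> (y - P)) \<le> e * norm (y - P)"
    using e by blast
qed

text \<open>A quadratic upper bound on \<open>S\<close> at a point where \<open>J\<close> is differentiable makes the derivative of
  \<open>J\<close> invertible; the Hessian of \<open>S\<close> is its inverse.\<close>

lemma expansion_at_contact:
  assumes M: "(J has_derivative M) (at P)" and Z: "J P = Z" and b: "b > 0" and r: "r > 0"
    and contact: "\<And>h. norm h < r \<Longrightarrow> S (Z + h) \<le> S Z + P \<bullet> h + b * (norm h)\<^sup>2 / 2"
  shows "\<exists>X. linear X \<and> (\<forall>\<epsilon>>0. \<exists>s>0. \<forall>h. norm h < s \<longrightarrow>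
     \<bar>S (Z + h) - S Z - P \<bullet> h - (X h \<bullet> h) / 2\<bar> \<le> \<epsilon> * (norm h)\<^sup>2)"
proof -
  have lin: "linear M" using M has_derivative_linear by blast
  have TP: "T P = P \<bullet> Z - S Z" by (simp add: T_def Z)
  have exp: "\<exists>s>0. \<forall>d. norm d < s \<longrightarrow> \<bar>T (P + d) - T P - Z \<bullet> d - (M d \<bullet> d) / 2\<bar> \<le> \<eta> * (norm d)\<^sup>2" if "\<eta> > 0" for \<eta>
    using second_order_expansion[OF zero_less_one T_has_derivative M that] unfolding Z .
  \<comment> \<open>Conjugation reverses inequalities: curvature at most \<open>b\<close> for
    \<open>S\<close> gives curvature at least \<open>1 / b\<close> for \<open>T\<close>, hence for
    \<open>M\<close>. The test point \<open>h = d / b\<close> is the maximiser in the conjugate of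
    \<open>b * |h|^2 / 2\<close>.\<close>
  have pos: "(norm d)\<^sup>2 / b \<le> M d \<bullet> d" for d
  proof (rule quadratic_le_of_asymptotic[of "\<lambda>d. (norm d)\<^sup>2 / b" "\<lambda>d. M d \<bullet> d"])
    fix \<epsilon> :: real assume "\<epsilon> > 0"
    then obtain s where s: "s > 0" "\<And>d. norm d < s \<Longrightarrow> \<bar>T (P + d) - T P - Z \<bullet> d - (M d \<bullet> d) / 2\<bar> \<le> \<epsilon> / 2 * (norm d)\<^sup>2"
      using exp[of "\<epsilon> / 2"] by auto
    have "(norm d)\<^sup>2 / b \<le> M d \<bullet> d + \<epsilon> * (norm d)\<^sup>2" if d: "norm d < min s (b * r)" for d
    proof -
      define h where "h = d /\<^sub>R b"
      have "norm h = norm d / b" using b by (simp add: h_def divide_inverse_commute)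
      then have "norm h < r" using d b by (simp add: pos_divide_less_eq mult.commute)
      from contact[OF this] T_ge[of "P + d" "Z + h"] TP
      have "d \<bullet> Z + d \<bullet> h - b * (norm h)\<^sup>2 / 2 \<le> T (P + d) - T P" by (simp add: algebra_simps)
      moreover have "d \<bullet> h = (norm d)\<^sup>2 / b" by (simp add: h_def power2_norm_eq_inner divide_inverse_commute)
      moreover have "b * (norm h)\<^sup>2 = (norm d)\<^sup>2 / b" using b
        by (simp add: h_def power_mult_distrib power2_eq_square field_simps)
      moreover have "T (P + d) - T P - Z \<bullet> d \<le> (M d \<bullet> d) / 2 + \<epsilon> / 2 * (norm d)\<^sup>2"
      proof -
        have "norm d < s" using d by simp
        from s(2)[OF this] show ?thesis unfolding abs_le_iff by linarith
      qed
      ultimately show ?thesis by (simp add: inner_commute)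
    qed
    then show "\<exists>s>0. \<forall>d. norm d < s \<longrightarrow> (norm d)\<^sup>2 / b \<le> M d \<bullet> d + \<epsilon> * (norm d)\<^sup>2"
      using s(1) b r by (intro exI[of _ "min s (b * r)"]) auto
  qed (auto simp: linear_cmul[OF lin] power_mult_distrib power2_eq_square)
  have "inj M"
  proof (rule linear_injective_0[OF lin, THEN iffD2], intro allI impI)
    fix d assume "M d = 0"
    then have "(norm d)\<^sup>2 / b \<le> 0" using pos[of d] by simp
    then show "d = 0" using b by (simp add: divide_le_0_iff)
  qed
  then obtain X where X: "linear X" "\<And>x. X (M x) = x" using linear_injective_isomorphism[OF lin] by blast
  obtain K where K: "K > 0" "\<And>x. norm (X x) \<le> norm x * K"
    using bounded_linear.pos_bounded[OF linear_conv_bounded_linear[THEN iffD1, OF X(1)]] by blast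
  \<comment> \<open>\<open>J\<close> need not be injective, so a point with value
    \<open>Z + h\<close> could lie far from \<open>P\<close>. Monotonicity along the ray through
    \<open>d\<close> excludes this: \<open>low\<close> at radius \<sigma> would force
    \<open>norm h \<ge> \<sigma> / (2 * b)\<close>.\<close>
  have small: "\<exists>s>0. \<forall>h d. norm h < s \<longrightarrow> J (P + d) = Z + h \<longrightarrow>
      norm d \<le> 2 * b * norm h \<and> norm d < \<rho>" if \<rho>: "\<rho> > 0" for \<rho>
  proof -
    have "1 / (2 * b) > 0" using b by simp
    then obtain s where s: "s > 0" "\<And>y. norm (y - P) < s \<Longrightarrow> norm (J y - J P - M (y - P)) \<le> 1 / (2 * b) * norm (y - P)"
      using M unfolding has_derivative_at_alt by blast
    have low: "(norm d)\<^sup>2 / (2 * b) \<le> (J (P + d) - Z) \<bullet> d" if d: "norm d < s" for d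
    proof -
      have "- ((J (P + d) - Z - M d) \<bullet> d) \<le> norm (J (P + d) - Z - M d) * norm d"
        using Cauchy_Schwarz_ineq2[of "J (P + d) - Z - M d" d] by (simp add: abs_le_iff)
      also have "\<dots> \<le> 1 / (2 * b) * norm d * norm d" using s(2)[of "P + d"] d Z by (intro mult_right_mono) auto
      finally have "M d \<bullet> d - (norm d)\<^sup>2 / (2 * b) \<le> (J (P + d) - Z) \<bullet> d"
        by (simp add: inner_diff_left power2_eq_square)
      moreover have "(norm d)\<^sup>2 / b = (norm d)\<^sup>2 / (2 * b) + (norm d)\<^sup>2 / (2 * b)" using b by (simp add: field_simps)
      ultimately show ?thesis using pos[of d] by linarith
    qed
    define \<sigma> where "\<sigma> = min \<rho> s / 2"
    have \<sigma>: "\<sigma> > 0" "\<sigma> < s" "\<sigma> < \<rho>" using s(1) \<rho> by (auto simp: \<sigma>_def min_def)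
    have "norm d \<le> 2 * b * norm h \<and> norm d < \<rho>" if h: "norm h < \<sigma> / (2 * b)" and Jd: "J (P + d) = Z + h" for h d
    proof -
      have nd: "norm d < \<sigma>"
      proof (rule ccontr)
        assume "\<not> norm d < \<sigma>"
        then have ge: "norm d \<ge> \<sigma>" by simp
        then have d0: "norm d > 0" using \<sigma> by linarith
        define t where "t = \<sigma> / norm d"
        have t: "0 < t" "t \<le> 1" "norm (t *\<^sub>R d) = \<sigma>" using ge d0 \<sigma> by (auto simp: t_def)
        have "0 \<le> ((P + d) - (P + t *\<^sub>R d)) \<bullet> (J (P + d) - J (P + t *\<^sub>R d))"
          using J_monotone[of "P + d" "P + t *\<^sub>R d"] zero_le_power2 order_trans by blast
        also have "(P + d) - (P + t *\<^sub>R d) = (1 - t) *\<^sub>R d" by (simp add: algebra_simps)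
        finally have "0 \<le> (1 - t) * ((J (P + d) - J (P + t *\<^sub>R d)) \<bullet> d)" by (simp add: inner_commute)
        have key: "(J (P + t *\<^sub>R d) - Z) \<bullet> d \<le> h \<bullet> d"
        proof (cases "t = 1")
          case True
          then show ?thesis using Jd by simp
        next
          case False
          then have "0 \<le> (J (P + d) - J (P + t *\<^sub>R d)) \<bullet> d"
            using \<open>0 \<le> (1 - t) * _\<close> t(2) by (simp add: zero_le_mult_iff)
          then show ?thesis using Jd by (simp add: inner_diff_left inner_add_left)
        qed
        have "t * (t * (norm d)\<^sup>2 / (2 * b)) = (norm (t *\<^sub>R d))\<^sup>2 / (2 * b)" by (simp add: power2_eq_square power_mult_distrib)
        also have "\<dots> \<le> (J (P + t *\<^sub>R d) - Z) \<bullet> (t *\<^sub>R d)" by (rule low) (use t \<sigma> in simp)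
        also have "\<dots> \<le> t * (h \<bullet> d)" using key t(1) by simp
        finally have "t * (t * (norm d)\<^sup>2 / (2 * b)) \<le> t * (h \<bullet> d)" .
        then have "t * (norm d)\<^sup>2 / (2 * b) \<le> h \<bullet> d" by (rule mult_left_le_imp_le[OF _ t(1)])
        also have "\<dots> \<le> norm h * norm d" by (rule norm_cauchy_schwarz)
        finally have "(t * norm d / (2 * b)) * norm d \<le> norm h * norm d" by (simp add: power2_eq_square)
        then have "t * norm d / (2 * b) \<le> norm h" by (rule mult_right_le_imp_le[OF _ d0])
        moreover have "t * norm d = \<sigma>" using d0 by (simp add: t_def)
        ultimately show False using h by simp
      qed
      have "(norm d / (2 * b)) * norm d \<le> norm h * norm d"
        using low[of d] nd \<sigma> Jd norm_cauchy_schwarz[of h d] by (simp add: power2_eq_square)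
      then have "norm d \<le> 2 * b * norm h" using b by (cases "norm d = 0") (auto simp: pos_divide_le_eq algebra_simps)
      then show ?thesis using nd \<sigma> by simp
    qed
    then show ?thesis using \<sigma> b by (intro exI[of _ "\<sigma> / (2 * b)"]) auto
  qed
  have "\<exists>s>0. \<forall>h. norm h < s \<longrightarrow> \<bar>S (Z + h) - S Z - P \<bullet> h - (X h \<bullet> h) / 2\<bar> \<le> \<epsilon> * (norm h)\<^sup>2" if \<epsilon>: "\<epsilon> > 0" for \<epsilon>
  proof -
    \<comment> \<open>\<open>6 * b\<^sup>2\<close> pays for \<open>e1\<close> and
      \<open>d \<bullet> e2\<close>, and \<open>K * (2 * b)\<close> for
      \<open>X e2 \<bullet> h\<close>.\<close>
    define C where "C = K * (2 * b) + 6 * b\<^sup>2"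
    have C: "C > 0" using K b by (simp add: C_def add_pos_pos)
    define \<eta> where "\<eta> = \<epsilon> / C"
    have \<eta>: "\<eta> > 0" using \<epsilon> C by (simp add: \<eta>_def)
    obtain s1 where s1: "s1 > 0" "\<And>d. norm d < s1 \<Longrightarrow> \<bar>T (P + d) - T P - Z \<bullet> d - (M d \<bullet> d) / 2\<bar> \<le> \<eta> * (norm d)\<^sup>2"
      using exp[OF \<eta>] by blast
    obtain s2 where s2: "s2 > 0" "\<And>y. norm (y - P) < s2 \<Longrightarrow> norm (J y - J P - M (y - P)) \<le> \<eta> * norm (y - P)"
      using M \<eta> unfolding has_derivative_at_alt by blast
    have "min s1 s2 > 0" using s1 s2 by simp
    from small[OF this] obtain s where s: "s > 0"
      "\<And>h d. norm h < s \<Longrightarrow> J (P + d) = Z + h \<Longrightarrow> norm d \<le> 2 * b * norm h \<and> norm d < min s1 s2" by blast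
    have "\<bar>S (Z + h) - S Z - P \<bullet> h - (X h \<bullet> h) / 2\<bar> \<le> \<epsilon> * (norm h)\<^sup>2" if h: "norm h < s" for h
    proof -
      obtain P' where P': "J P' = Z + h" using J_surj by blast
      define d where "d = P' - P"
      have Jd: "J (P + d) = Z + h" using P' by (simp add: d_def)
      from s(2)[OF h Jd] have d: "norm d \<le> 2 * b * norm h" "norm d < s1" "norm d < s2" by auto
      define e1 where "e1 = T (P + d) - T P - Z \<bullet> d - (M d \<bullet> d) / 2"
      define e2 where "e2 = h - M d"
      have e1: "\<bar>e1\<bar> \<le> \<eta> * (norm d)\<^sup>2" unfolding e1_def by (rule s1(2)[OF d(2)])
      have e2: "norm e2 \<le> \<eta> * norm d" using s2(2)[of "P + d"] d(3) Z Jd by (simp add: e2_def)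
      \<comment> \<open>Equality in the conjugacy relation at \<open>P + d\<close> turns the
        expansion of \<open>T\<close> into one of \<open>S\<close>; replacing \<open>d\<close> by
        \<open>X h\<close> costs only terms containing \<open>e2\<close>.\<close>
      have "S (Z + h) = (P + d) \<bullet> (Z + h) - T (P + d)" by (simp add: T_def Jd)
      then have Sh: "S (Z + h) - S Z - P \<bullet> h = d \<bullet> h - (M d \<bullet> d) / 2 - e1"
        unfolding e1_def using TP by (simp add: algebra_simps inner_commute)
      have "M d = h - e2" by (simp add: e2_def)
      then have "M d \<bullet> d = d \<bullet> h - d \<bullet> e2" by (simp add: inner_diff_left inner_diff_right inner_commute)
      moreover have "d = X (M d)" using X(2) by simp
      then have dX: "d = X h - X e2" by (simp add: e2_def linear_diff[OF X(1)])
      then have "d \<bullet> h = X h \<bullet> h - X e2 \<bullet> h" by (metis inner_diff_left)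
      ultimately have "S (Z + h) - S Z - P \<bullet> h - (X h \<bullet> h) / 2 = (d \<bullet> e2 - X e2 \<bullet> h) / 2 - e1"
        using Sh by (simp add: field_simps)
      moreover have "\<bar>(p - q) / 2 - e\<bar> \<le> \<bar>p\<bar> / 2 + \<bar>q\<bar> / 2 + \<bar>e\<bar>" for p q e :: real by (auto simp: abs_if field_simps)
      ultimately have "\<bar>S (Z + h) - S Z - P \<bullet> h - (X h \<bullet> h) / 2\<bar> \<le> \<bar>d \<bullet> e2\<bar> / 2 + \<bar>X e2 \<bullet> h\<bar> / 2 + \<bar>e1\<bar>" by metis
      moreover have nd2: "(norm d)\<^sup>2 \<le> (2 * b * norm h)\<^sup>2" using d(1) by (intro power_mono) auto
      have "\<bar>d \<bullet> e2\<bar> \<le> \<eta> * (norm d)\<^sup>2"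
        using Cauchy_Schwarz_ineq2[of d e2] mult_left_mono[OF e2, of "norm d"] by (simp add: power2_eq_square algebra_simps)
      moreover have "\<bar>X e2 \<bullet> h\<bar> \<le> \<eta> * (K * (2 * b)) * (norm h)\<^sup>2"
      proof -
        have "\<bar>X e2 \<bullet> h\<bar> \<le> norm (X e2) * norm h" by (rule Cauchy_Schwarz_ineq2)
        also have "\<dots> \<le> (\<eta> * (2 * b * norm h) * K) * norm h"
        proof (intro mult_right_mono)
          have "norm (X e2) \<le> norm e2 * K" by (rule K)
          also have "\<dots> \<le> (\<eta> * (2 * b * norm h)) * K"
            using e2 d(1) \<eta> K(1) by (intro mult_right_mono) (auto intro: order_trans mult_left_mono)
          finally show "norm (X e2) \<le> \<eta> * (2 * b * norm h) * K" .
        qed simp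
        finally show ?thesis by (simp add: power2_eq_square algebra_simps)
      qed
      ultimately have "\<bar>S (Z + h) - S Z - P \<bullet> h - (X h \<bullet> h) / 2\<bar> \<le> \<eta> * (norm d)\<^sup>2 / 2 + \<eta> * (K * (2 * b)) * (norm h)\<^sup>2 / 2 + \<eta> * (norm d)\<^sup>2"
        using e1 by linarith
      also have "\<dots> \<le> \<eta> * (2 * b * norm h)\<^sup>2 / 2 + \<eta> * (K * (2 * b)) * (norm h)\<^sup>2 + \<eta> * (2 * b * norm h)\<^sup>2"
        using mult_left_mono[OF nd2, of \<eta>] \<eta> K(1) b by (intro add_mono) auto
      also have "\<dots> = \<eta> * C * (norm h)\<^sup>2" by (simp add: C_def power2_eq_square algebra_simps)
      also have "\<eta> * C = \<epsilon>" using C by (simp add: \<eta>_def)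
      finally show ?thesis .
    qed
    then show ?thesis using s(1) by blast
  qed
  then show ?thesis using X(1) by blast
qed

text \<open>Jensen's lemma: the contact points of \<open>S - \<Psi>\<close> with slopes \<open>q\<close> near \<open>0\<close> come from the points
  \<open>P = Q + B Z + q\<close>; as \<open>q\<close> is a Lipschitz function of \<open>P\<close>, the set of these \<open>P\<close> is not negligible,
  so Rademacher's theorem applies to \<open>J\<close> at one of them.\<close>

lemma perturbed_maximum_expansion:
  assumes B: "linear B" "\<And>x y. B x \<bullet> y = x \<bullet> B y" and r: "r > 0" and \<delta>: "\<delta> > 0" and Ya: "Ya \<in> ball Yc r"
    and sphere: "\<And>Y. Y \<in> sphere Yc r \<Longrightarrow>
       S Y - (Q \<bullet> Y + (B Y \<bullet> Y) / 2) < S Ya - (Q \<bullet> Ya + (B Ya \<bullet> Ya) / 2)"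
  shows "\<exists>Z q X. Z \<in> ball Yc r \<and> norm q < \<delta> \<and> linear X \<and> (\<forall>h. X h \<bullet> h \<le> B h \<bullet> h) \<and>
     (\<forall>\<epsilon>>0. \<exists>s>0. \<forall>h. norm h < s \<longrightarrow>
       \<bar>S (Z + h) - S Z - (Q + B Z + q) \<bullet> h - (X h \<bullet> h) / 2\<bar> \<le> \<epsilon> * (norm h)\<^sup>2)"
proof -
  define \<Psi> where "\<Psi> Y = Q \<bullet> Y + (B Y \<bullet> Y) / 2" for Y
  obtain K where K: "K > 0" "\<And>x. norm (B x) \<le> norm x * K"
    using bounded_linear.pos_bounded[OF linear_conv_bounded_linear[THEN iffD1, OF B(1)]] by blast
  have cB: "continuous_on UNIV B" using B(1) linear_continuous_on linear_conv_bounded_linear by blast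
  have cont: "continuous_on UNIV (\<lambda>Y. S Y - \<Psi> Y)"
    unfolding \<Psi>_def by (intro continuous_intros continuous_S cB) auto
  have \<Psi>: "\<Psi> (Z + h) = \<Psi> Z + (Q + B Z) \<bullet> h + (B h \<bullet> h) / 2" for Z h
    by (simp add: \<Psi>_def linear_add[OF B(1)] algebra_simps B(2)[of Z h] inner_commute[of h "B Z"]) (simp add: B(2) inner_commute)
  have "\<exists>\<gamma>>0. \<forall>Y\<in>sphere Yc r. S Y - \<Psi> Y + \<gamma> \<le> S Ya - \<Psi> Ya"
  proof -
    have "sphere Yc r \<noteq> {}" using r by simp
    then obtain Y where Y: "Y \<in> sphere Yc r" "\<And>Y'. Y' \<in> sphere Yc r \<Longrightarrow> S Y' - \<Psi> Y' \<le> S Y - \<Psi> Y"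
      using continuous_attains_sup[OF compact_sphere _ continuous_on_subset[OF cont subset_UNIV], of Yc r] by blast
    show ?thesis
      using sphere[OF Y(1)] Y(2) unfolding \<Psi>_def[symmetric]
      by (intro exI[of _ "(S Ya - \<Psi> Ya) - (S Y - \<Psi> Y)"]) (auto simp: algebra_simps)
  qed
  then obtain \<gamma> where \<gamma>: "\<gamma> > 0" "\<And>Y. Y \<in> sphere Yc r \<Longrightarrow> S Y - \<Psi> Y + \<gamma> \<le> S Ya - \<Psi> Ya" by blast
  \<comment> \<open>A tilt \<open>q\<close> of this size changes the comparison between
    \<open>Ya\<close> and points of the sphere by less than \<gamma>, so the tilted maximum stays in
    the open ball.\<close>
  define \<delta>' where "\<delta>' = min \<delta> (\<gamma> / (4 * r))"
  have \<delta>': "\<delta>' > 0" "\<delta>' \<le> \<delta>" "\<delta>' * (2 * r) < \<gamma>"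
  proof -
    show "\<delta>' > 0" "\<delta>' \<le> \<delta>" using \<delta> \<gamma>(1) r by (auto simp: \<delta>'_def)
    have "\<delta>' * (2 * r) \<le> (\<gamma> / (4 * r)) * (2 * r)" using r by (intro mult_right_mono) (auto simp: \<delta>'_def)
    also have "\<dots> < \<gamma>" using r \<gamma>(1) by simp
    finally show "\<delta>' * (2 * r) < \<gamma>" .
  qed
  define \<kappa> where "\<kappa> P = P - Q - B (J P)" for P
  define contact where "contact P \<longleftrightarrow> J P \<in> ball Yc r \<and> norm (\<kappa> P) < \<delta>' \<and>
     (\<forall>Y\<in>cball Yc r. S Y - \<Psi> Y - \<kappa> P \<bullet> Y \<le> S (J P) - \<Psi> (J P) - \<kappa> P \<bullet> J P)" for P
  have ex_contact: "\<exists>P. contact P \<and> \<kappa> P = q" if q: "norm q < \<delta>'" for q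
  proof -
    have "\<exists>Z\<in>cball Yc r. \<forall>Y\<in>cball Yc r. S Y - \<Psi> Y - q \<bullet> Y \<le> S Z - \<Psi> Z - q \<bullet> Z"
      by (rule continuous_attains_sup) (use r in \<open>auto intro!: continuous_intros continuous_on_subset[OF cont]\<close>)
    then obtain Z where Z: "Z \<in> cball Yc r" "\<And>Y. Y \<in> cball Yc r \<Longrightarrow> S Y - \<Psi> Y - q \<bullet> Y \<le> S Z - \<Psi> Z - q \<bullet> Z" by blast
    have Zb: "Z \<in> ball Yc r"
    proof (rule ccontr)
      assume "Z \<notin> ball Yc r"
      then have Zs: "Z \<in> sphere Yc r" using Z(1) by auto
      have "q \<bullet> (Ya - Z) \<le> norm q * norm (Ya - Z)" by (rule norm_cauchy_schwarz)
      also have "\<dots> \<le> \<delta>' * (2 * r)"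
      proof (rule mult_mono)
        have "dist Ya Z \<le> dist Ya Yc + dist Yc Z" by (rule dist_triangle)
        then show "norm (Ya - Z) \<le> 2 * r" using Ya Z(1) dist_commute[of Ya Yc]
          unfolding mem_ball mem_cball dist_norm[symmetric] by linarith
      qed (use q \<delta>'(1) in auto)
      also have "\<dots> < \<gamma>" by (rule \<delta>'(3))
      finally have "q \<bullet> Ya - q \<bullet> Z < \<gamma>" by (simp add: inner_diff_right)
      moreover have "S Ya - \<Psi> Ya - q \<bullet> Ya \<le> S Z - \<Psi> Z - q \<bullet> Z" by (rule Z(2)) (use Ya in auto)
      ultimately show False using \<gamma>(2)[OF Zs] by simp
    qed
    obtain P where P: "J P = Z" using J_surj by blast
    obtain \<rho> where \<rho>: "\<rho> > 0" "ball Z \<rho> \<subseteq> ball Yc r" using Zb open_ball open_contains_ball by blast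
    define w where "w = P - Q - B Z - q"
    have le: "w \<bullet> h \<le> (B h \<bullet> h) / 2" if "norm h < \<rho>" for h
    proof -
      have "Z + h \<in> ball Z \<rho>" using that by (simp add: dist_norm)
      then have "Z + h \<in> cball Yc r" using \<rho>(2) by auto
      from Z(2)[OF this] have "S (Z + h) \<le> S Z + (Q + B Z + q) \<bullet> h + (B h \<bullet> h) / 2"
        by (simp add: \<Psi> algebra_simps)
      with S_subgradient[OF P, of "Z + h"] show ?thesis by (simp add: w_def algebra_simps)
    qed
    \<comment> \<open>First-order condition: the subgradient inequality and the maximum property
      bound the linear term \<open>w \<bullet> h\<close> by a quadratic one, so it vanishes. Hence
      \<open>P\<close> is determined by \<open>Z\<close> and \<open>q\<close>.\<close>
    have "w = 0"
    proof (rule ccontr)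
      assume "w \<noteq> 0"
      then have nw: "norm w > 0" by simp
      define t where "t = min (\<rho> / (2 * norm w)) (1 / K)"
      have t: "t > 0" using \<rho>(1) nw K(1) by (simp add: t_def)
      have "norm (t *\<^sub>R w) = t * norm w" using t by simp
      also have "\<dots> \<le> \<rho> / (2 * norm w) * norm w" by (intro mult_right_mono) (auto simp: t_def)
      also have "\<dots> < \<rho>" using nw \<rho>(1) by simp
      finally have "w \<bullet> (t *\<^sub>R w) \<le> (B (t *\<^sub>R w) \<bullet> (t *\<^sub>R w)) / 2" by (rule le)
      then have "t * (w \<bullet> w) \<le> t * (t * (B w \<bullet> w) / 2)" by (simp add: linear_cmul[OF B(1)])
      then have "w \<bullet> w \<le> t * (B w \<bullet> w) / 2" using t by simp
      also have "\<dots> \<le> t * (K * (w \<bullet> w)) / 2"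
      proof -
        have "B w \<bullet> w \<le> norm (B w) * norm w" by (rule norm_cauchy_schwarz)
        also have "\<dots> \<le> (norm w * K) * norm w" by (intro mult_right_mono K) auto
        also have "\<dots> = K * (w \<bullet> w)" by (simp add: power2_norm_eq_inner[symmetric] power2_eq_square)
        finally show ?thesis using t by simp
      qed
      also have "\<dots> = (t * K) * (w \<bullet> w) / 2" by simp
      also have "\<dots> \<le> 1 * (w \<bullet> w) / 2"
      proof -
        have "t * K \<le> 1 / K * K" using K(1) by (intro mult_right_mono) (auto simp: t_def)
        then have "t * K \<le> 1" using K(1) by simp
        then show ?thesis by (intro divide_right_mono mult_right_mono) auto
      qed
      finally have "w \<bullet> w \<le> 0" by simp
      then show False using \<open>w \<noteq> 0\<close> using inner_gt_zero_iff[of w] by linarith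
    qed
    then have "\<kappa> P = q" by (simp add: \<kappa>_def w_def P)
    moreover have "contact P" unfolding contact_def P \<open>\<kappa> P = q\<close> using Zb q Z(2) by blast
    ultimately show ?thesis by blast
  qed
  have "\<not> negligible (Collect contact)"
  proof
    assume neg: "negligible (Collect contact)"
    have "negligible (\<kappa> ` Collect contact)"
    proof (rule negligible_locally_Lipschitz_image[OF order_refl neg])
      fix x
      have "norm (\<kappa> y - \<kappa> x) \<le> (1 + K) * norm (y - x)" for y
      proof -
        have "\<kappa> y - \<kappa> x = (y - x) - B (J y - J x)" by (simp add: \<kappa>_def linear_diff[OF B(1)])
        then have "norm (\<kappa> y - \<kappa> x) \<le> norm (y - x) + norm (B (J y - J x))" by (metis norm_triangle_ineq4)
        also have "norm (B (J y - J x)) \<le> norm (J y - J x) * K" by (rule K)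
        also have "\<dots> \<le> norm (y - x) * K"
          using lipschitz_onD[OF J_lipschitz, of y x] K(1) by (intro mult_right_mono) (auto simp: dist_norm)
        finally show ?thesis by (simp add: algebra_simps)
      qed
      then show "\<exists>T B. open T \<and> x \<in> T \<and> (\<forall>y\<in>Collect contact \<inter> T. norm (\<kappa> y - \<kappa> x) \<le> B * norm (y - x))"
        by (intro exI[of _ UNIV] exI[of _ "1 + K"]) auto
    qed
    moreover have "ball 0 \<delta>' \<subseteq> \<kappa> ` Collect contact" using ex_contact by force
    ultimately have "negligible (ball (0::'a) \<delta>')" using negligible_subset by blast
    then show False using \<delta>'(1) open_not_negligible by (metis ball_eq_empty not_le open_ball)
  qed
  then have "\<not> Collect contact \<subseteq> {P. \<not> J differentiable (at P)}"
    using Rademacher_vector[OF J_lipschitz] negligible_subset by blast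
  then obtain P where P: "contact P" "J differentiable (at P)" by blast
  then obtain M where M: "(J has_derivative M) (at P)" unfolding differentiable_def by blast
  define Z where "Z = J P"
  have Z: "Z \<in> ball Yc r" "norm (\<kappa> P) < \<delta>'"
    "\<And>Y. Y \<in> cball Yc r \<Longrightarrow> S Y - \<Psi> Y - \<kappa> P \<bullet> Y \<le> S Z - \<Psi> Z - \<kappa> P \<bullet> Z"
    using P(1) by (auto simp: contact_def Z_def)
  have PQ: "P = Q + B Z + \<kappa> P" by (simp add: \<kappa>_def Z_def)
  obtain \<rho> where \<rho>: "\<rho> > 0" "ball Z \<rho> \<subseteq> ball Yc r" using Z(1) open_ball open_contains_ball by blast
  have up: "S (Z + h) \<le> S Z + P \<bullet> h + (B h \<bullet> h) / 2" if "norm h < \<rho>" for h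
  proof -
    have "Z + h \<in> ball Z \<rho>" using that by (simp add: dist_norm)
    then have "Z + h \<in> cball Yc r" using \<rho>(2) by auto
    from Z(3)[OF this] have "S (Z + h) \<le> S Z + (Q + B Z + \<kappa> P) \<bullet> h + (B h \<bullet> h) / 2"
      by (simp add: \<Psi> algebra_simps)
    then show ?thesis using PQ by simp
  qed
  have "\<exists>X. linear X \<and> (\<forall>\<epsilon>>0. \<exists>s>0. \<forall>h. norm h < s \<longrightarrow>
     \<bar>S (Z + h) - S Z - P \<bullet> h - (X h \<bullet> h) / 2\<bar> \<le> \<epsilon> * (norm h)\<^sup>2)"
  proof (rule expansion_at_contact[OF M Z_def[symmetric] K(1) \<rho>(1)])
    fix h :: 'a assume h: "norm h < \<rho>"
    have "B h \<bullet> h \<le> norm (B h) * norm h" by (rule norm_cauchy_schwarz)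
    also have "\<dots> \<le> (norm h * K) * norm h" by (intro mult_right_mono K) auto
    finally have "B h \<bullet> h \<le> K * (norm h)\<^sup>2" by (simp add: power2_eq_square algebra_simps)
    then show "S (Z + h) \<le> S Z + P \<bullet> h + K * (norm h)\<^sup>2 / 2" using up[OF h] by simp
  qed
  then obtain X where X: "linear X" "\<And>\<epsilon>. \<epsilon> > 0 \<Longrightarrow> \<exists>s>0. \<forall>h. norm h < s \<longrightarrow>
     \<bar>S (Z + h) - S Z - P \<bullet> h - (X h \<bullet> h) / 2\<bar> \<le> \<epsilon> * (norm h)\<^sup>2" by blast
  have "X h \<bullet> h \<le> B h \<bullet> h" for h
  proof (rule quadratic_le_of_asymptotic[of "\<lambda>h. X h \<bullet> h" "\<lambda>h. B h \<bullet> h"])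
    fix \<epsilon> :: real assume "\<epsilon> > 0"
    then obtain s where s: "s > 0" "\<And>h. norm h < s \<Longrightarrow> \<bar>S (Z + h) - S Z - P \<bullet> h - (X h \<bullet> h) / 2\<bar> \<le> \<epsilon> / 2 * (norm h)\<^sup>2"
      using X(2)[of "\<epsilon> / 2"] by auto
    have "X h \<bullet> h \<le> B h \<bullet> h + \<epsilon> * (norm h)\<^sup>2" if "norm h < min s \<rho>" for h
    proof -
      have h: "norm h < s" "norm h < \<rho>" using that by auto
      from s(2)[OF h(1)] up[OF h(2)] show ?thesis unfolding abs_le_iff by linarith
    qed
    then show "\<exists>s>0. \<forall>h. norm h < s \<longrightarrow> X h \<bullet> h \<le> B h \<bullet> h + \<epsilon> * (norm h)\<^sup>2"
      using s(1) \<rho>(1) by (intro exI[of _ "min s \<rho>"]) auto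
  qed (auto simp: linear_cmul[OF X(1)] linear_cmul[OF B(1)] power2_eq_square)
  then show ?thesis using Z(1,2) \<delta>'(2) X PQ
    by (intro exI[of _ Z] exI[of _ "\<kappa> P"] exI[of _ X]) auto
qed

end

section \<open>Superjets and sup-convolution\<close>

text \<open>The second-order superjet with its remainder spelled out. Only the quadratic form of
  \<open>X\<close> enters, so \<open>X\<close> stands for its symmetric part.\<close>

definition superjet :: "('a::real_inner \<Rightarrow> real) \<Rightarrow> 'a \<Rightarrow> 'a \<Rightarrow> ('a \<Rightarrow> 'a) \<Rightarrow> bool" where
  "superjet w z P X \<longleftrightarrow> linear X \<and> (\<forall>\<epsilon>>0. \<exists>s>0. \<forall>h. norm h < s \<longrightarrow>
     w (z + h) \<le> w z + P \<bullet> h + (X h \<bullet> h) / 2 + \<epsilon> * (norm h)\<^sup>2)"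

lemma superjet_shift: "superjet (\<lambda>h. w (z + h)) a P X \<longleftrightarrow> superjet w (z + a) P X"
  by (simp add: superjet_def add.assoc)

text \<open>Sup-convolution over the product \<open>A\<close>: \<open>ma.S\<close> equals
  \<open>\<epsilon> * W + |Y|^2\<close>, where \<open>W\<close> is the maximum over \<open>a\<close>
  of \<open>w a - |Y - a|^2 / (2 * \<epsilon>)\<close>. Jensen's lemma expands \<open>W\<close> to
  second order near 0, and the expansion passes to a superjet of \<open>w\<close> at the nearby
  maximiser \<open>a\<close>. Since the test function has constant Hessian \<open>B\<close> and the
  jets may sit near the maximum instead of at it, the matrix inequality carries no correction term
  in the square of \<open>B\<close>.\<close>

lemma theorem_on_sums_0:
  fixes w1 :: "'a::euclidean_space \<Rightarrow> real" and w2 :: "'b::euclidean_space \<Rightarrow> real"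
  assumes cont: "continuous_on (cball 0 R) w1" "continuous_on (cball 0 R) w2" and R: "R > 0"
    and B: "linear B" "\<And>x y. B x \<bullet> y = x \<bullet> B y"
    and max: "\<And>h k. norm h \<le> R \<Longrightarrow> norm k \<le> R \<Longrightarrow> (h, k) \<noteq> 0 \<Longrightarrow>
       w1 h + w2 k < w1 0 + w2 0 + Q \<bullet> (h, k) + (B (h, k) \<bullet> (h, k)) / 2"
    and \<delta>: "\<delta> > 0"
  shows "\<exists>z1 z2 P1 P2 X1 X2. norm z1 < \<delta> \<and> norm z2 < \<delta> \<and> norm (P1 - fst Q) < \<delta> \<and> norm (P2 - snd Q) < \<delta> \<and>
     superjet w1 z1 P1 X1 \<and> superjet w2 z2 P2 X2 \<and>
     (\<forall>h k. X1 h \<bullet> h + X2 k \<bullet> k \<le> B (h, k) \<bullet> (h, k))"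
proof -
  define A where "A = cball (0::'a) R \<times> cball (0::'b) R"
  define w where "w Y = w1 (fst Y) + w2 (snd Y)" for Y
  define \<Psi> where "\<Psi> Y = w1 0 + w2 0 + Q \<bullet> Y + (B Y \<bullet> Y) / 2" for Y
  have cA: "compact A" unfolding A_def by (intro compact_Times compact_cball)
  have cw: "continuous_on A w"
    unfolding w_def A_def by (intro continuous_intros continuous_on_compose2[OF cont(1)] continuous_on_compose2[OF cont(2)]) auto
  have cB: "continuous_on UNIV B" using B(1) linear_continuous_on linear_conv_bounded_linear by blast
  have c\<Psi>: "continuous_on UNIV \<Psi>" unfolding \<Psi>_def by (intro continuous_intros cB) auto
  obtain K where K: "K > 0" "\<And>x. norm (B x) \<le> norm x * K"
    using bounded_linear.pos_bounded[OF linear_conv_bounded_linear[THEN iffD1, OF B(1)]] by blast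
  have less: "w Y < \<Psi> Y" if "Y \<in> A" "Y \<noteq> 0" for Y
    using max[of "fst Y" "snd Y"] that by (simp add: A_def w_def \<Psi>_def mem_Times_iff)
  have ballA: "Y \<in> A" if "norm Y \<le> R" for Y
    using that norm_fst_le[of "fst Y" "snd Y"] norm_snd_le[of "snd Y" "fst Y"] by (auto simp: A_def mem_Times_iff)
  \<comment> \<open>\<open>K * r\<close> bounds the drift \<open>B Z\<close> of the slope, and
    \<open>2 * r\<close> the distance of the final point from 0.\<close>
  define r where "r = min (R / 4) (min (\<delta> / 4) (\<delta> / (4 * K)))"
  have r: "r > 0" "r \<le> R / 4" "r \<le> \<delta> / 4" "K * r \<le> \<delta> / 4"
  proof -
    show "r > 0" "r \<le> R / 4" "r \<le> \<delta> / 4" using R \<delta> K by (auto simp: r_def)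
    have "K * r \<le> K * (\<delta> / (4 * K))" using K by (intro mult_left_mono) (auto simp: r_def)
    then show "K * r \<le> \<delta> / 4" using K by simp
  qed
  have "\<exists>\<gamma>>0. \<forall>Y\<in>A - ball 0 (r / 2). w Y + \<gamma> \<le> \<Psi> Y"
  proof (cases "A - ball 0 (r / 2) = {}")
    case True
    then show ?thesis by (intro exI[of _ 1]) auto
  next
    case False
    have "compact (A - ball 0 (r / 2))" using cA by (intro compact_diff) auto
    moreover have "continuous_on (A - ball 0 (r / 2)) (\<lambda>Y. \<Psi> Y - w Y)"
      by (intro continuous_intros continuous_on_subset[OF c\<Psi>] continuous_on_subset[OF cw]) auto
    ultimately have "\<exists>Y\<in>A - ball 0 (r / 2). \<forall>Y'\<in>A - ball 0 (r / 2). \<Psi> Y - w Y \<le> \<Psi> Y' - w Y'"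
      by (intro continuous_attains_inf False)
    then obtain Y where Y: "Y \<in> A - ball 0 (r / 2)" "\<forall>Y'\<in>A - ball 0 (r / 2). \<Psi> Y - w Y \<le> \<Psi> Y' - w Y'" ..
    have "Y \<noteq> 0" using Y(1) r(1) by auto
    then have "\<Psi> Y - w Y > 0" using less Y(1) by simp
    then show ?thesis using Y(2) by (intro exI[of _ "\<Psi> Y - w Y"]) (auto simp: algebra_simps)
  qed
  then obtain \<gamma> where \<gamma>: "\<gamma> > 0" "\<And>Y. Y \<in> A \<Longrightarrow> Y \<notin> ball 0 (r / 2) \<Longrightarrow> w Y + \<gamma> \<le> \<Psi> Y" by blast
  have "uniformly_continuous_on A \<Psi>" by (intro compact_uniformly_continuous cA continuous_on_subset[OF c\<Psi>]) auto
  then obtain \<eta>0 where \<eta>0: "\<eta>0 > 0" "\<And>Y Y'. Y \<in> A \<Longrightarrow> Y' \<in> A \<Longrightarrow> dist Y' Y < \<eta>0 \<Longrightarrow> dist (\<Psi> Y') (\<Psi> Y) < \<gamma>"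
    using \<gamma>(1) unfolding uniformly_continuous_on_def by metis
  define \<eta> where "\<eta> = min (\<eta>0 / 2) (r / 2)"
  have \<eta>: "\<eta> > 0" "\<eta> < \<eta>0" "\<eta> \<le> r / 2" using \<eta>0(1) r(1) by (auto simp: \<eta>_def min_def)
  obtain M where M: "M > 0" "\<And>Y. Y \<in> A \<Longrightarrow> \<bar>w Y\<bar> \<le> M"
    using compact_imp_bounded[OF compact_continuous_image[OF cw cA]] unfolding bounded_pos by auto
  \<comment> \<open>Since \<open>|w| \<le> M\<close> on \<open>A\<close>, a maximiser for
    \<open>Y \<in> A\<close> satisfies
    \<open>|Y - a|^2 \<le> 4 * \<epsilon> * M = \<eta>\<^sup>2\<close>.\<close>
  define \<epsilon> where "\<epsilon> = \<eta>\<^sup>2 / (4 * M)"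
  have \<epsilon>: "\<epsilon> > 0" "4 * \<epsilon> * M = \<eta>\<^sup>2" using \<eta> M by (auto simp: \<epsilon>_def)
  define c where "c a = \<epsilon> * w a - (norm a)\<^sup>2 / 2" for a
  define m where "m Y = (SUP a\<in>A. Y \<bullet> a + c a)" for Y
  have "0 \<in> A" using ballA R by simp
  have att: "\<exists>a\<in>A. \<forall>a'\<in>A. Y \<bullet> a' + c a' \<le> Y \<bullet> a + c a" for Y
    by (rule continuous_attains_sup) (use cA \<open>0 \<in> A\<close> in \<open>auto simp: c_def intro!: continuous_intros cw\<close>)
  have m_eq: "\<exists>a\<in>A. m Y = Y \<bullet> a + c a \<and> (\<forall>a'\<in>A. Y \<bullet> a' + c a' \<le> m Y)" for Y
  proof -
    obtain a where a: "a \<in> A" "\<forall>a'\<in>A. Y \<bullet> a' + c a' \<le> Y \<bullet> a + c a" using att by blast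
    then have "m Y = Y \<bullet> a + c a" unfolding m_def by (intro cSup_eq_maximum) auto
    then show ?thesis using a by auto
  qed
  interpret ma: max_affine A c m
    by unfold_locales (use m_eq compact_imp_bounded[OF cA] in \<open>blast+\<close>)
  define W where "W Y = (ma.S Y - (norm Y)\<^sup>2) / \<epsilon>" for Y
  have quad: "(norm (Y - a))\<^sup>2 = (norm Y)\<^sup>2 - 2 * (Y \<bullet> a) + (norm a)\<^sup>2" for Y a :: "'a \<times> 'b"
    unfolding power2_norm_eq_inner by (simp add: inner_diff_left inner_diff_right inner_commute)
  have val: "(Y \<bullet> a + c a + (norm Y)\<^sup>2 / 2 - (norm Y)\<^sup>2) / \<epsilon> = w a - (norm (Y - a))\<^sup>2 / (2 * \<epsilon>)" for Y a
    using \<epsilon>(1) unfolding quad c_def by (simp add: field_simps)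
  have W_ge: "w a - (norm (Y - a))\<^sup>2 / (2 * \<epsilon>) \<le> W Y" if "a \<in> A" for a Y
    unfolding val[symmetric] W_def ma.S_def using ma.upper[OF that, of Y] \<epsilon>(1) by (intro divide_right_mono) auto
  have W_att: "\<exists>a\<in>A. W Y = w a - (norm (Y - a))\<^sup>2 / (2 * \<epsilon>)" for Y
  proof -
    obtain a where "a \<in> A" "m Y = Y \<bullet> a + c a" using ma.attained by blast
    then show ?thesis unfolding val[symmetric] W_def ma.S_def by (intro bexI[of _ a]) (auto simp: algebra_simps)
  qed
  have W_near: "norm (Y - a) \<le> \<eta>" if "a \<in> A" "Y \<in> A" "W Y = w a - (norm (Y - a))\<^sup>2 / (2 * \<epsilon>)" for Y a
  proof -
    have "w Y \<le> W Y" using W_ge[OF that(2), of Y] by simp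
    then have "(norm (Y - a))\<^sup>2 / (2 * \<epsilon>) \<le> 2 * M" using that(3) M(2)[OF that(1)] M(2)[OF that(2)] by linarith
    then have "(norm (Y - a))\<^sup>2 \<le> \<eta>\<^sup>2" using \<epsilon> by (simp add: pos_divide_le_eq algebra_simps)
    then show ?thesis using \<eta>(1) by (simp add: power2_le_iff_abs_le)
  qed
  \<comment> \<open>The test function transported from \<open>W\<close> to \<open>ma.S\<close>:
    multiplied by \<epsilon> and increased by \<open>|Y|^2\<close>, up to a constant.\<close>
  define Q' where "Q' = \<epsilon> *\<^sub>R Q"
  define B' where "B' Y = 2 *\<^sub>R Y + \<epsilon> *\<^sub>R B Y" for Y
  have B': "linear B'" "\<And>x y. B' x \<bullet> y = x \<bullet> B' y"
    unfolding B'_def by (intro linear_compose_add linear_compose_scale_right B(1) linear_ident)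
      (simp add: inner_add_left inner_add_right B(2))
  have \<Psi>': "ma.S Y - (Q' \<bullet> Y + (B' Y \<bullet> Y) / 2) = \<epsilon> * (W Y - (\<Psi> Y - \<Psi> 0))" for Y
    using \<epsilon>(1) by (simp add: W_def \<Psi>_def Q'_def B'_def linear_0[OF B(1)] inner_add_left field_simps power2_norm_eq_inner)
  have "\<exists>Z q X. Z \<in> ball 0 r \<and> norm q < \<epsilon> * (\<delta> / 4) \<and> linear X \<and> (\<forall>h. X h \<bullet> h \<le> B' h \<bullet> h) \<and>
     (\<forall>\<epsilon>>0. \<exists>s>0. \<forall>h. norm h < s \<longrightarrow>
       \<bar>ma.S (Z + h) - ma.S Z - (Q' + B' Z + q) \<bullet> h - (X h \<bullet> h) / 2\<bar> \<le> \<epsilon> * (norm h)\<^sup>2)"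
  proof (rule ma.perturbed_maximum_expansion[OF B' r(1), where Ya = 0 and Yc = 0])
    show "\<epsilon> * (\<delta> / 4) > 0" using \<epsilon> \<delta> by simp
    show "0 \<in> ball (0::'a \<times> 'b) r" using r by simp
    fix Y :: "'a \<times> 'b" assume "Y \<in> sphere 0 r"
    then have nY: "norm Y = r" by simp
    have YA: "Y \<in> A" using ballA r nY R by simp
    obtain a where a: "a \<in> A" "W Y = w a - (norm (Y - a))\<^sup>2 / (2 * \<epsilon>)" using W_att by blast
    have Ya: "norm (Y - a) \<le> \<eta>" by (rule W_near[OF a(1) YA a(2)])
    have "norm a \<ge> r / 2" using Ya \<eta>(3) nY norm_triangle_ineq2[of Y a] by simp
    then have "w a + \<gamma> \<le> \<Psi> a" by (intro \<gamma>(2)[OF a(1)]) simp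
    moreover have "dist (\<Psi> a) (\<Psi> Y) < \<gamma>" by (rule \<eta>0(2)[OF YA a(1)]) (use Ya \<eta> in \<open>simp add: dist_norm norm_minus_commute\<close>)
    moreover have "W Y \<le> w a" using a(2) \<epsilon>(1) by simp
    ultimately have "W Y < \<Psi> Y" by (simp add: dist_real_def)
    moreover have "\<Psi> 0 \<le> W 0" using W_ge[OF \<open>0 \<in> A\<close>, of 0] by (simp add: \<Psi>_def w_def linear_0[OF B(1)])
    ultimately have "W Y - (\<Psi> Y - \<Psi> 0) < W 0 - (\<Psi> 0 - \<Psi> 0)" by simp
    then show "ma.S Y - (Q' \<bullet> Y + (B' Y \<bullet> Y) / 2) < ma.S 0 - (Q' \<bullet> 0 + (B' 0 \<bullet> 0) / 2)"
      unfolding \<Psi>' using \<epsilon>(1) by simp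
  qed
  then obtain Z q X where Z: "norm Z < r" and q: "norm q < \<epsilon> * (\<delta> / 4)" and X: "linear X" "\<And>h. X h \<bullet> h \<le> B' h \<bullet> h"
    and exp: "\<And>e. e > 0 \<Longrightarrow> \<exists>s>0. \<forall>h. norm h < s \<longrightarrow>
       \<bar>ma.S (Z + h) - ma.S Z - (Q' + B' Z + q) \<bullet> h - (X h \<bullet> h) / 2\<bar> \<le> e * (norm h)\<^sup>2" by auto
  have ZA: "Z \<in> A" using ballA r Z R by simp
  obtain a where a: "a \<in> A" "W Z = w a - (norm (Z - a))\<^sup>2 / (2 * \<epsilon>)" using W_att by blast
  have Za: "norm (Z - a) \<le> \<eta>" by (rule W_near[OF a(1) ZA a(2)])
  have na: "norm a < 2 * r" using norm_triangle_ineq2[of a Z] Za \<eta>(3) Z r(1) by (simp add: norm_minus_commute)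
  define P where "P = Q + B Z + q /\<^sub>R \<epsilon>"
  define X' where "X' h = (X h - 2 *\<^sub>R h) /\<^sub>R \<epsilon>" for h
  have linX': "linear X'" unfolding X'_def
    by (intro linear_compose_scale_right linear_compose_sub X(1) linear_ident)
  have X'B: "X' h \<bullet> h \<le> B h \<bullet> h" for h
    using X(2)[of h] \<epsilon>(1) by (simp add: X'_def B'_def inner_diff_left inner_add_left field_simps)
  \<comment> \<open>The translation property of sup-convolutions:
    \<open>w (a + h) - |Z - a|^2 / (2 * \<epsilon>) \<le> W (Z + h)\<close> with equality at
    \<open>h = 0\<close>, so an upper expansion of \<open>W\<close> at \<open>Z\<close> holds for
    \<open>w\<close> at \<open>a\<close> with the same slope and form.\<close>
  have jet: "\<exists>s>0. \<forall>h. norm h < s \<longrightarrow> w (a + h) \<le> w a + P \<bullet> h + (X' h \<bullet> h) / 2 + e * (norm h)\<^sup>2" if e: "e > 0" for e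
  proof -
    obtain s where s: "s > 0" "\<And>h. norm h < s \<Longrightarrow>
       \<bar>ma.S (Z + h) - ma.S Z - (Q' + B' Z + q) \<bullet> h - (X h \<bullet> h) / 2\<bar> \<le> (\<epsilon> * e) * (norm h)\<^sup>2"
      using exp[of "\<epsilon> * e"] \<epsilon>(1) e by auto
    have "w (a + h) \<le> w a + P \<bullet> h + (X' h \<bullet> h) / 2 + e * (norm h)\<^sup>2" if h: "norm h < min s (2 * r)" for h
    proof -
      have hs: "norm h < s" "norm h < 2 * r" using h by auto
      have "norm (a + h) \<le> norm a + norm h" by (rule norm_triangle_ineq)
      then have "a + h \<in> A" using na hs r by (intro ballA) linarith
      from W_ge[OF this, of "Z + h"] have "w (a + h) \<le> w a + (W (Z + h) - W Z)" using a(2) by simp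
      moreover have "W (Z + h) - W Z = (ma.S (Z + h) - ma.S Z - 2 * (Z \<bullet> h) - h \<bullet> h) / \<epsilon>"
      proof -
        have "(norm (Z + h))\<^sup>2 = (norm Z)\<^sup>2 + 2 * (Z \<bullet> h) + h \<bullet> h"
          unfolding power2_norm_eq_inner by (simp add: inner_add_left inner_add_right inner_commute)
        then show ?thesis unfolding W_def diff_divide_distrib[symmetric] by simp
      qed
      moreover have "ma.S (Z + h) - ma.S Z - 2 * (Z \<bullet> h) - h \<bullet> h \<le> \<epsilon> * (P \<bullet> h + (X' h \<bullet> h) / 2 + e * (norm h)\<^sup>2)"
      proof -
        have "\<epsilon> * (P \<bullet> h) = (Q' + B' Z + q) \<bullet> h - 2 * (Z \<bullet> h)"
          using \<epsilon>(1) by (simp add: P_def Q'_def B'_def inner_add_left algebra_simps)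
        moreover have "\<epsilon> * (X' h \<bullet> h) = X h \<bullet> h - 2 * (h \<bullet> h)"
          using \<epsilon>(1) by (simp add: X'_def inner_diff_left)
        moreover have "\<epsilon> * (P \<bullet> h + (X' h \<bullet> h) / 2 + e * (norm h)\<^sup>2) = \<epsilon> * (P \<bullet> h) + (\<epsilon> * (X' h \<bullet> h)) / 2 + (\<epsilon> * e) * (norm h)\<^sup>2"
          by (simp add: algebra_simps)
        ultimately show ?thesis using s(2)[OF hs(1)] unfolding abs_le_iff by linarith
      qed
      then have "(ma.S (Z + h) - ma.S Z - 2 * (Z \<bullet> h) - h \<bullet> h) / \<epsilon> \<le> P \<bullet> h + (X' h \<bullet> h) / 2 + e * (norm h)\<^sup>2"
        using \<epsilon>(1) by (simp add: pos_divide_le_eq mult.commute)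
      ultimately show ?thesis by linarith
    qed
    then show ?thesis using s(1) r(1) by (intro exI[of _ "min s (2 * r)"]) auto
  qed
  have split: "X (h, 0) \<bullet> (h, 0) + X (0, k) \<bullet> (0, k) \<le> X (h, k) \<bullet> (h, k)" for h k
  proof -
    have super: "ma.S (Z + (h, 0)) + ma.S (Z + (0, k)) \<le> ma.S (Z + (h, k)) + ma.S Z" for h k
    proof -
      obtain b1 b2 where b: "(b1, b2) \<in> A" "m (Z + (h, 0)) = (Z + (h, 0)) \<bullet> (b1, b2) + c (b1, b2)"
        using ma.attained[of "Z + (h, 0)"] by (metis surj_pair)
      obtain d1 d2 where d: "(d1, d2) \<in> A" "m (Z + (0, k)) = (Z + (0, k)) \<bullet> (d1, d2) + c (d1, d2)"
        using ma.attained[of "Z + (0, k)"] by (metis surj_pair)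
      have in1: "(b1, d2) \<in> A" and in2: "(d1, b2) \<in> A" using b(1) d(1) by (auto simp: A_def)
      have c_split: "c (b1, b2) + c (d1, d2) = c (b1, d2) + c (d1, b2)"
        by (simp add: c_def w_def norm_Pair algebra_simps add_divide_distrib)
      obtain z1 z2 where z: "Z = (z1, z2)" by fastforce
      have "m (Z + (h, 0)) + m (Z + (0, k)) \<le> m (Z + (h, k)) + m Z"
        using ma.upper[OF in1, of "Z + (h, k)"] ma.upper[OF in2, of Z] b(2) d(2) c_split
        by (simp add: z inner_add_left)
      then show ?thesis unfolding ma.S_def power2_norm_eq_inner z
        by (simp add: inner_add_left inner_add_right add_divide_distrib)
    qed
    define q1 where "q1 H = X (fst H, 0) \<bullet> (fst H, 0) + X (0, snd H) \<bullet> (0, snd H)" for H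
    have "q1 (h, k) \<le> X (h, k) \<bullet> (h, k)"
    proof (rule quadratic_le_of_asymptotic[of q1 "\<lambda>h. X h \<bullet> h"])
      fix t H
      have 1: "(t *\<^sub>R fst H, 0) = t *\<^sub>R (fst H, 0)" "(0, t *\<^sub>R snd H) = t *\<^sub>R (0, snd H)" for H :: "'a \<times> 'b" by auto
      show "q1 (t *\<^sub>R H) = t\<^sup>2 * q1 H" "X (t *\<^sub>R H) \<bullet> (t *\<^sub>R H) = t\<^sup>2 * (X H \<bullet> H)"
        unfolding q1_def fst_scaleR snd_scaleR 1
        by (simp_all only: linear_cmul[OF X(1)] inner_scaleR_left inner_scaleR_right power2_eq_square) (simp_all add: algebra_simps)
    next
      fix e :: real assume e: "e > 0"
      then obtain s where s: "s > 0" "\<And>h. norm h < s \<Longrightarrow>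
         \<bar>ma.S (Z + h) - ma.S Z - (Q' + B' Z + q) \<bullet> h - (X h \<bullet> h) / 2\<bar> \<le> (e / 6) * (norm h)\<^sup>2"
        using exp[of "e / 6"] by auto
      have "q1 H \<le> X H \<bullet> H + e * (norm H)\<^sup>2" if H: "norm H < s" for H
      proof -
        obtain h k where hk: "H = (h, k)" by fastforce
        have n: "norm (h, 0::'b) \<le> norm H" "norm (0::'a, k) \<le> norm H" unfolding hk by (auto simp: norm_Pair)
        then have n2: "(norm (h, 0::'b))\<^sup>2 \<le> (norm H)\<^sup>2" "(norm (0::'a, k))\<^sup>2 \<le> (norm H)\<^sup>2" by (auto intro: power_mono)
        have 1: "ma.S Z + (Q' + B' Z + q) \<bullet> (h, 0) + (X (h, 0) \<bullet> (h, 0)) / 2 - (e / 6) * (norm H)\<^sup>2 \<le> ma.S (Z + (h, 0))"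
          using s(2)[of "(h, 0)"] n(1) H mult_left_mono[OF n2(1), of "e / 6"] e unfolding abs_le_iff by linarith
        have 2: "ma.S Z + (Q' + B' Z + q) \<bullet> (0, k) + (X (0, k) \<bullet> (0, k)) / 2 - (e / 6) * (norm H)\<^sup>2 \<le> ma.S (Z + (0, k))"
          using s(2)[of "(0, k)"] n(2) H mult_left_mono[OF n2(2), of "e / 6"] e unfolding abs_le_iff by linarith
        have 3: "ma.S (Z + (h, k)) \<le> ma.S Z + (Q' + B' Z + q) \<bullet> (h, k) + (X (h, k) \<bullet> (h, k)) / 2 + (e / 6) * (norm H)\<^sup>2"
          using s(2)[of "(h, k)"] H unfolding hk abs_le_iff by linarith
        have 4: "(Q' + B' Z + q) \<bullet> (h, k) = (Q' + B' Z + q) \<bullet> (h, 0) + (Q' + B' Z + q) \<bullet> (0, k)"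
          by (simp flip: inner_add_right)
        show ?thesis unfolding q1_def using 1 2 3 4 super[of h k] by (simp add: hk)
      qed
      then show "\<exists>s>0. \<forall>h. norm h < s \<longrightarrow> q1 h \<le> X h \<bullet> h + e * (norm h)\<^sup>2" using s(1) by blast
    qed
    then show ?thesis by (simp add: q1_def)
  qed
  define X1 where "X1 h = fst (X' (h, 0))" for h
  define X2 where "X2 k = snd (X' (0, k))" for k
  have X12: "X1 h \<bullet> h = X' (h, 0) \<bullet> (h, 0)" "X2 k \<bullet> k = X' (0, k) \<bullet> (0, k)" for h k
    by (simp_all add: X1_def X2_def inner_prod_def)
  have lin12: "linear X1" "linear X2"
  proof -
    have "X' (x + y, 0) = X' (x, 0) + X' (y, 0)" "X' (r *\<^sub>R x, 0) = r *\<^sub>R X' (x, 0)" for x y r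
      using linear_add[OF linX', of "(x, 0)" "(y, 0)"] linear_cmul[OF linX', of r "(x, 0)"] by simp_all
    then show "linear X1" unfolding X1_def by (intro linearI) simp_all
    have "X' (0, x + y) = X' (0, x) + X' (0, y)" "X' (0, r *\<^sub>R x) = r *\<^sub>R X' (0, x)" for x y r
      using linear_add[OF linX', of "(0, x)" "(0, y)"] linear_cmul[OF linX', of r "(0, x)"] by simp_all
    then show "linear X2" unfolding X2_def by (intro linearI) simp_all
  qed
  have "superjet w1 (fst a) (fst P) X1" unfolding superjet_def
  proof (intro conjI lin12 allI impI)
    fix e :: real assume "e > 0"
    from jet[OF this] obtain s where s: "s > 0" "\<And>h. norm h < s \<Longrightarrow> w (a + h) \<le> w a + P \<bullet> h + (X' h \<bullet> h) / 2 + e * (norm h)\<^sup>2" by blast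
    have "w1 (fst a + h) \<le> w1 (fst a) + fst P \<bullet> h + (X1 h \<bullet> h) / 2 + e * (norm h)\<^sup>2" if "norm h < s" for h
      using s(2)[of "(h, 0)"] that by (simp add: w_def X12 inner_prod_def norm_Pair)
    then show "\<exists>s>0. \<forall>h. norm h < s \<longrightarrow> w1 (fst a + h) \<le> w1 (fst a) + fst P \<bullet> h + (X1 h \<bullet> h) / 2 + e * (norm h)\<^sup>2"
      using s(1) by blast
  qed
  moreover have "superjet w2 (snd a) (snd P) X2" unfolding superjet_def
  proof (intro conjI lin12 allI impI)
    fix e :: real assume "e > 0"
    from jet[OF this] obtain s where s: "s > 0" "\<And>h. norm h < s \<Longrightarrow> w (a + h) \<le> w a + P \<bullet> h + (X' h \<bullet> h) / 2 + e * (norm h)\<^sup>2" by blast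
    have "w2 (snd a + h) \<le> w2 (snd a) + snd P \<bullet> h + (X2 h \<bullet> h) / 2 + e * (norm h)\<^sup>2" if "norm h < s" for h
      using s(2)[of "(0, h)"] that by (simp add: w_def X12 inner_prod_def norm_Pair)
    then show "\<exists>s>0. \<forall>h. norm h < s \<longrightarrow> w2 (snd a + h) \<le> w2 (snd a) + snd P \<bullet> h + (X2 h \<bullet> h) / 2 + e * (norm h)\<^sup>2"
      using s(1) by blast
  qed
  moreover have "X1 h \<bullet> h + X2 k \<bullet> k \<le> B (h, k) \<bullet> (h, k)" for h k
  proof -
    have "X' (h, 0) \<bullet> (h, 0) + X' (0, k) \<bullet> (0, k) \<le> X' (h, k) \<bullet> (h, k)"
    proof -
      have "\<epsilon> * (X' H \<bullet> H) = X H \<bullet> H - 2 * (H \<bullet> H)" for H using \<epsilon>(1) by (simp add: X'_def inner_diff_left)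
      moreover have "(h, k) \<bullet> (h, k) = (h, 0) \<bullet> (h, 0::'b) + (0::'a, k) \<bullet> (0, k)" by simp
      ultimately have "\<epsilon> * (X' (h, 0) \<bullet> (h, 0) + X' (0, k) \<bullet> (0, k)) \<le> \<epsilon> * (X' (h, k) \<bullet> (h, k))"
        using split[of h k] by (simp only: distrib_left)
      then show ?thesis using \<epsilon>(1) by simp
    qed
    also have "\<dots> \<le> B (h, k) \<bullet> (h, k)" by (rule X'B)
    finally show ?thesis by (simp only: X12)
  qed
  moreover have "norm (fst a) < \<delta>" "norm (snd a) < \<delta>"
    using norm_fst_le[of "fst a" "snd a"] norm_snd_le[of "snd a" "fst a"] na r(3) \<delta> by auto
  moreover have "norm (P - Q) < \<delta>"
  proof -
    have "P - Q = B Z + q /\<^sub>R \<epsilon>" by (simp add: P_def)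
    then have "norm (P - Q) \<le> norm (B Z) + norm (q /\<^sub>R \<epsilon>)" by (metis norm_triangle_ineq)
    also have "norm (B Z) \<le> norm Z * K" by (rule K)
    also have "\<dots> \<le> K * r" using Z K(1) by (simp add: mult.commute)
    also have "norm (q /\<^sub>R \<epsilon>) = norm q / \<epsilon>" using \<epsilon>(1) by (simp add: divide_inverse_commute)
    also have "\<dots> \<le> \<delta> / 4" using q \<epsilon>(1) by (simp add: pos_divide_le_eq mult.commute)
    finally show ?thesis using r(4) \<delta> by simp
  qed
  then have "norm (fst P - fst Q) < \<delta>" "norm (snd P - snd Q) < \<delta>"
  proof -
    have "P - Q = (fst P - fst Q, snd P - snd Q)" by (simp add: prod_eq_iff)
    then have "norm (fst P - fst Q) \<le> norm (P - Q)" "norm (snd P - snd Q) \<le> norm (P - Q)"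
      by (simp_all add: norm_fst_le norm_snd_le)
    then show "norm (fst P - fst Q) < \<delta>" "norm (snd P - snd Q) < \<delta>" using \<open>norm (P - Q) < \<delta>\<close> by simp_all
  qed
  ultimately show ?thesis by blast
qed

lemma theorem_on_sums:
  fixes w1 :: "'a::euclidean_space \<Rightarrow> real" and w2 :: "'b::euclidean_space \<Rightarrow> real"
  assumes cont: "continuous_on (cball a R) w1" "continuous_on (cball b R) w2" and R: "R > 0"
    and B: "linear B" "\<And>x y. B x \<bullet> y = x \<bullet> B y"
    and max: "\<And>h k. norm h \<le> R \<Longrightarrow> norm k \<le> R \<Longrightarrow> (h, k) \<noteq> 0 \<Longrightarrow>
       w1 (a + h) + w2 (b + k) < w1 a + w2 b + Q \<bullet> (h, k) + (B (h, k) \<bullet> (h, k)) / 2"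
    and \<delta>: "\<delta> > 0"
  shows "\<exists>z1 z2 P1 P2 X1 X2. norm (z1 - a) < \<delta> \<and> norm (z2 - b) < \<delta> \<and>
     norm (P1 - fst Q) < \<delta> \<and> norm (P2 - snd Q) < \<delta> \<and>
     superjet w1 z1 P1 X1 \<and> superjet w2 z2 P2 X2 \<and>
     (\<forall>h k. X1 h \<bullet> h + X2 k \<bullet> k \<le> B (h, k) \<bullet> (h, k))"
proof -
  have "\<exists>z1 z2 P1 P2 X1 X2. norm z1 < \<delta> \<and> norm z2 < \<delta> \<and> norm (P1 - fst Q) < \<delta> \<and> norm (P2 - snd Q) < \<delta> \<and>
     superjet (\<lambda>h. w1 (a + h)) z1 P1 X1 \<and> superjet (\<lambda>h. w2 (b + h)) z2 P2 X2 \<and>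
     (\<forall>h k. X1 h \<bullet> h + X2 k \<bullet> k \<le> B (h, k) \<bullet> (h, k))"
  proof (rule theorem_on_sums_0[OF _ _ R B _ \<delta>])
    show "continuous_on (cball 0 R) (\<lambda>h. w1 (a + h))" "continuous_on (cball 0 R) (\<lambda>h. w2 (b + h))"
      by (auto intro!: continuous_intros continuous_on_compose2[OF cont(1)] continuous_on_compose2[OF cont(2)] simp: dist_norm)
  qed (use max in auto)
  then obtain z1 z2 P1 P2 X1 X2 where "norm z1 < \<delta>" "norm z2 < \<delta>" "norm (P1 - fst Q) < \<delta>" "norm (P2 - snd Q) < \<delta>"
     "superjet w1 (a + z1) P1 X1" "superjet w2 (b + z2) P2 X2"
     "\<forall>h k. X1 h \<bullet> h + X2 k \<bullet> k \<le> B (h, k) \<bullet> (h, k)" unfolding superjet_shift by blast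
  then show ?thesis by (intro exI[of _ "a + z1"] exI[of _ "b + z2"] exI[of _ P1] exI[of _ P2] exI[of _ X1] exI[of _ X2]) simp
qed

text \<open>Second-order Taylor expansion of the inverse of \<Phi>, where \<open>a\<close> and
  \<open>b\<close> are the first two derivatives of \<Phi> at \<open>u z\<close>. The inverse is
  never differentiated: the expected increment \<open>l + \<rho>\<close> is inserted into the
  expansion of \<Phi>, and strict monotonicity compares the arguments.\<close>

lemma superjet_inverse_image:
  fixes u :: "'a::euclidean_space \<Rightarrow> real" and \<Phi> :: "real \<Rightarrow> real"
  assumes jet: "superjet (\<lambda>y. \<Phi> (u y)) z P X"
    and mono: "strict_mono \<Phi>" and a: "a > 0"
    and \<Phi>: "\<And>\<eta>. \<eta> > 0 \<Longrightarrow> \<exists>s>0. \<forall>d. \<bar>d\<bar> < s \<longrightarrow> \<bar>\<Phi> (u z + d) - \<Phi> (u z) - a * d - b * d\<^sup>2 / 2\<bar> \<le> \<eta> * d\<^sup>2"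
  shows "superjet u z (P /\<^sub>R a) (\<lambda>h. X h /\<^sub>R a - (b / a ^ 3 * (P \<bullet> h)) *\<^sub>R P)"
  unfolding superjet_def
proof (intro conjI allI impI)
  have lin: "linear X" using jet by (simp add: superjet_def)
  show "linear (\<lambda>h. X h /\<^sub>R a - (b / a ^ 3 * (P \<bullet> h)) *\<^sub>R P)"
    by (intro linearI) (simp_all add: linear_add[OF lin] linear_cmul[OF lin] inner_add_right algebra_simps add_divide_distrib)
  obtain \<kappa> where \<kappa>: "\<kappa> > 0" "\<And>x. norm (X x) \<le> norm x * \<kappa>"
    using bounded_linear.pos_bounded[OF linear_conv_bounded_linear[THEN iffD1, OF lin]] by blast
  fix \<epsilon> :: real assume \<epsilon>: "\<epsilon> > 0"
  define L where "L = norm P / a"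
  define R where "R = \<kappa> / (2 * a) + \<bar>b\<bar> / (2 * a ^ 3) * (norm P)\<^sup>2 + \<epsilon>"
  have L0: "L \<ge> 0" and R0: "R > 0" using a \<epsilon> \<kappa> by (auto simp: L_def R_def intro!: add_nonneg_pos add_nonneg_nonneg)
  \<comment> \<open>The slack \<open>\<epsilon> * |h|^2\<close> in the claim becomes
    \<open>a * \<epsilon> * |h|^2\<close> under \<Phi>. Half of it pays for the error of the jet, a
    quarter for the Taylor remainder of \<Phi>, and a quarter for replacing
    \<open>(l + \<rho>)\<^sup>2\<close> by \<open>l\<^sup>2\<close>.\<close>
  define \<eta> where "\<eta> = a * \<epsilon> / (4 * (L + R)\<^sup>2)"
  have LR: "(L + R)\<^sup>2 > 0" using L0 R0 by simp
  have \<eta>: "\<eta> > 0" using a \<epsilon> LR by (simp add: \<eta>_def)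
  obtain s1 where s1: "s1 > 0" "\<And>d. \<bar>d\<bar> < s1 \<Longrightarrow> \<bar>\<Phi> (u z + d) - \<Phi> (u z) - a * d - b * d\<^sup>2 / 2\<bar> \<le> \<eta> * d\<^sup>2"
    using \<Phi>[OF \<eta>] by blast
  have "a * \<epsilon> / 2 > 0" using a \<epsilon> by simp
  then obtain s2 where s2: "s2 > 0" "\<And>h. norm h < s2 \<Longrightarrow>
      \<Phi> (u (z + h)) \<le> \<Phi> (u z) + P \<bullet> h + (X h \<bullet> h) / 2 + a * \<epsilon> / 2 * (norm h)\<^sup>2"
    using jet unfolding superjet_def by blast
  define C where "C = \<bar>b\<bar> / 2 * (R * (2 * L + R))"
  have C0: "C \<ge> 0" using L0 R0 by (simp add: C_def)
  define s where "s = min (min s2 1) (min (s1 / (L + R)) (a * \<epsilon> / (4 * (C + 1))))"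
  have s: "s > 0" using s1 s2 a \<epsilon> C0 L0 R0 by (simp add: s_def)
  have "u (z + h) \<le> u z + (P /\<^sub>R a) \<bullet> h + ((X h /\<^sub>R a - (b / a ^ 3 * (P \<bullet> h)) *\<^sub>R P) \<bullet> h) / 2 + \<epsilon> * (norm h)\<^sup>2"
    if h: "norm h < s" for h
  proof -
    define l where "l = (P \<bullet> h) / a"
    define \<rho> where "\<rho> = (X h \<bullet> h) / (2 * a) - b / (2 * a ^ 3) * (P \<bullet> h)\<^sup>2 + \<epsilon> * (norm h)\<^sup>2"
    define n where "n = norm h"
    have n: "0 \<le> n" "n < s2" "n < 1" "n < s1 / (L + R)" "n < a * \<epsilon> / (4 * (C + 1))" using h by (auto simp: s_def n_def)
    have n21: "n\<^sup>2 \<le> n" using n by (simp add: power2_eq_square mult_left_le)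
    have eq: "(P /\<^sub>R a) \<bullet> h + ((X h /\<^sub>R a - (b / a ^ 3 * (P \<bullet> h)) *\<^sub>R P) \<bullet> h) / 2 + \<epsilon> * (norm h)\<^sup>2 = l + \<rho>"
      using a by (simp add: l_def \<rho>_def inner_diff_left field_simps power2_eq_square)
    have l: "\<bar>l\<bar> \<le> L * n"
      using Cauchy_Schwarz_ineq2[of P h] a by (simp add: l_def L_def n_def abs_div_pos[symmetric] divide_right_mono)
    have \<rho>: "\<bar>\<rho>\<bar> \<le> R * n\<^sup>2"
    proof -
      have "\<bar>X h \<bullet> h\<bar> \<le> norm (X h) * norm h" by (rule Cauchy_Schwarz_ineq2)
      also have "\<dots> \<le> (norm h * \<kappa>) * norm h" by (intro mult_right_mono \<kappa>) auto
      finally have 1: "\<bar>(X h \<bullet> h) / (2 * a)\<bar> \<le> \<kappa> / (2 * a) * n\<^sup>2"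
        using a by (simp add: abs_div_pos[symmetric] n_def power2_eq_square divide_right_mono algebra_simps)
      have "(P \<bullet> h)\<^sup>2 \<le> (norm P * norm h)\<^sup>2" using Cauchy_Schwarz_ineq2[of P h] by (metis abs_le_square_iff abs_mult abs_norm_cancel)
      then have "\<bar>b\<bar> / (2 * a ^ 3) * (P \<bullet> h)\<^sup>2 \<le> \<bar>b\<bar> / (2 * a ^ 3) * ((norm P)\<^sup>2 * n\<^sup>2)"
        using a by (intro mult_left_mono) (auto simp: power_mult_distrib n_def)
      then have 2: "\<bar>b / (2 * a ^ 3) * (P \<bullet> h)\<^sup>2\<bar> \<le> \<bar>b\<bar> / (2 * a ^ 3) * (norm P)\<^sup>2 * n\<^sup>2"
        using a by (simp add: abs_mult)
      have 3: "\<bar>\<epsilon> * (norm h)\<^sup>2\<bar> = \<epsilon> * n\<^sup>2" using \<epsilon> by (simp add: n_def)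
      have "\<bar>\<rho>\<bar> \<le> \<kappa> / (2 * a) * n\<^sup>2 + \<bar>b\<bar> / (2 * a ^ 3) * (norm P)\<^sup>2 * n\<^sup>2 + \<epsilon> * n\<^sup>2"
        unfolding \<rho>_def using 1 2 3 by linarith
      then show ?thesis by (simp add: R_def algebra_simps)
    qed
    have \<theta>: "\<bar>l + \<rho>\<bar> \<le> (L + R) * n"
    proof -
      have "R * n\<^sup>2 \<le> R * n" using n21 R0 by simp
      then show ?thesis using l \<rho> by (simp add: algebra_simps)
    qed
    also have "\<dots> < s1" using n(4) L0 R0 by (simp add: pos_less_divide_eq mult.commute)
    finally have "\<bar>\<Phi> (u z + (l + \<rho>)) - \<Phi> (u z) - a * (l + \<rho>) - b * (l + \<rho>)\<^sup>2 / 2\<bar> \<le> \<eta> * (l + \<rho>)\<^sup>2" by (rule s1(2))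
    from abs_le_D2[OF this]
    have "\<Phi> (u z) + a * (l + \<rho>) + b * (l + \<rho>)\<^sup>2 / 2 - \<eta> * (l + \<rho>)\<^sup>2 \<le> \<Phi> (u z + (l + \<rho>))" by linarith
    moreover have "\<eta> * (l + \<rho>)\<^sup>2 \<le> a * \<epsilon> / 4 * n\<^sup>2"
    proof -
      have "(l + \<rho>)\<^sup>2 \<le> ((L + R) * n)\<^sup>2" using \<theta> by (metis abs_ge_zero abs_le_square_iff abs_of_nonneg order_trans)
      then have "\<eta> * (l + \<rho>)\<^sup>2 \<le> \<eta> * ((L + R)\<^sup>2 * n\<^sup>2)" using \<eta> by (simp add: power_mult_distrib)
      also have "\<dots> = a * \<epsilon> / 4 * n\<^sup>2" using LR by (simp add: \<eta>_def)
      finally show ?thesis .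
    qed
    moreover have "b * l\<^sup>2 / 2 - a * \<epsilon> / 4 * n\<^sup>2 \<le> b * (l + \<rho>)\<^sup>2 / 2"
    proof -
      have e: "b * (l + \<rho>)\<^sup>2 / 2 - b * l\<^sup>2 / 2 = b / 2 * (\<rho> * (2 * l + \<rho>))"
        by (simp add: power2_eq_square field_simps)
      have "\<bar>b * (l + \<rho>)\<^sup>2 / 2 - b * l\<^sup>2 / 2\<bar> = \<bar>b\<bar> / 2 * (\<bar>\<rho>\<bar> * \<bar>2 * l + \<rho>\<bar>)"
        unfolding e by (simp add: abs_mult)
      also have "\<dots> \<le> \<bar>b\<bar> / 2 * ((R * n\<^sup>2) * ((2 * L + R) * n))"
      proof (intro mult_left_mono mult_mono \<rho>)
        have "R * n\<^sup>2 \<le> R * n" using n21 R0 by simp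
        then show "\<bar>2 * l + \<rho>\<bar> \<le> (2 * L + R) * n" using l \<rho> by (simp add: algebra_simps)
      qed (use R0 in auto)
      also have "\<dots> = (C * n) * n\<^sup>2" by (simp add: C_def algebra_simps)
      also have "\<dots> \<le> (a * \<epsilon> / 4) * n\<^sup>2"
      proof (intro mult_right_mono)
        have "C * n \<le> (C + 1) * n" using n(1) by (simp add: algebra_simps)
        also have "\<dots> \<le> a * \<epsilon> / 4" using n(5) C0 by (simp add: pos_less_divide_eq algebra_simps)
        finally show "C * n \<le> a * \<epsilon> / 4" .
      qed simp
      finally show ?thesis unfolding abs_le_iff by linarith
    qed
    moreover have "a * (l + \<rho>) + b * l\<^sup>2 / 2 = P \<bullet> h + (X h \<bullet> h) / 2 + a * \<epsilon> * n\<^sup>2"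
      using a by (simp add: l_def \<rho>_def n_def field_simps power2_eq_square power3_eq_cube)
    moreover have "\<Phi> (u (z + h)) \<le> \<Phi> (u z) + P \<bullet> h + (X h \<bullet> h) / 2 + a * \<epsilon> / 2 * n\<^sup>2"
      using s2(2)[of h] n(2) by (simp add: n_def)
    moreover have "a * \<epsilon> / 4 * n\<^sup>2 = a * \<epsilon> * n\<^sup>2 / 4" "a * \<epsilon> / 2 * n\<^sup>2 = a * \<epsilon> * n\<^sup>2 / 2" by simp_all
    ultimately have "\<Phi> (u (z + h)) \<le> \<Phi> (u z + (l + \<rho>))" by linarith
    then have "u (z + h) \<le> u z + (l + \<rho>)" using mono strict_mono_less_eq by blast
    then show ?thesis using eq by linarith
  qed
  then show "\<exists>s>0. \<forall>h. norm h < s \<longrightarrow> u (z + h) \<le> u z + (P /\<^sub>R a) \<bullet> h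
     + ((X h /\<^sub>R a - (b / a ^ 3 * (P \<bullet> h)) *\<^sub>R P) \<bullet> h) / 2 + \<epsilon> * (norm h)\<^sup>2" using s by blast
qed

section \<open>Viscosity solutions and superjets\<close>

definition quad_poly :: "'a::real_inner \<Rightarrow> 'a \<Rightarrow> ('a \<Rightarrow> 'a) \<Rightarrow> 'a \<Rightarrow> real" where
  "quad_poly z P S y = P \<bullet> (y - z) + (S (y - z) \<bullet> (y - z)) / 2"

lemma has_derivative_quad_poly:
  fixes S :: "'a::euclidean_space \<Rightarrow> 'a"
  assumes S: "linear S" "\<And>x y. S x \<bullet> y = x \<bullet> S y"
  shows "(quad_poly z P S has_derivative (\<lambda>h. (P + S (y - z)) \<bullet> h)) (at y)"
proof -
  have bl: "bounded_linear S" using S(1) linear_conv_bounded_linear by blast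
  have 1: "((\<lambda>y. y - z) has_derivative (\<lambda>h. h)) (at y)" by (auto intro!: derivative_eq_intros)
  have 2: "((\<lambda>y. S (y - z)) has_derivative S) (at y)" using bounded_linear.has_derivative[OF bl 1] .
  have "(quad_poly z P S has_derivative (\<lambda>h. P \<bullet> h + (S (y - z) \<bullet> h + S h \<bullet> (y - z)) / 2)) (at y)"
    unfolding quad_poly_def
    by (rule has_derivative_add[OF bounded_linear.has_derivative[OF bounded_linear_inner_right 1]
          bounded_linear.has_derivative[OF bounded_linear_divide has_derivative_inner[OF 2 1]]])
  moreover have "P \<bullet> h + (S (y - z) \<bullet> h + S h \<bullet> (y - z)) / 2 = (P + S (y - z)) \<bullet> h" for h
    by (simp add: inner_add_left S(2)[of h] inner_commute[of h])
  ultimately show ?thesis by simp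
qed

lemma C2_on_quad_poly:
  fixes S :: "'a::euclidean_space \<Rightarrow> 'a"
  assumes S: "linear S" "\<And>x y. S x \<bullet> y = x \<bullet> S y"
  shows "C2_on U (quad_poly z P S)"
proof -
  have bl: "bounded_linear S" using S(1) linear_conv_bounded_linear by blast
  have bl2: "bounded_linear (\<lambda>h. blinfun_inner_right (S h))"
    by (rule bounded_linear_compose[OF bounded_linear_blinfun_inner_right bl])
  show ?thesis unfolding C2_on_def
  proof (intro exI conjI ballI)
    fix y
    show "(quad_poly z P S has_derivative blinfun_apply (blinfun_inner_right (P + S (y - z)))) (at y)"
      using has_derivative_quad_poly[OF S, of z P y] by (simp add: blinfun_inner_right.rep_eq)
    have "((\<lambda>y. blinfun_inner_right (P + S (y - z))) has_derivative (\<lambda>h. blinfun_inner_right (S h))) (at y)"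
      by (rule bounded_linear.has_derivative[OF bounded_linear_blinfun_inner_right])
        (auto intro!: derivative_eq_intros bounded_linear.has_derivative[OF bl])
    then show "((\<lambda>y. blinfun_inner_right (P + S (y - z))) has_derivative
        blinfun_apply (Blinfun (\<lambda>h. blinfun_inner_right (S h)))) (at y)"
      by (simp add: bounded_linear_Blinfun_apply[OF bl2])
  qed (rule continuous_on_const)
qed

lemma dir_deriv_quad_poly:
  fixes S :: "'a::euclidean_space \<Rightarrow> 'a"
  assumes S: "linear S" "\<And>x y. S x \<bullet> y = x \<bullet> S y"
  shows "dir_deriv v (quad_poly z P S) y = (P + S (y - z)) \<bullet> v"
proof -
  have "((\<lambda>h. quad_poly z P S (y + h *\<^sub>R v)) has_derivative (\<lambda>h. (P + S (y + 0 *\<^sub>R v - z)) \<bullet> (h *\<^sub>R v))) (at 0)"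
    by (rule has_derivative_compose[of "\<lambda>h. y + h *\<^sub>R v" "\<lambda>h. h *\<^sub>R v", OF _ has_derivative_quad_poly[OF S]])
      (auto intro!: derivative_eq_intros)
  then have "((\<lambda>h. quad_poly z P S (y + h *\<^sub>R v)) has_field_derivative ((P + S (y - z)) \<bullet> v)) (at 0)"
    unfolding has_field_derivative_def inner_scaleR_right mult_commute_abs by simp
  then show ?thesis unfolding dir_deriv_def by (rule DERIV_imp_deriv)
qed

lemma dir_deriv_affine:
  fixes S :: "'a::euclidean_space \<Rightarrow> 'a"
  assumes S: "linear S"
  shows "dir_deriv w (\<lambda>y. (P + S (y - z)) \<bullet> v) y = S w \<bullet> v"
proof -
  have "(\<lambda>h. (P + S (y + h *\<^sub>R w - z)) \<bullet> v) = (\<lambda>h. (P + S (y - z)) \<bullet> v + h * (S w \<bullet> v))"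
    by (simp add: linear_diff[OF S] linear_add[OF S] linear_cmul[OF S] inner_add_left inner_diff_left algebra_simps)
  moreover have "((\<lambda>h. (P + S (y - z)) \<bullet> v + h * (S w \<bullet> v)) has_field_derivative (S w \<bullet> v)) (at 0)"
    by (auto intro!: derivative_eq_intros)
  ultimately show ?thesis unfolding dir_deriv_def by (simp add: DERIV_imp_deriv)
qed

text \<open>The trace of \<open>I + (p-2) q q^T/|q|^2\<close> times the spatial block of a
  space-time Hessian \<open>X\<close>; time entries of \<open>X\<close> do not contribute.\<close>

definition diffusion :: "real \<Rightarrow> real ^ 'n \<Rightarrow> ((real ^ 'n) \<times> real \<Rightarrow> (real ^ 'n) \<times> real) \<Rightarrow> real" where
  "diffusion p q X = (\<Sum>i\<in>UNIV. X (axis i 1, 0) \<bullet> (axis i 1, 0)) + (p - 2) * (X (q, 0) \<bullet> (q, 0)) / (norm q)\<^sup>2"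

lemma Pair_axis_expansion: "(q :: real ^ 'n, 0::real) = (\<Sum>i\<in>UNIV. q $ i *\<^sub>R (axis i 1, 0))"
proof -
  have "fst (\<Sum>i\<in>UNIV. q $ i *\<^sub>R (axis i 1 :: real ^ 'n, 0::real)) = q"
    by (simp add: fst_sum basis_expansion scalar_mult_eq_scaleR[symmetric])
  moreover have "snd (\<Sum>i\<in>UNIV. q $ i *\<^sub>R (axis i 1 :: real ^ 'n, 0::real)) = 0" by (simp add: snd_sum)
  ultimately show ?thesis by (metis prod.collapse)
qed

lemma second_order_op_quad_poly:
  fixes S :: "(real ^ 'n) \<times> real \<Rightarrow> (real ^ 'n) \<times> real"
  assumes S: "linear S" "\<And>x y. S x \<bullet> y = x \<bullet> S y"
  shows "second_order_op p (\<lambda>i j. q $ i * q $ j / (norm q)\<^sup>2) (quad_poly z P S) y = diffusion p q S"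
proof -
  have px: "partial_x i (quad_poly z P S) = (\<lambda>y. (P + S (y - z)) \<bullet> (axis i 1, 0))" for i
    by (rule ext) (simp add: partial_x_def dir_deriv_quad_poly[OF S])
  have pxx: "partial_x j (partial_x i (quad_poly z P S)) y = S (axis j 1, 0) \<bullet> (axis i 1, 0)" for i j
    unfolding px by (simp only: partial_x_def dir_deriv_affine[OF S(1)])
  have "(\<Sum>i\<in>UNIV. \<Sum>j\<in>UNIV. (if i = j then 1 else 0) * (S (axis j 1, 0) \<bullet> (axis i (1::real), 0))) =
     (\<Sum>i\<in>UNIV. S (axis i 1, 0) \<bullet> (axis i 1, 0))"
    by (intro sum.cong refl) (simp add: if_distrib[of "\<lambda>x. x * _"] sum.delta cong: if_cong)
  moreover have "S (q, 0) \<bullet> (q, 0) = (\<Sum>i\<in>UNIV. \<Sum>j\<in>UNIV. q $ i * q $ j * (S (axis j 1, 0) \<bullet> (axis i 1, 0)))"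
  proof -
    have "S (q, 0) \<bullet> (q, 0) = (\<Sum>i\<in>UNIV. q $ i * (S (q, 0) \<bullet> (axis i 1, 0)))"
      by (subst (2) Pair_axis_expansion) (simp only: inner_sum_right inner_scaleR_right)
    also have "\<dots> = (\<Sum>i\<in>UNIV. q $ i * (\<Sum>j\<in>UNIV. q $ j * (S (axis j 1, 0) \<bullet> (axis i 1, 0))))"
      by (subst (1) Pair_axis_expansion) (simp only: linear_sum[OF S(1)] linear_cmul[OF S(1)] inner_sum_left inner_scaleR_left)
    finally show ?thesis by (simp add: sum_distrib_left mult.assoc)
  qed
  ultimately show ?thesis
    unfolding second_order_op_def pxx diffusion_def
    by (simp add: distrib_right sum.distrib sum_distrib_left sum_divide_distrib mult.assoc)
qed

lemma quad_poly_partials: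
  fixes S :: "(real ^ 'n) \<times> real \<Rightarrow> (real ^ 'n) \<times> real"
  assumes S: "linear S" "\<And>x y. S x \<bullet> y = x \<bullet> S y"
  shows "grad_x (quad_poly z P S) z = fst P" "partial_t (quad_poly z P S) z = snd P"
    "partial_x i (quad_poly z P S) z = fst P $ i"
proof -
  have 1: "partial_x i (quad_poly z P S) z = fst P $ i" for i
    by (simp add: partial_x_def dir_deriv_quad_poly[OF S] linear_0[OF S(1)] inner_prod_def inner_axis)
  show "partial_x i (quad_poly z P S) z = fst P $ i" by (rule 1)
  show "grad_x (quad_poly z P S) z = fst P" by (simp add: grad_x_def 1)
  show "partial_t (quad_poly z P S) z = snd P"
    by (simp add: partial_t_def dir_deriv_quad_poly[OF S] linear_0[OF S(1)] inner_prod_def)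
qed

text \<open>A superjet gives an inequality with an error term, whereas a test function must touch
  from above. Adding \<open>2 * e\<close> times the identity to the symmetrised form absorbs the
  error; the diffusion then changes by \<open>2 * e\<close> times the trace
  \<open>CARD('n) + p - 2\<close> of its matrix.\<close>

lemma superjet_quad_poly:
  fixes u :: "(real ^ 'n) \<times> real \<Rightarrow> real"
  assumes jet: "superjet u z P X" and e: "e > 0"
  shows "\<exists>S. linear S \<and> (\<forall>x y. S x \<bullet> y = x \<bullet> S y) \<and>
     (\<forall>\<^sub>F y in nhds z. u y - quad_poly z P S y \<le> u z - quad_poly z P S z) \<and>
     (q \<noteq> 0 \<longrightarrow> diffusion p q S = diffusion p q X + 2 * e * (real CARD('n) + (p - 2)))"
proof -
  have X: "linear X" using jet by (simp add: superjet_def)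
  define S where "S h = (1/2) *\<^sub>R (X h + adjoint X h) + (2 * e) *\<^sub>R h" for h
  have S: "linear S" unfolding S_def
    by (intro linear_compose_add linear_compose_scale_right X adjoint_linear linear_ident)
  have ad: "x \<bullet> adjoint X y = X x \<bullet> y" for x y using adjoint_works[OF X] by blast
  have ad': "adjoint X y \<bullet> x = y \<bullet> X x" for x y using ad[of x y] by (simp add: inner_commute)
  have sym: "S x \<bullet> y = x \<bullet> S y" for x y
    by (simp add: S_def inner_add_left inner_add_right ad ad' algebra_simps)
  have Sh: "S h \<bullet> h = X h \<bullet> h + 2 * e * (h \<bullet> h)" for h
    by (simp add: S_def inner_add_left ad' inner_commute[of h "X h"])
  obtain s where s: "s > 0" "\<And>h. norm h < s \<Longrightarrow> u (z + h) \<le> u z + P \<bullet> h + (X h \<bullet> h) / 2 + e * (norm h)\<^sup>2"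
    using jet e unfolding superjet_def by blast
  have "u y - quad_poly z P S y \<le> u z - quad_poly z P S z" if "dist y z < s" for y
    using s(2)[of "y - z"] that
    by (simp add: quad_poly_def Sh linear_0[OF S] dist_norm power2_norm_eq_inner add_divide_distrib)
  then have "\<forall>\<^sub>F y in nhds z. u y - quad_poly z P S y \<le> u z - quad_poly z P S z"
    unfolding eventually_nhds_metric using s(1) by blast
  moreover have "diffusion p q S = diffusion p q X + 2 * e * (real CARD('n) + (p - 2))" if "q \<noteq> 0"
  proof -
    have "(p - 2) * (S (q, 0) \<bullet> (q, 0)) / (norm q)\<^sup>2 = (p - 2) * (X (q, 0) \<bullet> (q, 0)) / (norm q)\<^sup>2 + 2 * e * (p - 2)"
      using that by (simp add: Sh power2_norm_eq_inner field_simps)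
    moreover have "(\<Sum>i\<in>UNIV. S (axis i 1 :: real ^ 'n, 0) \<bullet> (axis i 1, 0)) =
        (\<Sum>i\<in>UNIV. X (axis i 1 :: real ^ 'n, 0) \<bullet> (axis i 1, 0)) + 2 * e * real CARD('n)"
      by (simp add: Sh sum.distrib inner_axis_axis)
    ultimately show ?thesis by (simp add: diffusion_def algebra_simps)
  qed
  ultimately show ?thesis using S sym by blast
qed

text \<open>The equation is tested with the paraboloids of \<open>superjet_quad_poly\<close>;
  dividing by \<open>c\<close> makes the trace error at most the arbitrary \<open>e\<close>.\<close>

lemma subsolution_superjet:
  fixes u :: "(real ^ 'n) \<times> real \<Rightarrow> real"
  assumes sub: "viscosity_subsolution p f T u" and z: "z \<in> UNIV \<times> open_times T"
    and jet: "superjet u z P X" and P: "fst P \<noteq> 0"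
  shows "snd P + pow_2mp p (norm (fst P)) * f (u z) \<le> diffusion p (fst P) X"
proof (rule field_le_epsilon)
  fix e :: real assume e: "e > 0"
  define c where "c = 2 * \<bar>real CARD('n) + (p - 2)\<bar> + 1"
  have c: "c > 0" by (simp add: c_def add_nonneg_pos)
  obtain S where S: "linear S" "\<And>x y. S x \<bullet> y = x \<bullet> S y"
     "\<forall>\<^sub>F y in nhds z. u y - quad_poly z P S y \<le> u z - quad_poly z P S z"
     "diffusion p (fst P) S = diffusion p (fst P) X + 2 * (e / c) * (real CARD('n) + (p - 2))"
    using superjet_quad_poly[OF jet, of "e / c" "fst P" p] P e c by auto
  have "snd P + pow_2mp p (norm (fst P)) * f (u z) \<le> diffusion p (fst P) S"
    using sub[unfolded viscosity_subsolution_def, THEN conjunct2, THEN conjunct2, THEN spec,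
        of "quad_poly z P S", THEN bspec, OF z, THEN mp,
        OF conjI[OF C2_on_quad_poly[OF S(1,2)] S(3)], THEN conjunct1] P
    by (simp add: quad_poly_partials[OF S(1,2)] second_order_op_quad_poly[OF S(1,2)])
  also have "\<dots> \<le> diffusion p (fst P) X + e"
  proof -
    have "(2 * (real CARD('n) + (p - 2))) * e \<le> c * e"
      using e abs_ge_self[of "real CARD('n) + (p - 2)"] by (intro mult_right_mono) (simp_all add: c_def)
    then have "2 * (e / c) * (real CARD('n) + (p - 2)) \<le> e" using c by (simp add: pos_divide_le_eq algebra_simps)
    then show ?thesis unfolding S(4) by simp
  qed
  finally show "snd P + pow_2mp p (norm (fst P)) * f (u z) \<le> diffusion p (fst P) X + e" .
qed

text \<open>A superjet of \<open>- u\<close> is the negative of a subjet of \<open>u\<close>. The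
  diffusion is odd in the Hessian and even in the slope, and the time slope is odd, while the term
  with \<open>f\<close> is even; hence the minus in front of it.\<close>

lemma supersolution_superjet_minus:
  fixes u :: "(real ^ 'n) \<times> real \<Rightarrow> real"
  assumes sup: "viscosity_supersolution p f T u" and z: "z \<in> UNIV \<times> open_times T"
    and jet: "superjet (\<lambda>y. - u y) z P X" and P: "fst P \<noteq> 0"
  shows "snd P - pow_2mp p (norm (fst P)) * f (u z) \<le> diffusion p (fst P) X"
proof (rule field_le_epsilon)
  fix e :: real assume e: "e > 0"
  define c where "c = 2 * \<bar>real CARD('n) + (p - 2)\<bar> + 1"
  have c: "c > 0" by (simp add: c_def add_nonneg_pos)
  obtain S where S: "linear S" "\<And>x y. S x \<bullet> y = x \<bullet> S y"
     "\<forall>\<^sub>F y in nhds z. - u y - quad_poly z P S y \<le> - u z - quad_poly z P S z"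
     "diffusion p (fst P) S = diffusion p (fst P) X + 2 * (e / c) * (real CARD('n) + (p - 2))"
    using superjet_quad_poly[OF jet, of "e / c" "fst P" p] P e c by auto
  define S' where "S' h = - S h" for h
  have S': "linear S'" "\<And>x y. S' x \<bullet> y = x \<bullet> S' y"
    unfolding S'_def using linear_compose_neg[OF S(1)] S(2) by auto
  have neg: "quad_poly z (- P) S' y = - quad_poly z P S y" for y by (simp add: quad_poly_def S'_def)
  have "\<forall>\<^sub>F y in nhds z. u y - quad_poly z (- P) S' y \<ge> u z - quad_poly z (- P) S' z"
    using S(3) unfolding neg by (rule eventually_mono) simp
  then have "snd (- P) + pow_2mp p (norm (fst (- P))) * f (u z) \<ge> diffusion p (fst (- P)) S'"
    using sup[unfolded viscosity_supersolution_def, THEN conjunct2, THEN conjunct2, THEN spec,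
        of "quad_poly z (- P) S'", THEN bspec, OF z, THEN mp,
        OF conjI[OF C2_on_quad_poly[OF S']], THEN conjunct1] P
    by (simp add: quad_poly_partials[OF S'] second_order_op_quad_poly[OF S', where q = "- fst P", simplified])
  moreover have "diffusion p (fst (- P)) S' = - diffusion p (fst P) S"
  proof -
    have "(- fst P, 0) = - (fst P, 0::real)" by simp
    then have "S' (- fst P, 0) \<bullet> (- fst P, 0) = - (S (fst P, 0) \<bullet> (fst P, 0))"
      by (simp only: S'_def linear_neg[OF S(1)] inner_minus_left inner_minus_right minus_minus)
    then show ?thesis by (simp add: diffusion_def S'_def sum_negf)
  qed
  ultimately have "snd P - pow_2mp p (norm (fst P)) * f (u z) \<le> diffusion p (fst P) S" by simp
  also have "\<dots> \<le> diffusion p (fst P) X + e"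
  proof -
    have "(2 * (real CARD('n) + (p - 2))) * e \<le> c * e"
      using e abs_ge_self[of "real CARD('n) + (p - 2)"] by (intro mult_right_mono) (simp_all add: c_def)
    then have "2 * (e / c) * (real CARD('n) + (p - 2)) \<le> e" using c by (simp add: pos_divide_le_eq algebra_simps)
    then show ?thesis unfolding S(4) by simp
  qed
  finally show "snd P - pow_2mp p (norm (fst P)) * f (u z) \<le> diffusion p (fst P) X + e" .
qed

section \<open>The equation for the transformed unknown\<close>

text \<open>The diffusion matrix depends only on the direction of the slope, which is an eigenvector
  with eigenvalue \<open>p - 1\<close>. The rank-one term created by the change of unknown therefore
  contributes \<open>p - 1\<close> times its spatial trace.\<close>

lemma diffusion_rank_one:
  fixes X :: "(real ^ 'n) \<times> real \<Rightarrow> (real ^ 'n) \<times> real"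
  assumes g: "g > 0" and X: "linear X" and q: "fst P \<noteq> 0"
  shows "diffusion p (fst (g *\<^sub>R P)) (\<lambda>h. g *\<^sub>R X h + (b * (P \<bullet> h)) *\<^sub>R P) =
     g * diffusion p (fst P) X + b * ((p - 1) * (norm (fst P))\<^sup>2)"
proof -
  define q where "q = fst P"
  have q0: "(norm q)\<^sup>2 > 0" using q by (simp add: q_def)
  have "(\<Sum>i\<in>UNIV. (P \<bullet> (axis i 1, 0)) * (P \<bullet> (axis i 1, 0))) = (norm q)\<^sup>2"
    by (simp add: inner_prod_def inner_axis q_def norm_vec_def L2_set_def power2_eq_square sum_nonneg)
  then have 1: "(\<Sum>i\<in>UNIV. (g *\<^sub>R X (axis i 1, 0) + (b * (P \<bullet> (axis i 1, 0))) *\<^sub>R P) \<bullet> (axis i 1, 0)) =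
     g * (\<Sum>i\<in>UNIV. X (axis i 1, 0) \<bullet> (axis i 1, 0)) + b * (norm q)\<^sup>2"
    by (simp add: inner_add_left sum.distrib sum_distrib_left mult.assoc flip: sum_distrib_left)
  have "(g *\<^sub>R q, 0::real) = g *\<^sub>R (q, 0)" by simp
  then have "(g *\<^sub>R X (g *\<^sub>R q, 0) + (b * (P \<bullet> (g *\<^sub>R q, 0))) *\<^sub>R P) \<bullet> (g *\<^sub>R q, 0) =
      g\<^sup>2 * (g * (X (q, 0) \<bullet> (q, 0)) + b * (P \<bullet> (q, 0)) * (P \<bullet> (q, 0)))"
    by (simp only: linear_cmul[OF X] inner_scaleR_left inner_scaleR_right inner_add_left) (simp add: power2_eq_square algebra_simps)
  moreover have "P \<bullet> (q, 0) = (norm q)\<^sup>2" by (simp add: inner_prod_def q_def power2_norm_eq_inner)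
  ultimately have 2: "(g *\<^sub>R X (g *\<^sub>R q, 0) + (b * (P \<bullet> (g *\<^sub>R q, 0))) *\<^sub>R P) \<bullet> (g *\<^sub>R q, 0) / (norm (g *\<^sub>R q))\<^sup>2 =
     g * (X (q, 0) \<bullet> (q, 0)) / (norm q)\<^sup>2 + b * (norm q)\<^sup>2"
    using g q0 by (simp add: power_mult_distrib field_simps)
  have "diffusion p (g *\<^sub>R q) (\<lambda>h. g *\<^sub>R X h + (b * (P \<bullet> h)) *\<^sub>R P) =
     g * (\<Sum>i\<in>UNIV. X (axis i 1, 0) \<bullet> (axis i 1, 0)) + b * (norm q)\<^sup>2 +
     (p - 2) * (g * (X (q, 0) \<bullet> (q, 0)) / (norm q)\<^sup>2 + b * (norm q)\<^sup>2)"
    unfolding diffusion_def 1 times_divide_eq_right[symmetric] 2 ..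
  also have "\<dots> = g * diffusion p q X + b * ((p - 1) * (norm q)\<^sup>2)"
    by (simp add: diffusion_def algebra_simps)
  finally show ?thesis by (simp add: q_def)
qed

lemma pow_2mp_mult: "a > 0 \<Longrightarrow> b > 0 \<Longrightarrow> pow_2mp p (a * b) = pow_2mp p a * pow_2mp p b"
  by (simp add: pow_2mp_def powr_mult)

text \<open>\<open>R\<close> is the first-order term \<open>h (|Dv|\<^sup>2 - |Dv|\<^sup>2\<^sup>-\<^sup>p)\<close> of the equation for \<open>v = \<Phi>(u)\<close>, with
  \<open>h = F' G\<^sup>1\<^sup>-\<^sup>p\<close> for \<open>G = 1/\<Phi>'\<close>.\<close>

lemma transformed_solution_superjets:
  fixes u :: "(real ^ 'n) \<times> real \<Rightarrow> real" and F f \<Phi> :: "real \<Rightarrow> real"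
  assumes p: "1 < p" "p \<le> 2"
    and F0: "\<And>s. F s > 0" and F: "\<And>s. (F has_field_derivative f s) (at s)"
    and \<Phi>: "\<And>s. (\<Phi> has_field_derivative (p / (p - 1) * F s) powr (- (1 / p))) (at s)"
    and z: "z \<in> UNIV \<times> open_times T" and P: "fst P \<noteq> 0"
  defines "R \<equiv> (p / (p - 1) * F (u z)) powr (1 / p - 1) * f (u z) * ((norm (fst P))\<^sup>2 - pow_2mp p (norm (fst P)))"
  shows "viscosity_subsolution p f T u \<Longrightarrow> superjet (\<lambda>y. \<Phi> (u y)) z P X \<Longrightarrow> snd P \<le> diffusion p (fst P) X + R"
    and "viscosity_supersolution p f T u \<Longrightarrow> superjet (\<lambda>y. - \<Phi> (u y)) z P X \<Longrightarrow> snd P \<le> diffusion p (fst P) X - R"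
proof -
  define c where "c = p / (p - 1)"
  have c: "c > 0" "c * (p - 1) = p" using p by (auto simp: c_def)
  define E where "E = c * F (u z)"
  have E: "E > 0" using c(1) F0 by (simp add: E_def)
  define a where "a = E powr (- (1 / p))"
  define G where "G = E powr (1 / p)"
  \<comment> \<open>\<open>k\<close> is \<open>G\<close> to the power \<open>1 - p\<close>, and
    \<open>b\<close> below is the second derivative of \<Phi> at \<open>u z\<close>.\<close>
  define k where "k = E powr (1 / p - 1)"
  define b where "b = - (1 / p) * E powr (- (1 / p) - 1) * (c * f (u z))"
  have a: "a > 0" using E by (simp add: a_def)
  have G: "G > 0" using E by (simp add: G_def)
  have Ga: "inverse a = G" by (simp add: a_def G_def powr_minus)
  have Gk: "pow_2mp p G = G * k"
  proof (cases "p = 2")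
    case True
    have "E powr (1 / p) * E powr (1 / p - 1) = E powr 0" using True by (simp flip: powr_add)
    then show ?thesis using True E by (simp add: pow_2mp_def G_def k_def)
  next
    case False
    have "1 / p * (2 - p) = 1 / p + (1 / p - 1)" using p by (simp add: field_simps)
    then show ?thesis using False by (simp add: pow_2mp_def G_def k_def powr_powr flip: powr_add)
  qed
  \<comment> \<open>Here the constant \<open>p / (p - 1)\<close> matters: the coefficient of the
    squared slope, which comes from the second derivative of \<Phi>, coincides with the coefficient
    \<open>G * k * f (u z)\<close> that \<open>Gk\<close> gives for the power
    \<open>2 - p\<close>.\<close>
  have ba: "- (b / a ^ 3) * (p - 1) = G * k * f (u z)"
  proof -
    have "b / a ^ 3 = b * G ^ 3" using a by (simp add: Ga[symmetric] divide_inverse power_inverse)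
    also have "G ^ 3 = E powr (3 / p)" using E by (simp add: G_def powr_power)
    also have "b * E powr (3 / p) = - (1 / p) * (c * f (u z)) * (E powr (- (1 / p) - 1) * E powr (3 / p))" by (simp add: b_def)
    also have "E powr (- (1 / p) - 1) * E powr (3 / p) = E powr (1 / p) * E powr (1 / p - 1)"
      using p by (simp add: field_simps flip: powr_add)
    finally have "- (b / a ^ 3) * (p - 1) = (c * (p - 1)) / p * (G * k * f (u z))" by (simp add: G_def k_def)
    then show ?thesis using c(2) p by simp
  qed
  have der1: "(\<Phi> has_derivative (\<lambda>d. (c * F y) powr (- (1 / p)) \<bullet> d)) (at y)" for y
    using \<Phi>[of y] by (simp add: has_field_derivative_def c_def)
  have der2: "((\<lambda>y. (c * F y) powr (- (1 / p))) has_derivative (\<lambda>d. b * d)) (at (u z))"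
  proof -
    have "((\<lambda>y. c * F y) has_field_derivative c * f (u z)) (at (u z))" using F by (intro DERIV_cmult)
    from DERIV_chain2[OF has_real_derivative_powr[OF E[unfolded E_def], of "- (1 / p)"] this]
    show ?thesis unfolding has_field_derivative_def b_def E_def .
  qed
  have exp: "\<exists>s>0. \<forall>d. \<bar>d\<bar> < s \<longrightarrow> \<bar>\<Phi> (u z + d) - \<Phi> (u z) - a * d - b * d\<^sup>2 / 2\<bar> \<le> \<eta> * d\<^sup>2" if "\<eta> > 0" for \<eta>
    using second_order_expansion[OF zero_less_one der1 der2 that]
    by (simp add: a_def E_def power2_eq_square mult.assoc)
  have mono: "strict_mono \<Phi>"
  proof (rule strict_monoI)
    fix x y :: real assume "x < y"
    then show "\<Phi> x < \<Phi> y"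
    proof (rule DERIV_pos_imp_increasing)
      fix s
      have "(p / (p - 1) * F s) powr (- (1 / p)) > 0" using F0[of s] p by simp
      then show "\<exists>y. (\<Phi> has_field_derivative y) (at s) \<and> 0 < y" using \<Phi> by blast
    qed
  qed
  define Y where "Y h = G *\<^sub>R X h + (- (b / a ^ 3) * (P \<bullet> h)) *\<^sub>R P" for h
  define Y' where "Y' h = G *\<^sub>R X h + (b / a ^ 3 * (P \<bullet> h)) *\<^sub>R P" for h
  have R: "R = k * f (u z) * ((norm (fst P))\<^sup>2 - pow_2mp p (norm (fst P)))"
    by (simp add: R_def k_def E_def c_def)
  have pow: "pow_2mp p (norm (fst (G *\<^sub>R P))) = G * k * pow_2mp p (norm (fst P))"
    using G P pow_2mp_mult[of G "norm (fst P)" p] by (simp add: Gk)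
  have GP: "fst (G *\<^sub>R P) \<noteq> 0" using G P by simp
  {
    assume sub: "viscosity_subsolution p f T u" and jet: "superjet (\<lambda>y. \<Phi> (u y)) z P X"
    have X: "linear X" using jet by (simp add: superjet_def)
    have "superjet u z (P /\<^sub>R a) (\<lambda>h. X h /\<^sub>R a - (b / a ^ 3 * (P \<bullet> h)) *\<^sub>R P)"
      by (rule superjet_inverse_image[OF jet mono a exp])
    then have "superjet u z (G *\<^sub>R P) Y" by (simp add: Ga Y_def[abs_def])
    from subsolution_superjet[OF sub z this GP]
    have "G * snd P + G * k * pow_2mp p (norm (fst P)) * f (u z) \<le> diffusion p (fst (G *\<^sub>R P)) Y"
      unfolding pow by simp
    also have "\<dots> = G * diffusion p (fst P) X + (- (b / a ^ 3)) * ((p - 1) * (norm (fst P))\<^sup>2)"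
      unfolding Y_def[abs_def] by (rule diffusion_rank_one[OF G X P])
    also have "\<dots> = G * diffusion p (fst P) X + G * k * f (u z) * (norm (fst P))\<^sup>2"
      unfolding mult.assoc[symmetric] ba ..
    finally have "G * snd P \<le> G * (diffusion p (fst P) X + R)" by (simp add: R algebra_simps)
    then show "snd P \<le> diffusion p (fst P) X + R" using G by simp
  next
    assume sup: "viscosity_supersolution p f T u" and jet: "superjet (\<lambda>y. - \<Phi> (u y)) z P X"
    have X: "linear X" using jet by (simp add: superjet_def)
    \<comment> \<open>Reflection writes \<open>- \<Phi> (u y)\<close> as an increasing function of
      \<open>- u y\<close>; the first derivative stays \<open>a\<close>, the second becomes
      \<open>- b\<close>.\<close>
    define \<Phi>' where "\<Phi>' s = - \<Phi> (- s)" for s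
    have mono': "strict_mono \<Phi>'" using mono by (auto simp: \<Phi>'_def strict_mono_def)
    have exp': "\<exists>s>0. \<forall>d. \<bar>d\<bar> < s \<longrightarrow> \<bar>\<Phi>' (- u z + d) - \<Phi>' (- u z) - a * d - (- b) * d\<^sup>2 / 2\<bar> \<le> \<eta> * d\<^sup>2"
      if \<eta>: "\<eta> > 0" for \<eta>
    proof -
      obtain s where s: "s > 0" "\<And>d. \<bar>d\<bar> < s \<Longrightarrow> \<bar>\<Phi> (u z + d) - \<Phi> (u z) - a * d - b * d\<^sup>2 / 2\<bar> \<le> \<eta> * d\<^sup>2"
        using exp[OF \<eta>] by blast
      have "\<bar>\<Phi>' (- u z + d) - \<Phi>' (- u z) - a * d - (- b) * d\<^sup>2 / 2\<bar> \<le> \<eta> * d\<^sup>2" if d: "\<bar>d\<bar> < s" for d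
      proof -
        have "\<bar>\<Phi> (u z + (- d)) - \<Phi> (u z) - a * (- d) - b * (- d)\<^sup>2 / 2\<bar> \<le> \<eta> * (- d)\<^sup>2" by (rule s(2)) (use d in simp)
        moreover have "\<Phi>' (- u z + d) - \<Phi>' (- u z) - a * d - (- b) * d\<^sup>2 / 2 =
            - (\<Phi> (u z + (- d)) - \<Phi> (u z) - a * (- d) - b * (- d)\<^sup>2 / 2)" by (simp add: \<Phi>'_def)
        ultimately show ?thesis by (simp only: abs_minus_cancel power2_minus)
      qed
      then show ?thesis using s(1) by blast
    qed
    have jet': "superjet (\<lambda>y. \<Phi>' (- u y)) z P X" using jet by (simp add: \<Phi>'_def)
    have "superjet (\<lambda>y. - u y) z (P /\<^sub>R a) (\<lambda>h. X h /\<^sub>R a - (- b / a ^ 3 * (P \<bullet> h)) *\<^sub>R P)"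
      by (rule superjet_inverse_image[OF jet' mono' a exp'])
    then have "superjet (\<lambda>y. - u y) z (G *\<^sub>R P) Y'" by (simp add: Ga Y'_def[abs_def])
    from supersolution_superjet_minus[OF sup z this GP]
    have "G * snd P - G * k * pow_2mp p (norm (fst P)) * f (u z) \<le> diffusion p (fst (G *\<^sub>R P)) Y'"
      unfolding pow by simp
    also have "\<dots> = G * diffusion p (fst P) X + (b / a ^ 3) * ((p - 1) * (norm (fst P))\<^sup>2)"
      unfolding Y'_def[abs_def] by (rule diffusion_rank_one[OF G X P])
    also have "\<dots> = G * diffusion p (fst P) X - G * k * f (u z) * (norm (fst P))\<^sup>2"
      unfolding ba[symmetric] by simp
    finally have "G * snd P \<le> G * (diffusion p (fst P) X - R)" by (simp add: R algebra_simps)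
    then show "snd P \<le> diffusion p (fst P) X - R" using G by simp
  }
qed

section \<open>Square root of the diffusion matrix\<close>

text \<open>The square root of the matrix \<open>\<delta>\<^sub>i\<^sub>j + (p-2) q\<^sub>i q\<^sub>j/|q|\<^sup>2\<close>.\<close>

definition diffusion_root :: "real \<Rightarrow> real ^ 'n \<Rightarrow> real ^ 'n \<Rightarrow> real ^ 'n" where
  "diffusion_root p q \<xi> = \<xi> + ((sqrt (p - 1) - 1) * (sgn q \<bullet> \<xi>)) *\<^sub>R sgn q"

text \<open>The columns of the root turn the trace into a sum of values of the quadratic form of
  \<open>X\<close>, so a matrix inequality on pairs of vectors can be inserted column by column even
  when two different slopes are involved.\<close>

lemma diffusion_eq_root:
  fixes X :: "(real ^ 'n) \<times> real \<Rightarrow> (real ^ 'n) \<times> real"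
  assumes p: "1 < p" and X: "linear X" and q: "q \<noteq> 0"
  shows "diffusion p q X = (\<Sum>i\<in>UNIV. X (diffusion_root p q (axis i 1), 0) \<bullet> (diffusion_root p q (axis i 1), 0))"
proof -
  define s where "s = sgn q"
  define c where "c = sqrt (p - 1) - 1"
  define \<beta> where "\<beta> \<xi> \<eta> = X (\<xi>, 0) \<bullet> (\<eta>, 0::real)" for \<xi> \<eta>
  \<comment> \<open>Equivalent to \<open>(1 + c)\<^sup>2 = p - 1\<close>, the eigenvalue in the
    direction \<open>s\<close>.\<close>
  have c: "2 * c + c\<^sup>2 = p - 2" using p by (simp add: c_def power2_diff)
  have add: "\<beta> (x + y) w = \<beta> x w + \<beta> y w" "\<beta> w (x + y) = \<beta> w x + \<beta> w y" for x y w
  proof -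
    have "(x + y, 0::real) = (x, 0) + (y, 0)" by simp
    then show "\<beta> (x + y) w = \<beta> x w + \<beta> y w" "\<beta> w (x + y) = \<beta> w x + \<beta> w y"
      unfolding \<beta>_def by (simp_all only: linear_add[OF X] inner_add_left inner_add_right)
  qed
  have scale: "\<beta> (r *\<^sub>R x) w = r * \<beta> x w" "\<beta> w (r *\<^sub>R x) = r * \<beta> w x" for r x w
  proof -
    have "(r *\<^sub>R x, 0::real) = r *\<^sub>R (x, 0)" by simp
    then show "\<beta> (r *\<^sub>R x) w = r * \<beta> x w" "\<beta> w (r *\<^sub>R x) = r * \<beta> w x"
      unfolding \<beta>_def by (simp_all only: linear_cmul[OF X] inner_scaleR_left inner_scaleR_right)
  qed
  have sum1: "(\<Sum>i\<in>UNIV. s $ i * \<beta> s (axis i 1)) = \<beta> s s"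
    unfolding \<beta>_def by (subst (3) Pair_axis_expansion) (simp only: inner_sum_right inner_scaleR_right)
  have sum2: "(\<Sum>i\<in>UNIV. s $ i * \<beta> (axis i 1) s) = \<beta> s s"
    unfolding \<beta>_def by (subst (3) Pair_axis_expansion) (simp only: linear_sum[OF X] linear_cmul[OF X] inner_sum_left inner_scaleR_left)
  have sum3: "(\<Sum>i\<in>UNIV. s $ i * s $ i) = 1"
  proof -
    have "s \<bullet> s = 1" using q by (simp add: s_def norm_sgn flip: power2_norm_eq_inner)
    then show ?thesis by (simp add: inner_vec_def)
  qed
  have "q = norm q *\<^sub>R s" using q by (simp add: s_def sgn_div_norm)
  then have "\<beta> q q = (norm q)\<^sup>2 * \<beta> s s" by (metis scale mult.assoc power2_eq_square)
  then have \<beta>q: "\<beta> q q / (norm q)\<^sup>2 = \<beta> s s" using q by simp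
  have "(\<Sum>i\<in>UNIV. \<beta> (axis i 1 + (c * s $ i) *\<^sub>R s) (axis i 1 + (c * s $ i) *\<^sub>R s)) =
    (\<Sum>i\<in>UNIV. \<beta> (axis i 1) (axis i 1) + c * (s $ i * \<beta> s (axis i 1)) + c * (s $ i * \<beta> (axis i 1) s)
       + c\<^sup>2 * \<beta> s s * (s $ i * s $ i))"
    by (intro sum.cong refl) (simp add: add scale power2_eq_square algebra_simps)
  also have "\<dots> = (\<Sum>i\<in>UNIV. \<beta> (axis i 1) (axis i 1)) + c * \<beta> s s + c * \<beta> s s + c\<^sup>2 * \<beta> s s"
    by (simp only: sum.distrib sum_distrib_left[symmetric] sum1 sum2 sum3 mult_1_right)
  also have "\<dots> = (\<Sum>i\<in>UNIV. \<beta> (axis i 1) (axis i 1)) + (2 * c + c\<^sup>2) * \<beta> s s" by (simp add: algebra_simps)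
  also have "\<dots> = diffusion p q X"
    unfolding c diffusion_def \<beta>_def[symmetric] times_divide_eq_right[symmetric] \<beta>q ..
  finally show ?thesis by (simp add: diffusion_root_def s_def c_def \<beta>_def inner_axis)
qed

text \<open>The diffusion matrix has the eigenvalue \<open>p - 1\<close> along \<open>q\<close> and
  acts as the identity across it; both values are at most 1 because
  \<open>p \<le> 2\<close>.\<close>

lemma norm_diffusion_root_axis:
  assumes p: "1 < p" "p \<le> 2" and q: "q \<noteq> 0"
  shows "(norm (diffusion_root p q (axis i 1)))\<^sup>2 \<le> 1"
proof -
  define s where "s = sgn q"
  define c where "c = sqrt (p - 1) - 1"
  define t where "t = s \<bullet> axis i 1"
  have c: "2 * c + c\<^sup>2 = p - 2" using p by (simp add: c_def power2_diff)
  have ss: "s \<bullet> s = 1" using q by (simp add: s_def norm_sgn flip: power2_norm_eq_inner)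
  have "(norm (diffusion_root p q (axis i 1)))\<^sup>2 = (axis i 1 + (c * t) *\<^sub>R s) \<bullet> (axis i 1 + (c * t) *\<^sub>R s)"
    by (simp add: diffusion_root_def s_def c_def t_def power2_norm_eq_inner)
  also have "\<dots> = 1 + 2 * (c * t) * t + (c * t) * (c * t)"
    by (simp only: inner_add_left inner_add_right inner_scaleR_left inner_scaleR_right inner_commute[of "axis i 1" s] t_def[symmetric] ss)
      (simp add: inner_axis_axis algebra_simps)
  also have "\<dots> = 1 + (2 * c + c\<^sup>2) * t\<^sup>2" by (simp add: power2_eq_square algebra_simps)
  also have "\<dots> \<le> 1" unfolding c using p by (simp add: mult_nonpos_nonneg)
  finally show ?thesis .
qed

text \<open>The root is even in the slope, so it can be compared through the sum of the directions:
  in the application the slopes belong to \<open>v\<close> and \<open>- v\<close> and are nearly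
  opposite.\<close>

lemma norm_diffusion_root_diff:
  assumes p: "1 < p" "p \<le> 2" and q: "q1 \<noteq> 0" "q2 \<noteq> 0"
  shows "norm (diffusion_root p q1 (axis i 1) - diffusion_root p q2 (axis i 1)) \<le> 2 * norm (sgn q1 + sgn q2)"
proof -
  define e :: "real ^ 'a" where "e = axis i 1"
  define s1 where "s1 = sgn q1"
  define s2 where "s2 = sgn q2"
  define c where "c = sqrt (p - 1) - 1"
  have ne: "norm e = 1" by (simp add: e_def)
  have n12: "norm s1 = 1" "norm s2 = 1" using q by (auto simp: s1_def s2_def norm_sgn)
  have c: "\<bar>c\<bar> \<le> 1" using p by (auto simp: c_def abs_le_iff real_le_lsqrt)
  have t1: "\<bar>s1 \<bullet> e\<bar> \<le> 1" using Cauchy_Schwarz_ineq2[of s1 e] ne n12 by simp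
  have t2: "\<bar>(s1 + s2) \<bullet> e\<bar> \<le> norm (s1 + s2)" using Cauchy_Schwarz_ineq2[of "s1 + s2" e] ne by simp
  have "diffusion_root p q1 e - diffusion_root p q2 e = c *\<^sub>R ((s1 \<bullet> e) *\<^sub>R (s1 + s2) - ((s1 + s2) \<bullet> e) *\<^sub>R s2)"
    by (simp add: diffusion_root_def c_def s1_def s2_def inner_add_left algebra_simps)
  then have "norm (diffusion_root p q1 e - diffusion_root p q2 e) =
     \<bar>c\<bar> * norm ((s1 \<bullet> e) *\<^sub>R (s1 + s2) - ((s1 + s2) \<bullet> e) *\<^sub>R s2)" by simp
  also have "\<dots> \<le> 1 * norm ((s1 \<bullet> e) *\<^sub>R (s1 + s2) - ((s1 + s2) \<bullet> e) *\<^sub>R s2)" using c by (intro mult_right_mono) auto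
  also have "\<dots> \<le> norm ((s1 \<bullet> e) *\<^sub>R (s1 + s2)) + norm (((s1 + s2) \<bullet> e) *\<^sub>R s2)"
    unfolding mult_1 by (rule norm_triangle_ineq4)
  also have "\<dots> = \<bar>s1 \<bullet> e\<bar> * norm (s1 + s2) + \<bar>(s1 + s2) \<bullet> e\<bar>" by (simp add: n12)
  also have "\<dots> \<le> 1 * norm (s1 + s2) + norm (s1 + s2)" using t1 t2 by (intro add_mono mult_right_mono) auto
  finally show ?thesis by (simp add: e_def s1_def s2_def)
qed

text \<open>With corresponding columns of the two roots inserted, the singular term
  \<open>|\<xi> - \<eta>|^2 / \<rho>\<close> sees only the difference of the roots, hence the square
  of the direction error.\<close>

lemma diffusion_sum_bound:
  fixes X1 X2 :: "(real ^ 'n) \<times> real \<Rightarrow> (real ^ 'n) \<times> real"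
  assumes p: "1 < p" "p \<le> 2" and X: "linear X1" "linear X2" and q: "q1 \<noteq> 0" "q2 \<noteq> 0"
    and \<rho>: "\<rho> > 0" and K: "K \<ge> 0"
    and le: "\<And>\<xi> \<eta>. X1 (\<xi>, 0) \<bullet> (\<xi>, 0) + X2 (\<eta>, 0) \<bullet> (\<eta>, 0) \<le> (norm (\<xi> - \<eta>))\<^sup>2 / \<rho> + K * ((norm \<xi>)\<^sup>2 + (norm \<eta>)\<^sup>2)"
  shows "diffusion p q1 X1 + diffusion p q2 X2 \<le> real CARD('n) * (4 * (norm (sgn q1 + sgn q2))\<^sup>2 / \<rho> + 2 * K)"
proof -
  have "diffusion p q1 X1 + diffusion p q2 X2 =
    (\<Sum>i\<in>UNIV. X1 (diffusion_root p q1 (axis i 1), 0) \<bullet> (diffusion_root p q1 (axis i 1), 0) +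
       X2 (diffusion_root p q2 (axis i 1), 0) \<bullet> (diffusion_root p q2 (axis i 1), 0))"
    unfolding diffusion_eq_root[OF p(1) X(1) q(1)] diffusion_eq_root[OF p(1) X(2) q(2)] sum.distrib ..
  also have "\<dots> \<le> (\<Sum>i\<in>(UNIV::'n set). 4 * (norm (sgn q1 + sgn q2))\<^sup>2 / \<rho> + 2 * K)"
  proof (rule sum_mono)
    fix i
    let ?a = "diffusion_root p q1 (axis i 1)" and ?b = "diffusion_root p q2 (axis i 1)"
    have "X1 (?a, 0) \<bullet> (?a, 0) + X2 (?b, 0) \<bullet> (?b, 0) \<le> (norm (?a - ?b))\<^sup>2 / \<rho> + K * ((norm ?a)\<^sup>2 + (norm ?b)\<^sup>2)" by (rule le)
    also have "\<dots> \<le> (2 * norm (sgn q1 + sgn q2))\<^sup>2 / \<rho> + K * (1 + 1)"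
      using norm_diffusion_root_diff[OF p q] norm_diffusion_root_axis[OF p q(1)] norm_diffusion_root_axis[OF p q(2)] \<rho> K
      by (intro add_mono divide_right_mono power_mono mult_left_mono) auto
    finally show "X1 (?a, 0) \<bullet> (?a, 0) + X2 (?b, 0) \<bullet> (?b, 0) \<le> 4 * (norm (sgn q1 + sgn q2))\<^sup>2 / \<rho> + 2 * K"
      by (simp add: power_mult_distrib)
  qed
  finally show ?thesis by simp
qed

section \<open>Doubling of variables\<close>

lemma norm_fst_snd_le: "norm (fst z) \<le> norm z" "norm (snd z) \<le> norm z"
  by (cases z, simp add: norm_fst_le norm_snd_le)+

text \<open>As \<open>0 \<le> 2 - p < 1\<close>, the power lies between 1 and
  \<open>r\<close>.\<close>

lemma pow_2mp_near_1:
  assumes p: "1 < p" "p \<le> 2" and r: "r > 0"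
  shows "\<bar>pow_2mp p r - 1\<bar> \<le> \<bar>r - 1\<bar>"
proof (cases "p = 2")
  case False
  have e: "0 \<le> 2 - p" "2 - p \<le> 1" using p by auto
  show ?thesis
  proof (cases "r \<ge> 1")
    case True
    have "1 \<le> r powr (2 - p)" using True e ge_one_powr_ge_zero by blast
    moreover have "r powr (2 - p) \<le> r powr 1" using True e by (intro powr_mono) auto
    ultimately show ?thesis using True False by (simp add: pow_2mp_def)
  next
    case le: False
    have "r powr (2 - p) \<le> 1 powr (2 - p)" using le r e by (intro powr_mono2) auto
    moreover have "r powr 1 \<le> r powr (2 - p)" using le r e by (intro powr_mono') auto
    ultimately show ?thesis using le r False by (simp add: pow_2mp_def)
  qed
qed (simp add: pow_2mp_def)

text \<open>The powers \<open>|q|^2\<close> and \<open>|q|^(2-p)\<close> agree for unit vectors, so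
  their difference is at most linear in the distance to \<open>e\<close>; \<open>d \<le> 1/2\<close>
  keeps \<open>q\<close> away from 0.\<close>

lemma slope_error_bound:
  assumes p: "1 < p" "p \<le> 2" and e: "norm e = 1" and q: "norm (q - e) \<le> d" and d: "d \<le> 1/2"
  shows "q \<noteq> 0" "norm (sgn q - e) \<le> 2 * d" "\<bar>(norm q)\<^sup>2 - pow_2mp p (norm q)\<bar> \<le> 4 * d"
proof -
  have n: "\<bar>norm q - 1\<bar> \<le> d" using norm_triangle_ineq3[of q e] e q by linarith
  show q0: "q \<noteq> 0" using n d by auto
  have "sgn q - q = (1 - norm q) *\<^sub>R sgn q" using q0 by (simp add: sgn_div_norm algebra_simps)
  then have "norm (sgn q - q) = \<bar>1 - norm q\<bar>" using q0 by (simp add: norm_sgn)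
  then show "norm (sgn q - e) \<le> 2 * d"
    using norm_triangle_ineq[of "sgn q - q" "q - e"] n q by simp
  have "(norm q)\<^sup>2 - 1 = (norm q - 1) * (norm q + 1)" by (simp add: power2_eq_square algebra_simps)
  then have "\<bar>(norm q)\<^sup>2 - 1\<bar> = \<bar>norm q - 1\<bar> * (norm q + 1)" by (simp add: abs_mult)
  also have "\<dots> \<le> d * 3" using n d by (intro mult_mono) auto
  finally show "\<bar>(norm q)\<^sup>2 - pow_2mp p (norm q)\<bar> \<le> 4 * d"
    using pow_2mp_near_1[OF p, of "norm q"] q0 n by simp
qed

text \<open>The doubling of variables: at a maximum of
  \<open>v(x,t) - v(y,s) - |x - y| - \<sigma>/(T\<^sub>1 - t) - \<kappa> |x|\<^sup>2 - (t - s)\<^sup>2/(2\<mu>)\<close>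
  both slopes are close to the unit vector \<open>(x - y)/|x - y|\<close>, so the first-order term of the
  equation is negligible, and \<open>|x - y| \<le> (|x - y|\<^sup>2 + \<rho>\<^sup>2)/(2\<rho>)\<close> makes the test function quadratic.\<close>

lemma spatial_contraction:
  fixes u :: "(real ^ 'n) \<times> real \<Rightarrow> real" and F f \<Phi> :: "real \<Rightarrow> real"
  defines "v \<equiv> \<lambda>z. \<Phi> (u z)"
  assumes p: "1 < p" "p \<le> 2"
    and F0: "\<And>s. F s > 0" and F: "\<And>s. (F has_field_derivative f s) (at s)"
    and \<Phi>: "\<And>s. (\<Phi> has_field_derivative (p / (p - 1) * F s) powr (- (1 / p))) (at s)"
    and sol: "viscosity_solution p f T u"
    and t: "0 \<le> t0" "t0 \<le> t1" "t1 < T2" "ereal T2 < T"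
    and cont: "continuous_on (UNIV \<times> {t0..T2}) v"
    and bound: "\<And>x t. t0 \<le> t \<Longrightarrow> t \<le> T2 \<Longrightarrow> \<bar>v (x, t)\<bar> \<le> M"
    and lip: "\<And>x y t. t0 \<le> t \<Longrightarrow> t \<le> T2 \<Longrightarrow> \<bar>v (x, t) - v (y, t)\<bar> \<le> L * norm (x - y)"
    and coeff: "\<And>x t. t0 \<le> t \<Longrightarrow> t \<le> T2 \<Longrightarrow> \<bar>(p / (p - 1) * F (u (x, t))) powr (1 / p - 1) * f (u (x, t))\<bar> \<le> H"
    and initial: "\<And>x y. v (x, t0) - v (y, t0) \<le> norm (x - y)"
  shows "v (x1, t1) - v (y1, t1) \<le> norm (x1 - y1)"
proof (rule ccontr)
  assume not: "\<not> v (x1, t1) - v (y1, t1) \<le> norm (x1 - y1)"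
  \<comment> \<open>The gap is split in three: one \<open>m\<close> for the time penalty, one for
    the spatial penalty, and one that survives as the value of \<Omega>.\<close>
  define m where "m = (v (x1, t1) - v (y1, t1) - norm (x1 - y1)) / 3"
  have m: "m > 0" "v (x1, t1) - v (y1, t1) - norm (x1 - y1) = 3 * m" using not by (auto simp: m_def)
  have "t1 \<noteq> t0" using not initial by auto
  then have t01: "t0 < t1" using t by simp
  have M0: "M \<ge> 0" using bound[of t0 0] t by (smt (verit) abs_ge_zero)
  have H0: "H \<ge> 0" using coeff[of t0 0] t by (smt (verit) abs_ge_zero)
  \<comment> \<open>The time penalty blows up at \<open>T1 < T2\<close>, which leaves room for the
    second time \<open>s\<close> beyond \<open>T1\<close>.\<close>
  define T1 where "T1 = (t1 + T2) / 2"
  have T1: "t1 < T1" "T1 < T2" using t by (auto simp: T1_def)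
  define \<sigma> where "\<sigma> = m * (T1 - t1)"
  have \<sigma>: "\<sigma> > 0" using m T1 by (simp add: \<sigma>_def)
  define Lp where "Lp = max L 1"
  have Lp: "Lp > 0" "\<And>x y t. t0 \<le> t \<Longrightarrow> t \<le> T2 \<Longrightarrow> \<bar>v (x, t) - v (y, t)\<bar> \<le> Lp * norm (x - y)"
  proof -
    show "Lp > 0" by (simp add: Lp_def)
    fix x y t assume "t0 \<le> t" "t \<le> T2"
    then have "\<bar>v (x, t) - v (y, t)\<bar> \<le> L * norm (x - y)" by (rule lip)
    also have "\<dots> \<le> Lp * norm (x - y)" by (intro mult_right_mono) (auto simp: Lp_def)
    finally show "\<bar>v (x, t) - v (y, t)\<bar> \<le> Lp * norm (x - y)" .
  qed
  \<comment> \<open>A lower bound for \<open>|x - y|\<close> at the maximum: the Lipschitz estimate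
    turns the surviving gap \<open>3 * m / 4\<close> into a distance. It does not depend on
    \<kappa>.\<close>
  define r0 where "r0 = 3 * m / (4 * Lp)"
  have r0: "r0 > 0" using m Lp by (simp add: r0_def)
  \<comment> \<open>\<open>D1\<close> bounds the slope errors: \<kappa> from the theorem on sums,
    and \<open>2 * \<kappa> * |x|\<close> where \<open>\<kappa> * |x|^2 \<le> 2 * M\<close> at the
    maximum. \<open>Err\<close> collects the diffusion terms, the two first-order terms and the
    inaccuracy of the time slopes.\<close>
  define D1 where "D1 \<kappa> = \<kappa> + 2 * sqrt (2 * M * \<kappa>)" for \<kappa> :: real
  define Err where "Err \<kappa> = real CARD('n) * (4 * (4 * D1 \<kappa>)\<^sup>2 / r0 + 8 * \<kappa>) + 8 * H * D1 \<kappa> + 2 * \<kappa>" for \<kappa> :: real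
  have limD1: "(D1 \<longlongrightarrow> 0) (at_right 0)" unfolding D1_def by (auto intro!: tendsto_eq_intros)
  have limErr: "(Err \<longlongrightarrow> 0) (at_right 0)" unfolding Err_def using r0 by (auto intro!: tendsto_eq_intros limD1)
  have limx: "((\<lambda>\<kappa>. \<kappa> * (norm x1)\<^sup>2) \<longlongrightarrow> 0) (at_right 0)" by (auto intro!: tendsto_eq_intros)
  have \<sigma>T: "\<sigma> / (T1 - t0)\<^sup>2 > 0" using \<sigma> T1 t01 by simp
  have "\<forall>\<^sub>F \<kappa> in at_right 0. D1 \<kappa> < 1/2 \<and> Err \<kappa> < \<sigma> / (T1 - t0)\<^sup>2 \<and> \<kappa> * (norm x1)\<^sup>2 < m \<and> \<kappa> > 0"
    using order_tendstoD(2)[OF limD1, of "1/2"] order_tendstoD(2)[OF limErr \<sigma>T] order_tendstoD(2)[OF limx m(1)]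
    by (intro eventually_conj) (auto simp: eventually_at_right_less)
  then have "\<exists>\<kappa>. D1 \<kappa> < 1/2 \<and> Err \<kappa> < \<sigma> / (T1 - t0)\<^sup>2 \<and> \<kappa> * (norm x1)\<^sup>2 < m \<and> \<kappa> > 0"
    by (rule eventually_happens'[OF trivial_limit_at_right_real])
  then obtain \<kappa> where \<kappa>: "D1 \<kappa> < 1/2" "Err \<kappa> < \<sigma> / (T1 - t0)\<^sup>2" "\<kappa> * (norm x1)\<^sup>2 < m" "\<kappa> > 0" by (elim exE conjE)
  \<comment> \<open>Positive values of \<Omega> force \<open>\<kappa> * |x|^2\<close> and
    \<open>|x - y|\<close> to be at most \<open>2 * M\<close>, whence the two radii; \<theta> below
    does the same for the distance of \<open>t\<close> from \<open>T1\<close>.\<close>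
  define R where "R = sqrt ((2 * M + 1) / \<kappa>)"
  define R' where "R' = R + 2 * M + 1"
  have R0: "R \<ge> 0" using M0 \<kappa>(4) by (simp add: R_def)
  have R2: "\<kappa> * R\<^sup>2 = 2 * M + 1" using M0 \<kappa>(4) by (simp add: R_def)
  define \<theta> where "\<theta> = \<sigma> / (2 * M + 1)"
  have \<theta>: "\<theta> > 0" using \<sigma> M0 by (simp add: \<theta>_def)
  have "compact (cball (0::real^'n) R' \<times> {t0..T2})" by (intro compact_Times) auto
  then have "uniformly_continuous_on (cball (0::real^'n) R' \<times> {t0..T2}) v"
    by (intro compact_uniformly_continuous continuous_on_subset[OF cont]) auto
  then obtain \<omega> where \<omega>: "\<omega> > 0" "\<And>z z'. z \<in> cball 0 R' \<times> {t0..T2} \<Longrightarrow> z' \<in> cball 0 R' \<times> {t0..T2} \<Longrightarrow> dist z' z < \<omega> \<Longrightarrow> dist (v z') (v z) < m / 4"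
    unfolding uniformly_continuous_on_def using m(1) by (metis divide_pos_pos zero_less_numeral)
  have \<omega>t: "\<bar>v (x, t) - v (x, s)\<bar> < m / 4" if "norm x \<le> R'" "t \<in> {t0..T2}" "s \<in> {t0..T2}" "\<bar>t - s\<bar> < \<omega>" for x t s
    using \<omega>(2)[of "(x, s)" "(x, t)"] that by (simp add: dist_Pair_Pair dist_real_def)
  define w0 where "w0 = min \<omega> (T2 - T1)"
  have w0: "w0 > 0" using \<omega> T1 by (simp add: w0_def)
  \<comment> \<open>Makes the penalty in \<open>t - s\<close> exceed \<open>2 * M\<close> as soon as
    \<open>|t - s| \<ge> w0\<close>.\<close>
  define \<mu> where "\<mu> = w0\<^sup>2 / (4 * M + 1)"
  have \<mu>: "\<mu> > 0" "4 * M * \<mu> < w0\<^sup>2"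
  proof -
    show "\<mu> > 0" using w0 M0 by (simp add: \<mu>_def)
    have "4 * M * \<mu> = w0\<^sup>2 * (4 * M / (4 * M + 1))" by (simp add: \<mu>_def)
    also have "\<dots> < w0\<^sup>2 * 1" using w0 M0 by (intro mult_strict_left_mono) auto
    finally show "4 * M * \<mu> < w0\<^sup>2" by simp
  qed
  define \<Omega> where "\<Omega> x t y s = v (x, t) - v (y, s) - norm (x - y) - \<sigma> / (T1 - t) - \<kappa> * (norm x)\<^sup>2 - (t - s)\<^sup>2 / (2 * \<mu>)" for x t y s
  define D where "D = (cball (0::real^'n) R \<times> {t0..T1 - \<theta>}) \<times> (cball (0::real^'n) R' \<times> {t0..T2})"
  \<comment> \<open>The set where \<Omega> is positive lies in the compact \<open>D\<close>, so the
    maximum over \<open>D\<close> is global on the strip.\<close>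
  have inD: "((x, t), (y, s)) \<in> D" if \<Omega>: "\<Omega> x t y s > 0" and ts: "t0 \<le> t" "t < T1" "t0 \<le> s" "s \<le> T2" for x t y s
  proof -
    have vv: "v (x, t) - v (y, s) \<le> 2 * M" using bound[of t x] bound[of s y] ts T1 by simp
    have nn: "0 \<le> norm (x - y)" "0 \<le> \<sigma> / (T1 - t)" "0 \<le> \<kappa> * (norm x)\<^sup>2" "0 \<le> (t - s)\<^sup>2 / (2 * \<mu>)" using \<sigma> ts \<kappa> \<mu> by auto
    have "\<kappa> * (norm x)\<^sup>2 \<le> \<kappa> * R\<^sup>2" using \<Omega> vv nn R2 unfolding \<Omega>_def by linarith
    then have x: "norm x \<le> R" using \<kappa>(4) R0 by (simp add: power2_le_iff_abs_le)
    have "norm (x - y) \<le> 2 * M" using \<Omega> vv nn unfolding \<Omega>_def by linarith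
    then have y: "norm y \<le> R'" using x norm_triangle_ineq2[of y x] by (simp add: R'_def norm_minus_commute)
    have "\<sigma> / (T1 - t) \<le> 2 * M + 1" using \<Omega> vv nn unfolding \<Omega>_def by linarith
    then have "\<sigma> \<le> (2 * M + 1) * (T1 - t)" using ts by (simp add: pos_divide_le_eq)
    then have "\<theta> \<le> T1 - t" unfolding \<theta>_def using M0 by (simp add: pos_divide_le_eq mult.commute)
    then have "t \<le> T1 - \<theta>" by simp
    then show ?thesis using x y ts by (simp add: D_def)
  qed
  have \<Omega>1: "\<Omega> x1 t1 y1 t1 \<ge> m"
  proof -
    have "\<sigma> / (T1 - t1) = m" using T1 by (simp add: \<sigma>_def)
    then show ?thesis using m(2) \<kappa>(3) by (simp add: \<Omega>_def)
  qed
  have "((x1, t1), (y1, t1)) \<in> D" by (rule inD) (use \<Omega>1 m t T1 in auto)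
  then have "D \<noteq> {}" by blast
  moreover have "compact D" unfolding D_def by (intro compact_Times) auto
  moreover have "continuous_on D (\<lambda>z. \<Omega> (fst (fst z)) (snd (fst z)) (fst (snd z)) (snd (snd z)))"
  proof -
    have "T1 - snd (fst z) \<noteq> 0" if "z \<in> D" for z using that \<theta> by (auto simp: D_def)
    moreover have "continuous_on D (\<lambda>z. v (fst z))" "continuous_on D (\<lambda>z. v (snd z))"
      using \<theta> T1 by (auto simp: D_def intro!: continuous_on_compose2[OF cont] continuous_intros)
    ultimately show ?thesis unfolding \<Omega>_def using \<mu>(1) by (auto intro!: continuous_intros)
  qed
  ultimately have "\<exists>z\<in>D. \<forall>z'\<in>D. \<Omega> (fst (fst z')) (snd (fst z')) (fst (snd z')) (snd (snd z')) \<le> \<Omega> (fst (fst z)) (snd (fst z)) (fst (snd z)) (snd (snd z))"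
    by (intro continuous_attains_sup)
  then obtain zh where zh: "zh \<in> D" "\<forall>z'\<in>D. \<Omega> (fst (fst z')) (snd (fst z')) (fst (snd z')) (snd (snd z'))
      \<le> \<Omega> (fst (fst zh)) (snd (fst zh)) (fst (snd zh)) (snd (snd zh))" ..
  obtain xh th yh sh where zh_eq: "zh = ((xh, th), (yh, sh))" by (metis surj_pair)
  have hD: "((xh, th), (yh, sh)) \<in> D" using zh(1) zh_eq by simp
  have hmaxD: "\<Omega> x t y s \<le> \<Omega> xh th yh sh" if "((x, t), (y, s)) \<in> D" for x t y s
    using bspec[OF zh(2) that] by (simp add: zh_eq)
  have \<Omega>h: "\<Omega> xh th yh sh \<ge> m" using hmaxD[OF \<open>((x1, t1), (y1, t1)) \<in> D\<close>] \<Omega>1 by linarith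
  have hmax: "\<Omega> x t y s \<le> \<Omega> xh th yh sh" if "t0 \<le> t" "t < T1" "t0 \<le> s" "s \<le> T2" for x t y s
    using inD[OF _ that] hmaxD \<Omega>h m(1) by (cases "\<Omega> x t y s > 0") fastforce+
  have h: "norm xh \<le> R" "t0 \<le> th" "th \<le> T1 - \<theta>" "norm yh \<le> R'" "t0 \<le> sh" "sh \<le> T2" using hD by (auto simp: D_def)
  have hT: "th < T1" "th \<le> T2" using h(3) \<theta> T1 by auto
  have xR': "norm xh \<le> R'" using h(1) M0 by (simp add: R'_def)
  have vv: "v (xh, th) - v (yh, sh) \<le> 2 * M" using bound[of th xh] bound[of sh yh] h hT by simp
  have nn: "0 \<le> norm (xh - yh)" "0 < \<sigma> / (T1 - th)" "0 \<le> \<kappa> * (norm xh)\<^sup>2" "0 \<le> (th - sh)\<^sup>2 / (2 * \<mu>)" using \<sigma> hT \<kappa> \<mu> by auto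
  have ts_near: "\<bar>th - sh\<bar> < w0"
  proof -
    have "(th - sh)\<^sup>2 / (2 * \<mu>) \<le> 2 * M" using \<Omega>h m(1) vv nn unfolding \<Omega>_def by linarith
    then have "(th - sh)\<^sup>2 \<le> 4 * M * \<mu>" using \<mu>(1) by (simp add: pos_divide_le_eq algebra_simps)
    also have "\<dots> < w0\<^sup>2" by (rule \<mu>(2))
    finally show ?thesis using w0 by (metis power2_abs power2_less_imp_less less_imp_le)
  qed
  have near: "\<bar>th - sh\<bar> < \<omega>" "\<bar>sh - th\<bar> < \<omega>" "\<bar>th - sh\<bar> < T2 - T1" using ts_near by (auto simp: w0_def)
  have main: "v (xh, th) - v (yh, sh) \<ge> m + norm (xh - yh)" using \<Omega>h nn unfolding \<Omega>_def by linarith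
  \<comment> \<open>At time \<open>t0\<close> the initial contraction would leave only the modulus
    \<open>m / 4\<close> to account for a gap of \<open>m\<close>.\<close>
  have th0: "t0 < th"
  proof (rule ccontr)
    assume "\<not> t0 < th"
    then have e: "th = t0" using h(2) by simp
    have "\<bar>v (yh, th) - v (yh, sh)\<bar> < m / 4" by (rule \<omega>t) (use h hT near in auto)
    then show False using main initial[of xh yh] m(1) unfolding e by linarith
  qed
  have sh0: "t0 < sh"
  proof (rule ccontr)
    assume "\<not> t0 < sh"
    then have e: "sh = t0" using h(5) by simp
    have "\<bar>v (xh, th) - v (xh, sh)\<bar> < m / 4" by (rule \<omega>t) (use h hT near xR' in auto)
    then show False using main initial[of xh yh] m(1) unfolding e by linarith
  qed
  have shT: "sh < T2" using near(3) hT by linarith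
  define \<rho> where "\<rho> = norm (xh - yh)"
  have \<rho>: "\<rho> \<ge> r0"
  proof -
    have "\<bar>v (yh, th) - v (yh, sh)\<bar> < m / 4" by (rule \<omega>t) (use h hT near in auto)
    then have "3 * m / 4 \<le> v (xh, th) - v (yh, th)" using main nn by linarith
    also have "\<dots> \<le> Lp * \<rho>" using Lp(2)[of th xh yh] h hT unfolding \<rho>_def by linarith
    finally show ?thesis using Lp(1) by (simp add: r0_def pos_divide_le_eq algebra_simps)
  qed
  have \<rho>0: "\<rho> > 0" using \<rho> r0 by linarith
  define e where "e = (xh - yh) /\<^sub>R \<rho>"
  have ne: "norm e = 1" using \<rho>0 by (simp add: e_def \<rho>_def)
  define a where "a = T1 - th"
  have a: "a > 0" "a \<le> T1 - t0" using hT h by (auto simp: a_def)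
  \<comment> \<open>\<open>Q\<close> and \<open>B\<close> are the gradient and Hessian of a
    quadratic majorant of the penalties. The time entry \<open>4 * \<sigma> / a ^ 3\<close> is twice
    the true second derivative, which makes it a majorant for time increments up to
    \<open>a / 2\<close>; an extra \<open>2 * \<kappa>\<close> on the whole diagonal makes the
    maximum strict.\<close>
  define Q where "Q = ((e + (2 * \<kappa>) *\<^sub>R xh, \<sigma> / a\<^sup>2 + (th - sh) / \<mu>), (- e, - ((th - sh) / \<mu>)))"
  define B where "B Z = ((((1 / \<rho>) *\<^sub>R (fst (fst Z) - fst (snd Z)) + (4 * \<kappa>) *\<^sub>R fst (fst Z),
       4 * \<sigma> / a ^ 3 * snd (fst Z) + (snd (fst Z) - snd (snd Z)) / \<mu> + 2 * \<kappa> * snd (fst Z))),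
      ((1 / \<rho>) *\<^sub>R (fst (snd Z) - fst (fst Z)) + (2 * \<kappa>) *\<^sub>R fst (snd Z),
       (snd (snd Z) - snd (fst Z)) / \<mu> + 2 * \<kappa> * snd (snd Z)))" for Z :: "((real^'n) \<times> real) \<times> ((real^'n) \<times> real)"
  have linB: "linear B"
    by (rule linearI) (simp_all add: B_def algebra_simps add_divide_distrib diff_divide_distrib)
  have symB: "B Z \<bullet> W = Z \<bullet> B W" for Z W
    by (cases Z; cases W) (simp add: B_def inner_prod_def inner_add_left inner_add_right inner_diff_left inner_diff_right algebra_simps add_divide_distrib diff_divide_distrib)
  have BZ: "B ((\<xi>, d), (\<eta>, g)) \<bullet> ((\<xi>, d), (\<eta>, g)) = (norm (\<xi> - \<eta>))\<^sup>2 / \<rho> + 4 * \<sigma> * d\<^sup>2 / a ^ 3 + 2 * \<kappa> * (norm \<xi>)\<^sup>2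
      + (d - g)\<^sup>2 / \<mu> + 2 * \<kappa> * ((norm \<xi>)\<^sup>2 + d\<^sup>2 + (norm \<eta>)\<^sup>2 + g\<^sup>2)" for \<xi> d \<eta> g
    unfolding power2_norm_eq_inner
    by (simp add: B_def inner_add_left inner_diff_left inner_diff_right power2_eq_square algebra_simps add_divide_distrib diff_divide_distrib inner_commute)
  \<comment> \<open>Keeps both times in \<open>[t0, T2]\<close> and the time increments at most
    \<open>a / 2\<close>, so the first time stays below \<open>T1\<close>.\<close>
  define Rad where "Rad = min (min (th - t0) (a / 2)) (min (sh - t0) (T2 - sh))"
  have Rad: "Rad > 0" using th0 sh0 shT a by (simp add: Rad_def)
  have Rads: "Rad \<le> th - t0" "Rad \<le> a / 2" "Rad \<le> sh - t0" "Rad \<le> T2 - sh"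
    unfolding Rad_def
    by (rule min.coboundedI1[OF min.cobounded1] min.coboundedI1[OF min.cobounded2]
        min.coboundedI2[OF min.cobounded1] min.coboundedI2[OF min.cobounded2])+
  have "\<exists>z1 z2 P1 P2 X1 X2. norm (z1 - (xh, th)) < min \<kappa> Rad \<and> norm (z2 - (yh, sh)) < min \<kappa> Rad \<and>
     norm (P1 - fst Q) < min \<kappa> Rad \<and> norm (P2 - snd Q) < min \<kappa> Rad \<and>
     superjet v z1 P1 X1 \<and> superjet (\<lambda>z. - v z) z2 P2 X2 \<and>
     (\<forall>h k. X1 h \<bullet> h + X2 k \<bullet> k \<le> B (h, k) \<bullet> (h, k))"
  proof (rule theorem_on_sums[OF _ _ Rad linB symB])
    have in_box: "z \<in> UNIV \<times> {t0..T2}" if z: "norm (z - c) \<le> Rad" and c: "c = (xh, th) \<or> c = (yh, sh)" for z c :: "(real^'n) \<times> real"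
    proof -
      have "\<bar>snd z - snd c\<bar> \<le> Rad" using z norm_fst_snd_le(2)[of "z - c"] by simp
      then have "snd z \<in> {t0..T2}" using Rads c hT T1 a by (auto simp: a_def)
      then show ?thesis by (cases z) simp
    qed
    show "continuous_on (cball (xh, th) Rad) v"
    proof (rule continuous_on_subset[OF cont], rule subsetI)
      fix z assume "z \<in> cball (xh, th) Rad"
      then have "norm (z - (xh, th)) \<le> Rad" by (metis dist_norm dist_commute mem_cball)
      then show "z \<in> UNIV \<times> {t0..T2}" by (rule in_box) simp
    qed
    have "continuous_on (cball (yh, sh) Rad) v"
    proof (rule continuous_on_subset[OF cont], rule subsetI)
      fix z assume "z \<in> cball (yh, sh) Rad"
      then have "norm (z - (yh, sh)) \<le> Rad" by (metis dist_norm dist_commute mem_cball)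
      then show "z \<in> UNIV \<times> {t0..T2}" by (rule in_box) simp
    qed
    then show "continuous_on (cball (yh, sh) Rad) (\<lambda>z. - v z)" by (rule continuous_on_minus)
    show "min \<kappa> Rad > 0" using \<kappa> Rad by simp
    fix h k :: "(real^'n) \<times> real" assume hk: "norm h \<le> Rad" "norm k \<le> Rad" "(h, k) \<noteq> 0"
    obtain \<xi> d \<eta> g where H: "h = (\<xi>, d)" "k = (\<eta>, g)" by (metis surj_pair)
    have dg: "\<bar>d\<bar> \<le> Rad" "\<bar>g\<bar> \<le> Rad" using hk(1,2) norm_snd_le[of d \<xi>] norm_snd_le[of g \<eta>] by (auto simp: H)
    have "\<Omega> (xh + \<xi>) (th + d) (yh + \<eta>) (sh + g) \<le> \<Omega> xh th yh sh"
      by (rule hmax) (use dg Rads a(1) in \<open>auto simp: a_def abs_le_iff\<close>)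
    moreover have "norm (xh + \<xi> - (yh + \<eta>)) \<le> \<rho> + e \<bullet> (\<xi> - \<eta>) + (norm (\<xi> - \<eta>))\<^sup>2 / (2 * \<rho>)"
    proof -
      let ?N = "norm (xh + \<xi> - (yh + \<eta>))"
      have "xh + \<xi> - (yh + \<eta>) = (xh - yh) + (\<xi> - \<eta>)" by simp
      then have "?N\<^sup>2 = \<rho>\<^sup>2 + 2 * ((xh - yh) \<bullet> (\<xi> - \<eta>)) + (norm (\<xi> - \<eta>))\<^sup>2"
        unfolding \<rho>_def power2_norm_eq_inner by (simp only: inner_add_left inner_add_right inner_commute[of "\<xi> - \<eta>" "xh - yh"])
      moreover have "(xh - yh) \<bullet> (\<xi> - \<eta>) = \<rho> * (e \<bullet> (\<xi> - \<eta>))" using \<rho>0 by (simp add: e_def)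
      moreover have "2 * \<rho> * ?N \<le> ?N\<^sup>2 + \<rho>\<^sup>2" using zero_le_power2[of "?N - \<rho>"] by (simp add: power2_diff algebra_simps)
      ultimately have "2 * \<rho> * ?N \<le> 2 * \<rho> * (\<rho> + e \<bullet> (\<xi> - \<eta>) + (norm (\<xi> - \<eta>))\<^sup>2 / (2 * \<rho>))"
        using \<rho>0 by (simp add: algebra_simps power2_eq_square)
      then show ?thesis using \<rho>0 by simp
    qed
    moreover have "\<sigma> / (T1 - (th + d)) \<le> \<sigma> / (T1 - th) + \<sigma> / a\<^sup>2 * d + 2 * \<sigma> * d\<^sup>2 / a ^ 3"
    proof -
      have ad: "a - d \<ge> a / 2" using dg Rads by linarith
      have "d\<^sup>2 * a \<le> 2 * d\<^sup>2 * (a - d)" using mult_left_mono[OF ad, of "2 * d\<^sup>2"] by simp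
      then have "a ^ 3 \<le> (a\<^sup>2 + a * d + 2 * d\<^sup>2) * (a - d)"
        by (simp add: power2_eq_square power3_eq_cube algebra_simps)
      then have "1 / (a - d) \<le> (a\<^sup>2 + a * d + 2 * d\<^sup>2) / a ^ 3"
        using ad a(1) by (simp add: divide_le_eq le_divide_eq mult.commute)
      also have "\<dots> = 1 / a + 1 / a\<^sup>2 * d + 2 * d\<^sup>2 / a ^ 3"
        using a(1) by (simp add: field_simps power2_eq_square power3_eq_cube)
      finally have "\<sigma> * (1 / (a - d)) \<le> \<sigma> * (1 / a + 1 / a\<^sup>2 * d + 2 * d\<^sup>2 / a ^ 3)" using \<sigma> by (intro mult_left_mono) auto
      then show ?thesis by (simp add: a_def algebra_simps)
    qed
    moreover have "\<kappa> * (norm (xh + \<xi>))\<^sup>2 = \<kappa> * (norm xh)\<^sup>2 + 2 * \<kappa> * (xh \<bullet> \<xi>) + \<kappa> * (norm \<xi>)\<^sup>2"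
      unfolding power2_norm_eq_inner by (simp add: inner_add_left inner_add_right inner_commute algebra_simps)
    moreover have "(th + d - (sh + g))\<^sup>2 / (2 * \<mu>) = (th - sh)\<^sup>2 / (2 * \<mu>) + (th - sh) / \<mu> * (d - g) + (d - g)\<^sup>2 / \<mu> / 2"
      using \<mu>(1) by (simp add: power2_eq_square field_simps)
    ultimately have "v (xh + \<xi>, th + d) - v (yh + \<eta>, sh + g) \<le> v (xh, th) - v (yh, sh) + e \<bullet> (\<xi> - \<eta>) + (norm (\<xi> - \<eta>))\<^sup>2 / (2 * \<rho>)
       + \<sigma> / a\<^sup>2 * d + 2 * \<sigma> * d\<^sup>2 / a ^ 3 + 2 * \<kappa> * (xh \<bullet> \<xi>) + \<kappa> * (norm \<xi>)\<^sup>2 + (th - sh) / \<mu> * (d - g) + (d - g)\<^sup>2 / \<mu> / 2"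
      unfolding \<Omega>_def \<rho>_def by linarith
    moreover have "Q \<bullet> (h, k) = e \<bullet> (\<xi> - \<eta>) + 2 * \<kappa> * (xh \<bullet> \<xi>) + \<sigma> / a\<^sup>2 * d + (th - sh) / \<mu> * (d - g)"
      by (simp add: Q_def H inner_add_left inner_diff_right algebra_simps add_divide_distrib diff_divide_distrib)
    moreover have "(B (h, k) \<bullet> (h, k)) / 2 = (norm (\<xi> - \<eta>))\<^sup>2 / (2 * \<rho>) + 2 * \<sigma> * d\<^sup>2 / a ^ 3 + \<kappa> * (norm \<xi>)\<^sup>2
      + (d - g)\<^sup>2 / \<mu> / 2 + \<kappa> * ((norm \<xi>)\<^sup>2 + d\<^sup>2 + (norm \<eta>)\<^sup>2 + g\<^sup>2)"
      unfolding H BZ by (simp add: field_simps)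
    moreover have "\<kappa> * ((norm \<xi>)\<^sup>2 + d\<^sup>2 + (norm \<eta>)\<^sup>2 + g\<^sup>2) > 0"
    proof -
      have "\<xi> \<noteq> 0 \<or> d \<noteq> 0 \<or> \<eta> \<noteq> 0 \<or> g \<noteq> 0" using hk(3) by (auto simp: H zero_prod_def)
      then have "(norm \<xi>)\<^sup>2 > 0 \<or> d\<^sup>2 > 0 \<or> (norm \<eta>)\<^sup>2 > 0 \<or> g\<^sup>2 > 0" by auto
      moreover have "(norm \<xi>)\<^sup>2 \<ge> 0" "d\<^sup>2 \<ge> 0" "(norm \<eta>)\<^sup>2 \<ge> 0" "g\<^sup>2 \<ge> 0" by auto
      ultimately have "(norm \<xi>)\<^sup>2 + d\<^sup>2 + (norm \<eta>)\<^sup>2 + g\<^sup>2 > 0" by linarith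
      then show ?thesis using \<kappa>(4) by simp
    qed
    ultimately have "v (xh + \<xi>, th + d) - v (yh + \<eta>, sh + g) < v (xh, th) - v (yh, sh) + Q \<bullet> (h, k) + (B (h, k) \<bullet> (h, k)) / 2"
      by linarith
    then show "v ((xh, th) + h) + - v ((yh, sh) + k) < v (xh, th) + - v (yh, sh) + Q \<bullet> (h, k) + (B (h, k) \<bullet> (h, k)) / 2"
      by (simp add: H)
  qed
  then obtain z1 z2 P1 P2 X1 X2 where Z: "norm (z1 - (xh, th)) < Rad" "norm (z2 - (yh, sh)) < Rad"
    and Pn: "norm (P1 - fst Q) < \<kappa>" "norm (P2 - snd Q) < \<kappa>"
    and jets: "superjet v z1 P1 X1" "superjet (\<lambda>z. - v z) z2 P2 X2"
    and XB: "\<And>h k. X1 h \<bullet> h + X2 k \<bullet> k \<le> B (h, k) \<bullet> (h, k)" by auto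
  have X: "linear X1" "linear X2" using jets by (auto simp: superjet_def)
  have sz: "\<bar>snd z1 - th\<bar> < Rad" "\<bar>snd z2 - sh\<bar> < Rad"
    using Z norm_fst_snd_le(2)[of "z1 - (xh, th)"] norm_fst_snd_le(2)[of "z2 - (yh, sh)"] by simp_all
  have tz: "t0 < snd z1" "snd z1 < T2" "t0 < snd z2" "snd z2 < T2"
    using sz Rads hT T1 a(1) by (auto simp: a_def abs_less_iff)
  have zT: "z1 \<in> UNIV \<times> open_times T" "z2 \<in> UNIV \<times> open_times T"
    using tz t by (auto simp: open_times_def mem_Times_iff intro: less_trans[of _ "ereal T2"])
  define q1 where "q1 = fst P1"
  define q2 where "q2 = fst P2"
  have P1: "norm (q1 - (e + (2 * \<kappa>) *\<^sub>R xh)) \<le> \<kappa>" "\<bar>snd P1 - (\<sigma> / a\<^sup>2 + (th - sh) / \<mu>)\<bar> \<le> \<kappa>"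
    using Pn(1) norm_fst_snd_le[of "P1 - fst Q"] by (auto simp: Q_def q1_def)
  have P2: "norm (q2 - (- e)) \<le> \<kappa>" "\<bar>snd P2 - (- ((th - sh) / \<mu>))\<bar> \<le> \<kappa>"
    using Pn(2) norm_fst_snd_le[of "P2 - snd Q"] by (auto simp: Q_def q2_def)
  have \<kappa>x: "2 * \<kappa> * norm xh \<le> 2 * sqrt (2 * M * \<kappa>)"
  proof -
    have "\<kappa> * (norm xh)\<^sup>2 \<le> 2 * M" using \<Omega>h m(1) vv nn unfolding \<Omega>_def by linarith
    then have "\<kappa> * (\<kappa> * (norm xh)\<^sup>2) \<le> \<kappa> * (2 * M)" using \<kappa>(4) by (intro mult_left_mono) auto
    then have "(\<kappa> * norm xh)\<^sup>2 \<le> 2 * M * \<kappa>" by (simp add: power2_eq_square algebra_simps)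
    then show ?thesis using real_le_rsqrt by simp
  qed
  have q1e: "norm (q1 - e) \<le> D1 \<kappa>"
  proof -
    have "norm (q1 - e) \<le> norm (q1 - (e + (2 * \<kappa>) *\<^sub>R xh)) + norm ((2 * \<kappa>) *\<^sub>R xh)"
      using norm_triangle_ineq[of "q1 - (e + (2 * \<kappa>) *\<^sub>R xh)" "(2 * \<kappa>) *\<^sub>R xh"] by (simp add: algebra_simps)
    then show ?thesis using P1(1) \<kappa>x \<kappa>(4) by (simp add: D1_def)
  qed
  have sq0: "sqrt (2 * M * \<kappa>) \<ge> 0" using M0 \<kappa>(4) by simp
  have q2e: "norm (q2 - (- e)) \<le> D1 \<kappa>" using P2(1) sq0 unfolding D1_def by linarith
  have ne': "norm (- e) = 1" using ne by simp
  have D1le: "D1 \<kappa> \<le> 1/2" using \<kappa>(1) by simp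
  note b1 = slope_error_bound[OF p ne q1e D1le]
  note b2 = slope_error_bound[OF p ne' q2e D1le]
  have ss: "norm (sgn q1 + sgn q2) \<le> 4 * D1 \<kappa>"
    using norm_triangle_ineq[of "sgn q1 - e" "sgn q2 - (- e)"] b1(2) b2(2) by simp
  define R1 where "R1 = (p / (p - 1) * F (u z1)) powr (1 / p - 1) * f (u z1) * ((norm q1)\<^sup>2 - pow_2mp p (norm q1))"
  define R2 where "R2 = (p / (p - 1) * F (u z2)) powr (1 / p - 1) * f (u z2) * ((norm q2)\<^sup>2 - pow_2mp p (norm q2))"
  have R12: "\<bar>R1\<bar> \<le> H * (4 * D1 \<kappa>)" "\<bar>R2\<bar> \<le> H * (4 * D1 \<kappa>)"
  proof -
    have "\<bar>(p / (p - 1) * F (u z1)) powr (1 / p - 1) * f (u z1)\<bar> \<le> H" using coeff[of "snd z1" "fst z1"] tz by simp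
    then show "\<bar>R1\<bar> \<le> H * (4 * D1 \<kappa>)" unfolding R1_def abs_mult[of _ "_ - _"] using b1(3) H0 by (intro mult_mono) auto
    have "\<bar>(p / (p - 1) * F (u z2)) powr (1 / p - 1) * f (u z2)\<bar> \<le> H" using coeff[of "snd z2" "fst z2"] tz by simp
    then show "\<bar>R2\<bar> \<le> H * (4 * D1 \<kappa>)" unfolding R2_def abs_mult[of _ "_ - _"] using b2(3) H0 by (intro mult_mono) auto
  qed
  have sub: "snd P1 \<le> diffusion p q1 X1 + R1"
    using transformed_solution_superjets(1)[OF p F0 F \<Phi> zT(1)] sol jets(1) b1(1)
    unfolding viscosity_solution_def v_def q1_def R1_def by blast
  have sup: "snd P2 \<le> diffusion p q2 X2 - R2"
    using transformed_solution_superjets(2)[OF p F0 F \<Phi> zT(2)] sol jets(2) b2(1)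
    unfolding viscosity_solution_def v_def q2_def R2_def by blast
  \<comment> \<open>Only vectors with zero time component enter \<open>XB\<close>, so the time
    entries of \<open>B\<close>, including those with \<open>1 / \<mu>\<close>, drop out.\<close>
  have "diffusion p q1 X1 + diffusion p q2 X2 \<le> real CARD('n) * (4 * (norm (sgn q1 + sgn q2))\<^sup>2 / \<rho> + 2 * (4 * \<kappa>))"
  proof (rule diffusion_sum_bound[OF p X b1(1) b2(1) \<rho>0])
    show "0 \<le> 4 * \<kappa>" using \<kappa>(4) by simp
    fix \<xi> \<eta> :: "real^'n"
    have "X1 (\<xi>, 0) \<bullet> (\<xi>, 0) + X2 (\<eta>, 0) \<bullet> (\<eta>, 0) \<le> (norm (\<xi> - \<eta>))\<^sup>2 / \<rho> + 2 * \<kappa> * (norm \<xi>)\<^sup>2 + 2 * \<kappa> * ((norm \<xi>)\<^sup>2 + (norm \<eta>)\<^sup>2)"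
      using XB[of "(\<xi>, 0)" "(\<eta>, 0)"] unfolding BZ by simp
    also have "\<dots> \<le> (norm (\<xi> - \<eta>))\<^sup>2 / \<rho> + 4 * \<kappa> * ((norm \<xi>)\<^sup>2 + (norm \<eta>)\<^sup>2)"
      using \<kappa>(4) by (simp add: algebra_simps)
    finally show "X1 (\<xi>, 0) \<bullet> (\<xi>, 0) + X2 (\<eta>, 0) \<bullet> (\<eta>, 0) \<le> (norm (\<xi> - \<eta>))\<^sup>2 / \<rho> + 4 * \<kappa> * ((norm \<xi>)\<^sup>2 + (norm \<eta>)\<^sup>2)" .
  qed
  also have "\<dots> \<le> real CARD('n) * (4 * (4 * D1 \<kappa>)\<^sup>2 / r0 + 8 * \<kappa>)"
    using ss \<rho> r0 by (intro mult_left_mono add_mono frac_le power_mono) auto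
  finally have diff: "diffusion p q1 X1 + diffusion p q2 X2 \<le> real CARD('n) * (4 * (4 * D1 \<kappa>)\<^sup>2 / r0 + 8 * \<kappa>)" .
  have "\<sigma> / (T1 - t0)\<^sup>2 \<le> \<sigma> / a\<^sup>2" using \<sigma> a by (intro divide_left_mono power_mono) auto
  \<comment> \<open>In the sum of the time slopes the contributions \<open>(th - sh) / \<mu>\<close>
    cancel and the gain from the time penalty remains.\<close>
  moreover have "\<sigma> / a\<^sup>2 - 2 * \<kappa> \<le> snd P1 + snd P2" using P1(2) P2(2) unfolding abs_le_iff by linarith
  ultimately have "\<sigma> / (T1 - t0)\<^sup>2 \<le> real CARD('n) * (4 * (4 * D1 \<kappa>)\<^sup>2 / r0 + 8 * \<kappa>) + 2 * (H * (4 * D1 \<kappa>)) + 2 * \<kappa>"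
    using sub sup diff R12 unfolding abs_le_iff by linarith
  also have "\<dots> = Err \<kappa>" by (simp add: Err_def)
  finally show False using \<kappa>(2) by simp
qed

section \<open>Gradient bounds\<close>

lemma AE_lebesgue_iff_negligible: "(AE x in lebesgue. P x) \<longleftrightarrow> negligible {x. \<not> P x}"
proof
  assume "AE x in lebesgue. P x"
  then obtain N where "N \<in> null_sets lebesgue" "{x. \<not> P x} \<subseteq> N" unfolding eventually_ae_filter by auto
  then show "negligible {x. \<not> P x}" using negligible_iff_null_sets negligible_subset by blast
next
  assume "negligible {x. \<not> P x}"
  then show "AE x in lebesgue. P x" unfolding eventually_ae_filter negligible_iff_null_sets by auto
qed

lemma not_negligible_open: "open U \<Longrightarrow> x \<in> U \<Longrightarrow> \<not> negligible (U :: 'a::euclidean_space set)"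
  using open_not_negligible by blast

text \<open>For almost every \<open>z\<close> the line through \<open>z\<close> along
  \<open>d\<close> meets the exceptional set in a null set, so the one-dimensional inequality holds
  there. The set of \<open>z\<close> violating it is open by continuity and null, hence
  empty.\<close>

lemma gradient_bound_imp_lipschitz:
  fixes f :: "'a::euclidean_space \<Rightarrow> real"
  assumes L: "L-lipschitz_on UNIV f"
    and grad: "AE x in lebesgue. \<exists>D. GDERIV f x :> D \<and> norm D \<le> K"
  shows "f y - f x \<le> K * norm (y - x)"
proof -
  define N where "N = {x. \<not> (\<exists>D. GDERIV f x :> D \<and> norm D \<le> K)}"
  have N: "negligible N" using grad unfolding AE_lebesgue_iff_negligible N_def .
  define d where "d = y - x"
  have cf: "continuous_on UNIV f" using L lipschitz_on_continuous_on by blast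
  have line: "f (z + d) - f z \<le> K * norm d" if neg: "negligible {\<tau>::real. z + \<tau> *\<^sub>R d \<in> N}" for z
  proof -
    have "(\<lambda>t. f (z + t *\<^sub>R d)) 1 - (\<lambda>t. f (z + t *\<^sub>R d)) 0 \<le> (K * norm d) * (1 - 0)"
    proof (rule lipschitz_derivative_le_imp_le[OF lipschitz_on_line[OF L] neg])
      fix \<tau> :: real assume "\<tau> \<notin> {\<tau>. z + \<tau> *\<^sub>R d \<in> N}"
      then obtain D where D: "GDERIV f (z + \<tau> *\<^sub>R d) :> D" "norm D \<le> K" by (auto simp: N_def)
      have "((\<lambda>t. z + t *\<^sub>R d) has_derivative (\<lambda>e. e *\<^sub>R d)) (at \<tau>)" by (auto intro!: derivative_eq_intros)
      from has_derivative_compose[OF this D(1)[unfolded gderiv_def]]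
      have "((\<lambda>t. f (z + t *\<^sub>R d)) has_field_derivative (d \<bullet> D)) (at \<tau>)"
        unfolding has_field_derivative_def inner_scaleR_left mult_commute_abs .
      moreover have "d \<bullet> D \<le> K * norm d"
        using norm_cauchy_schwarz[of d D] mult_left_mono[OF D(2), of "norm d"] by (simp add: mult.commute)
      ultimately show "\<exists>D. ((\<lambda>t. f (z + t *\<^sub>R d)) has_field_derivative D) (at \<tau>) \<and> D \<le> K * norm d" by blast
    qed simp
    then show ?thesis by simp
  qed
  have "f (z + d) - f z \<le> K * norm d" for z
  proof (rule ccontr)
    assume "\<not> f (z + d) - f z \<le> K * norm d"
    then have z: "z \<in> {z. K * norm d < f (z + d) - f z}" by simp
    have "open {z. K * norm d < f (z + d) - f z}"
      by (intro open_Collect_less continuous_intros cf continuous_on_compose2[OF cf]) auto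
    then have "\<not> negligible {z. K * norm d < f (z + d) - f z}" by (rule not_negligible_open[OF _ z])
    moreover have "AE z in lebesgue. negligible {\<tau>::real. z + \<tau> *\<^sub>R d \<in> N}"
      using AE_negligible_lines[OF N, of d] by (rule AE_completion)
    then have "negligible {z. \<not> negligible {\<tau>::real. z + \<tau> *\<^sub>R d \<in> N}}" unfolding AE_lebesgue_iff_negligible .
    moreover have "{z. K * norm d < f (z + d) - f z} \<subseteq> {z. \<not> negligible {\<tau>::real. z + \<tau> *\<^sub>R d \<in> N}}"
      using line by (force simp: not_le[symmetric])
    ultimately show False using negligible_subset by blast
  qed
  from this[of x] show ?thesis by (simp add: d_def)
qed

lemma lipschitz_has_derivative_bound:
  fixes f :: "'a::real_normed_vector \<Rightarrow> real"
  assumes f: "(f has_derivative f') (at x)" and L: "\<And>y. \<bar>f y - f x\<bar> \<le> L * norm (y - x)"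
  shows "\<bar>f' h\<bar> \<le> L * norm h"
proof -
  have lin: "linear f'" using f has_derivative_linear by blast
  have "((\<lambda>t. x + t *\<^sub>R h) has_derivative (\<lambda>e. e *\<^sub>R h)) (at (0::real))" by (auto intro!: derivative_eq_intros)
  moreover have "(f has_derivative f') (at (x + 0 *\<^sub>R h))" using f by simp
  ultimately have "((\<lambda>t. f (x + t *\<^sub>R h)) has_derivative (\<lambda>e. f' (e *\<^sub>R h))) (at 0)" by (rule has_derivative_compose)
  then have "((\<lambda>t. f (x + t *\<^sub>R h)) has_field_derivative f' h) (at 0)"
    unfolding has_field_derivative_def linear_cmul[OF lin] real_scaleR_def mult_commute_abs .
  then have "((\<lambda>t. \<bar>(f (x + t *\<^sub>R h) - f x) / t\<bar>) \<longlongrightarrow> \<bar>f' h\<bar>) (at 0)"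
    by (intro tendsto_rabs) (simp add: has_field_derivative_iff)
  moreover have "\<forall>\<^sub>F t in at 0. \<bar>(f (x + t *\<^sub>R h) - f x) / t\<bar> \<le> L * norm h"
  proof (rule eventually_mono[OF eventually_neq_at_within[of 0]])
    fix t :: real assume t: "t \<noteq> 0"
    have "\<bar>f (x + t *\<^sub>R h) - f x\<bar> \<le> (L * norm h) * \<bar>t\<bar>" using L[of "x + t *\<^sub>R h"] by (simp add: mult_ac)
    then show "\<bar>(f (x + t *\<^sub>R h) - f x) / t\<bar> \<le> L * norm h" using t by (simp add: abs_divide pos_divide_le_eq)
  qed
  ultimately show ?thesis by (rule tendsto_upperbound) simp
qed

lemma gderiv_exists:
  fixes f :: "'a::euclidean_space \<Rightarrow> real"
  assumes "f differentiable (at x)"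
  shows "\<exists>D. GDERIV f x :> D"
proof -
  obtain f' where f': "(f has_derivative f') (at x)" using assms by (auto simp: differentiable_def)
  then have "linear f'" using has_derivative_linear by blast
  then have "f' = (\<lambda>h. h \<bullet> adjoint f' 1)" by (auto simp: adjoint_works)
  then show ?thesis using f' unfolding gderiv_def by metis
qed

lemma closed_closed_times: "closed (closed_times T)"
  unfolding closed_times_def
  by (intro closed_Collect_conj closed_Collect_le continuous_on_ereal continuous_intros)

lemma ereal_less_trans: "s \<le> q \<Longrightarrow> ereal q < T \<Longrightarrow> ereal s < T"
  by (meson ereal_less_eq(3) le_less_trans)

text \<open>The class gives a Lipschitz constant that may depend on \<open>t\<close>, and a gradient
  bound at almost every point of space-time. Fubini gives the bound \<open>C\<close> for almost
  every \<open>t\<close>, and continuity in time extends the resulting Lipschitz estimate to all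
  \<open>t\<close>.\<close>

lemma uniform_spatial_lipschitz:
  fixes u :: "(real ^ 'n) \<times> real \<Rightarrow> real"
  assumes u: "u \<in> class_H T" and T: "0 < T"
  shows "\<exists>C. \<forall>t\<in>closed_times T. \<forall>x y. \<bar>u (x, t) - u (y, t)\<bar> \<le> C * norm (x - y)"
proof -
  let ?I = "closed_times T"
  have cont: "continuous_on (UNIV \<times> ?I) u" using u by (simp add: class_H_def)
  have lip: "\<exists>L. L-lipschitz_on UNIV (\<lambda>x. u (x, t))" if "t \<in> ?I" for t using u that by (simp add: class_H_def)
  obtain C where C: "AE z in lebesgue_on (UNIV \<times> ?I). case z of (x, t) \<Rightarrow> \<exists>D. GDERIV (\<lambda>y. u (y, t)) x :> D \<and> norm D \<le> C"
    using u unfolding class_H_def by auto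
  have "(UNIV :: (real^'n) set) \<times> ?I \<in> sets borel"
    by (intro borel_closed closed_Times closed_UNIV closed_closed_times)
  then have sI: "(UNIV \<times> ?I) \<inter> space lebesgue \<in> sets (lebesgue :: ((real^'n) \<times> real) measure)" by simp
  define N where "N = {z :: (real^'n) \<times> real. \<not> (z \<in> UNIV \<times> ?I \<longrightarrow> (\<exists>D. GDERIV (\<lambda>y. u (y, snd z)) (fst z) :> D \<and> norm D \<le> C))}"
  have "negligible N" using C unfolding AE_restrict_space_iff[OF sI] AE_lebesgue_iff_negligible N_def case_prod_beta .
  \<comment> \<open>The Borel superset is measurable in the product, as the exchange of the two
    almost everywhere quantifiers demands.\<close>
  then obtain B where B: "N \<subseteq> B" "B \<in> sets borel" "negligible B" using negligible_Borel_superset by blast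
  have B2: "B \<in> sets (lborel \<Otimes>\<^sub>M lborel)" using B(2) by (metis lborel_prod sets_lborel)
  have "B \<in> null_sets lborel" using B(2,3) unfolding negligible_iff_null_sets by (auto simp: null_sets_def)
  then have "AE z in lborel \<Otimes>\<^sub>M lborel. z \<notin> B" unfolding lborel_prod by (rule AE_not_in)
  then have "AE x in lborel. AE t in lborel. (x, t) \<notin> B" by (rule lborel_pair.AE_pair)
  moreover have "{z \<in> space (lborel \<Otimes>\<^sub>M lborel). (fst z, snd z) \<notin> B} \<in> sets (lborel \<Otimes>\<^sub>M lborel)"
    using sets.compl_sets[OF B2] by (simp add: set_diff_eq)
  ultimately have AEt: "AE t in lborel. AE x in lborel. (x, t) \<notin> B"
    using lborel_pair.AE_commute[of "\<lambda>x t. (x, t) \<notin> B"] by blast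
  have good: "\<bar>u (x, t) - u (y, t)\<bar> \<le> C * norm (x - y)" if t: "t \<in> ?I" and AEx: "AE x in lborel. (x, t) \<notin> B" for t x y
  proof -
    obtain L where L: "L-lipschitz_on UNIV (\<lambda>x. u (x, t))" using lip[OF t] by blast
    have "AE x in lborel. \<exists>D. GDERIV (\<lambda>y. u (y, t)) x :> D \<and> norm D \<le> C"
      using AEx
    proof (rule AE_mp, intro AE_I2 impI)
      fix x assume "(x, t) \<notin> B"
      then have "(x, t) \<notin> N" using B(1) by blast
      then show "\<exists>D. GDERIV (\<lambda>y. u (y, t)) x :> D \<and> norm D \<le> C" using t by (simp add: N_def)
    qed
    then have "AE x in lebesgue. \<exists>D. GDERIV (\<lambda>y. u (y, t)) x :> D \<and> norm D \<le> C" by (rule AE_completion)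
    from gradient_bound_imp_lipschitz[OF L this, of x y] gradient_bound_imp_lipschitz[OF L this, of y x]
    show ?thesis by (simp add: abs_le_iff norm_minus_commute)
  qed
  have "\<bar>u (x, t) - u (y, t)\<bar> \<le> C * norm (x - y)" if t: "t \<in> ?I" for t x y
  proof (rule ccontr)
    assume not: "\<not> \<bar>u (x, t) - u (y, t)\<bar> \<le> C * norm (x - y)"
    define g where "g t = \<bar>u (x, t) - u (y, t)\<bar>" for t
    have cg: "continuous_on ?I g" unfolding g_def
      by (intro continuous_intros continuous_on_compose2[OF cont]) auto
    have "g t - C * norm (x - y) > 0" using not by (simp add: g_def)
    then obtain \<delta> where \<delta>: "\<delta> > 0" "\<And>s. s \<in> ?I \<Longrightarrow> dist s t < \<delta> \<Longrightarrow> dist (g s) (g t) < g t - C * norm (x - y)"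
      using cg t unfolding continuous_on_iff by metis
    have bad: "g s > C * norm (x - y)" if "s \<in> ?I" "dist s t < \<delta>" for s
      using \<delta>(2)[OF that] by (simp add: dist_real_def)
    \<comment> \<open>The open interval lies to the left of \<open>t\<close> if
      \<open>t > 0\<close>, and to the right if \<open>t = 0\<close>, where \<open>0 < T\<close>
      enters.\<close>
    have "\<exists>a b. a < b \<and> {a<..<b} \<subseteq> ?I \<inter> ball t \<delta>"
    proof (cases "t > 0")
      case True
      then show ?thesis using t \<delta>(1)
        by (intro exI[of _ "max 0 (t - \<delta>)"] exI[of _ t])
          (auto simp: closed_times_def dist_real_def intro: order_trans[of _ "ereal t"])
    next
      case False
      then have t0: "t = 0" using t by (simp add: closed_times_def)
      obtain r where r: "0 < r" "ereal r < T" using T ereal_dense2[of 0 T] by (auto simp: zero_ereal_def)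
      then show ?thesis using t0 \<delta>(1)
        by (intro exI[of _ 0] exI[of _ "min r \<delta>"])
          (auto simp: closed_times_def dist_real_def intro: order_trans[of _ "ereal r"])
    qed
    then obtain a b where ab: "a < b" "{a<..<b} \<subseteq> ?I \<inter> ball t \<delta>" by blast
    have "negligible {s. \<not> (AE x in lborel. (x, s) \<notin> B)}"
      using AE_completion[OF AEt] unfolding AE_lebesgue_iff_negligible .
    moreover have "{a<..<b} \<subseteq> {s. \<not> (AE x in lborel. (x, s) \<notin> B)}"
    proof (rule subsetI, rule CollectI, rule notI)
      fix s assume s: "s \<in> {a<..<b}" and "AE x in lborel. (x, s) \<notin> B"
      then have "g s \<le> C * norm (x - y)" unfolding g_def using good ab(2) by blast
      moreover have "s \<in> ?I" "dist s t < \<delta>" using s ab(2) by (auto simp: dist_commute)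
      ultimately show False using bad[of s] by simp
    qed
    ultimately have "negligible {a<..<b}" using negligible_subset by blast
    moreover have "(a + b) / 2 \<in> {a<..<b}" using ab(1) by simp
    ultimately show False using not_negligible_open[OF open_greaterThanLessThan] by blast
  qed
  then show ?thesis by blast
qed

section \<open>Propagation of the gradient bound\<close>

text \<open>The version with margin \<delta>, at every point where the gradient exists. Since
  \<open>F + \<delta>\<close> is bounded below, \<Phi> is globally Lipschitz and the first-order
  coefficient is bounded where \<open>u\<close> is; only the value of \<delta> enters these bounds,
  so it can be sent to 0 afterwards at a fixed point.\<close>

lemma gradient_bound_preserved:
  fixes u :: "(real ^ 'n) \<times> real \<Rightarrow> real" and F :: "real \<Rightarrow> real"
  assumes p: "1 < p" "p \<le> 2"
    and dF: "\<And>s. F differentiable (at s)" and cf: "continuous_on UNIV (deriv F)" and F: "\<And>s. F s \<ge> 0" and \<delta>: "\<delta> > 0"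
    and T: "0 < T" and u: "u \<in> class_H T" and sol: "viscosity_solution p (deriv F) T u"
    and t0: "t0 \<in> closed_times T" and t1: "t1 \<in> closed_times T" "t0 \<le> t1"
    and initial: "AE x in lebesgue. \<exists>D. GDERIV (\<lambda>y. u (y, t0)) x :> D \<and>
           norm D powr p \<le> p / (p - 1) * F (u (x, t0))"
    and D: "GDERIV (\<lambda>y. u (y, t1)) x :> D"
  shows "norm D powr p \<le> p / (p - 1) * (F (u (x, t1)) + \<delta>)"
proof -
  let ?I = "closed_times T"
  define c where "c = p / (p - 1)"
  have c: "c > 0" using p by (simp add: c_def)
  define F1 where "F1 s = F s + \<delta>" for s
  have F1: "F1 s > 0" "c * F1 s \<ge> c * \<delta>" for s using F[of s] \<delta> c by (auto simp: F1_def)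
  have dF': "(F has_field_derivative deriv F s) (at s)" for s
    using dF[of s] DERIV_deriv_iff_real_differentiable by blast
  have dF1: "(F1 has_field_derivative deriv F s) (at s)" for s
    unfolding F1_def by (auto intro!: derivative_eq_intros dF')
  define r where "r s = (c * F1 s) powr (- (1 / p))" for s
  have isC: "isCont r s" for s
  proof -
    have "isCont F1 s" using dF1 DERIV_isCont by blast
    then show ?thesis unfolding r_def using F1(1)[of s] c by (auto intro!: continuous_intros)
  qed
  have "\<exists>\<Phi>. \<forall>s::real. - \<infinity> < ereal s \<longrightarrow> ereal s < \<infinity> \<longrightarrow> (\<Phi> has_vector_derivative r s) (at s)"
    by (rule einterval_antiderivative) (auto simp: isC)
  then obtain \<Phi> where "\<forall>s::real. - \<infinity> < ereal s \<longrightarrow> ereal s < \<infinity> \<longrightarrow> (\<Phi> has_vector_derivative r s) (at s)" ..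
  then have \<Phi>: "(\<Phi> has_field_derivative r s) (at s)" for s
    by (simp add: has_real_derivative_iff_has_vector_derivative)
  define A where "A = (c * \<delta>) powr (- (1 / p))"
  have r: "0 < r s" "r s \<le> A" for s
  proof -
    show "0 < r s" using F1(1)[of s] c by (simp add: r_def)
    show "r s \<le> A" unfolding r_def A_def using F1(2)[of s] c \<delta> p by (intro powr_mono2') auto
  qed
  have A0: "A > 0" using c \<delta> by (simp add: A_def)
  have lip\<Phi>: "\<bar>\<Phi> s - \<Phi> s'\<bar> \<le> A * \<bar>s - s'\<bar>" for s s'
    using field_differentiable_bound[of UNIV \<Phi> r A s s'] \<Phi> r
    by (simp add: less_imp_le abs_of_pos)
  define v where "v z = \<Phi> (u z)" for z
  have contu: "continuous_on (UNIV \<times> ?I) u" using u by (simp add: class_H_def)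
  have cont\<Phi>: "continuous_on UNIV \<Phi>" using \<Phi> DERIV_isCont continuous_at_imp_continuous_on by blast
  have contv: "continuous_on (UNIV \<times> ?I) v"
    unfolding v_def by (rule continuous_on_compose2[OF cont\<Phi> contu]) auto
  obtain C where C: "\<And>t x y. t \<in> ?I \<Longrightarrow> \<bar>u (x, t) - u (y, t)\<bar> \<le> C * norm (x - y)"
    using uniform_spatial_lipschitz[OF u T] by blast
  have lipv: "\<bar>v (x, t) - v (y, t)\<bar> \<le> (A * C) * norm (x - y)" if "t \<in> ?I" for t x y
  proof -
    have "\<bar>v (x, t) - v (y, t)\<bar> \<le> A * \<bar>u (x, t) - u (y, t)\<bar>" unfolding v_def by (rule lip\<Phi>)
    also have "\<dots> \<le> A * (C * norm (x - y))" using C[OF that] A0 by (intro mult_left_mono) auto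
    finally show ?thesis by (simp add: mult.assoc)
  qed
  have "bounded (u ` (UNIV \<times> open_times T))"
    using sol by (simp add: viscosity_solution_def viscosity_subsolution_def)
  then obtain M where M: "\<And>x t. t \<in> open_times T \<Longrightarrow> \<bar>u (x, t)\<bar> \<le> M" unfolding bounded_iff by force
  \<comment> \<open>The viscosity property bounds \<open>u\<close> at open times only; continuity
    extends the bound to time 0, for the case \<open>t0 = 0\<close>.\<close>
  have Mle: "\<bar>u (x, t)\<bar> \<le> M" if t: "0 \<le> t" "ereal t < T" for x t
  proof (cases "t = 0")
    case False
    then show ?thesis using t M by (simp add: open_times_def)
  next
    case True
    have "(0::real) \<in> ?I" using T by (simp add: closed_times_def zero_ereal_def[symmetric])
    have "continuous_on ?I (\<lambda>t. u (x, t))" by (intro continuous_on_compose2[OF contu] continuous_intros) auto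
    then have lim: "((\<lambda>t. u (x, t)) \<longlongrightarrow> u (x, 0)) (at 0 within ?I)"
      using \<open>0 \<in> ?I\<close> by (simp add: continuous_on)
    obtain q where q: "0 < q" "ereal q < T" using T ereal_dense2[of 0 T] by (auto simp: zero_ereal_def)
    have "at_right 0 \<le> at 0 within ?I"
    proof (rule filter_leI)
      fix P assume "eventually P (at 0 within ?I)"
      then obtain d where d: "d > 0" "\<And>s. s \<in> ?I \<Longrightarrow> s \<noteq> 0 \<Longrightarrow> dist s 0 < d \<Longrightarrow> P s" unfolding eventually_at by blast
      have "P s" if "0 < s" "s < min d q" for s
        using that q ereal_less_trans[of s q T] by (intro d(2)) (auto simp: closed_times_def)
      then show "eventually P (at_right 0)" unfolding eventually_at_right_field using d(1) q(1)
        by (intro exI[of _ "min d q"]) auto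
    qed
    then have "((\<lambda>t. \<bar>u (x, t)\<bar>) \<longlongrightarrow> \<bar>u (x, 0)\<bar>) (at_right 0)" by (intro tendsto_rabs tendsto_mono[OF _ lim])
    moreover have "\<forall>\<^sub>F t in at_right 0. \<bar>u (x, t)\<bar> \<le> M" unfolding eventually_at_right_field
      using q M ereal_less_trans[OF less_imp_le q(2)] by (intro exI[of _ q]) (auto simp: open_times_def)
    ultimately have "\<bar>u (x, 0)\<bar> \<le> M" by (rule tendsto_upperbound) simp
    then show ?thesis using True by simp
  qed
  have Mv: "\<bar>v (x, t)\<bar> \<le> \<bar>\<Phi> 0\<bar> + A * M" if t: "0 \<le> t" "ereal t < T" for x t
  proof -
    have "A * \<bar>u (x, t)\<bar> \<le> A * M" using Mle[OF t] A0 by (intro mult_left_mono) auto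
    then show ?thesis using lip\<Phi>[of "u (x, t)" 0] unfolding v_def by simp
  qed
  have "compact (deriv F ` {-M..M})" by (intro compact_continuous_image continuous_on_subset[OF cf]) auto
  from compact_imp_bounded[OF this] obtain K where "\<forall>y\<in>deriv F ` {-M..M}. norm y \<le> K" unfolding bounded_iff ..
  then have K: "\<bar>deriv F s\<bar> \<le> K" if "\<bar>s\<bar> \<le> M" for s using that by (auto simp: abs_le_iff)
  \<comment> \<open>The exponent \<open>1 / p - 1\<close> is negative, so the lower bound
    \<open>c * \<delta>\<close> on the base bounds the power from above.\<close>
  have coeff: "\<bar>(p / (p - 1) * F1 (u (x, t))) powr (1 / p - 1) * deriv F (u (x, t))\<bar> \<le> (c * \<delta>) powr (1 / p - 1) * K"
    if t: "0 \<le> t" "ereal t < T" for x t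
  proof -
    have "(c * F1 (u (x, t))) powr (1 / p - 1) \<le> (c * \<delta>) powr (1 / p - 1)"
      using F1(2)[of "u (x, t)"] c \<delta> p by (intro powr_mono2') auto
    then show ?thesis using K[OF Mle[OF t]] unfolding c_def[symmetric] abs_mult by (intro mult_mono) auto
  qed
  have init: "v (x, t0) - v (y, t0) \<le> norm (x - y)" for x y
  proof -
    have "(A * C)-lipschitz_on UNIV (\<lambda>x. v (x, t0))"
    proof (rule lipschitz_onI)
      show "dist (v (x, t0)) (v (y, t0)) \<le> (A * C) * dist x y" for x y
        using lipv[OF t0, of x y] by (simp add: dist_norm)
      \<comment> \<open>Any unit vector shows \<open>C \<ge> 0\<close>, which a Lipschitz constant
        has to satisfy.\<close>
      have "\<bar>u (axis undefined 1, t0) - u (0, t0)\<bar> \<le> C * norm (axis (undefined::'n) (1::real))"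
        using C[OF t0, of "axis undefined 1" 0] by simp
      then have "C \<ge> 0" by (simp add: order_trans[OF abs_ge_zero])
      then show "A * C \<ge> 0" using A0 by simp
    qed
    moreover have "AE x in lebesgue. \<exists>D. GDERIV (\<lambda>x. v (x, t0)) x :> D \<and> norm D \<le> 1"
      using initial
    proof (rule AE_mp, intro AE_I2 impI)
      fix x assume "\<exists>D. GDERIV (\<lambda>y. u (y, t0)) x :> D \<and> norm D powr p \<le> p / (p - 1) * F (u (x, t0))"
      then obtain D where D: "GDERIV (\<lambda>y. u (y, t0)) x :> D" "norm D powr p \<le> p / (p - 1) * F (u (x, t0))" by blast
      have "GDERIV (\<lambda>x. v (x, t0)) x :> r (u (x, t0)) *\<^sub>R D"
        unfolding v_def by (rule GDERIV_DERIV_compose[OF D(1) \<Phi>])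
      moreover have "norm (r (u (x, t0)) *\<^sub>R D) \<le> 1"
      proof -
        have "norm D powr p \<le> c * F1 (u (x, t0))" using D(2) c \<delta> by (simp add: c_def[symmetric] F1_def distrib_left add_increasing2)
        then have "(norm D powr p) powr (1 / p) \<le> (c * F1 (u (x, t0))) powr (1 / p)" using p by (intro powr_mono2) auto
        moreover have "(norm D powr p) powr (1 / p) = norm D" using p by (simp add: powr_powr)
        ultimately have "r (u (x, t0)) * norm D \<le> r (u (x, t0)) * (c * F1 (u (x, t0))) powr (1 / p)"
          using r(1) by (intro mult_left_mono) (auto simp: less_imp_le)
        also have "\<dots> = 1" using F1(1)[of "u (x, t0)"] c by (simp add: r_def flip: powr_add)
        finally show ?thesis using r(1)[of "u (x, t0)"] by simp
      qed
      ultimately show "\<exists>D. GDERIV (\<lambda>x. v (x, t0)) x :> D \<and> norm D \<le> 1" by blast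
    qed
    ultimately show ?thesis using gradient_bound_imp_lipschitz[of "A * C" "\<lambda>x. v (x, t0)" 1 x y] by simp
  qed
  have t00: "0 \<le> t0" using t0 by (simp add: closed_times_def)
  have inner: "v (x, t) - v (y, t) \<le> norm (x - y)" if t: "t0 \<le> t" "ereal t < T" for x y t
  proof -
    \<comment> \<open>The contraction works on a closed slab that ends after \<open>t\<close> and
      strictly before \<open>T\<close>.\<close>
    obtain T2 where T2: "t < T2" "ereal T2 < T" using ereal_dense2[OF t(2)] by auto
    have lt: "ereal s < T" if "s \<le> T2" for s using that T2(2) by (rule ereal_less_trans)
    have inI: "s \<in> ?I" if "t0 \<le> s" "s \<le> T2" for s using that t00 lt[of s] by (auto simp: closed_times_def)
    have sub: "UNIV \<times> {t0..T2} \<subseteq> UNIV \<times> ?I" using inI by auto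
    have "(\<lambda>z. \<Phi> (u z)) (x, t) - (\<lambda>z. \<Phi> (u z)) (y, t) \<le> norm (x - y)"
    proof (rule spatial_contraction[OF p F1(1) dF1 _ sol t00 t(1) T2])
      show "(\<Phi> has_field_derivative (p / (p - 1) * F1 s) powr - (1 / p)) (at s)" for s
        using \<Phi>[of s] by (simp add: r_def c_def)
      show "continuous_on (UNIV \<times> {t0..T2}) (\<lambda>z. \<Phi> (u z))" using continuous_on_subset[OF contv sub] by (simp add: v_def[abs_def])
      show "\<bar>\<Phi> (u (x, s))\<bar> \<le> \<bar>\<Phi> 0\<bar> + A * M" if "t0 \<le> s" "s \<le> T2" for x s
        using Mv[of s x] that t00 lt[of s] by (simp add: v_def)
      show "\<bar>\<Phi> (u (x, s)) - \<Phi> (u (y, s))\<bar> \<le> (A * C) * norm (x - y)" if "t0 \<le> s" "s \<le> T2" for x y s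
        using lipv[OF inI[OF that], of x y] by (simp add: v_def)
      show "\<bar>(p / (p - 1) * F1 (u (x, s))) powr (1 / p - 1) * deriv F (u (x, s))\<bar> \<le> (c * \<delta>) powr (1 / p - 1) * K"
        if "t0 \<le> s" "s \<le> T2" for x s using coeff[of s x] that t00 lt[of s] by simp
      show "\<Phi> (u (x, t0)) - \<Phi> (u (y, t0)) \<le> norm (x - y)" for x y using init[of x y] by (simp add: v_def)
    qed
    then show ?thesis by (simp add: v_def)
  qed
  have contr: "v (x, t1) - v (y, t1) \<le> norm (x - y)" for x y
  proof (cases "ereal t1 < T")
    case True
    then show ?thesis using inner t1(2) by blast
  next
    case False
    show ?thesis
    proof (cases "t1 = t0")
      case True
      then show ?thesis using init by simp
    next
      case ne: False
      \<comment> \<open>The equation holds only before \<open>T\<close>, so a finite final time is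
        reached by left continuity.\<close>
      have eqT: "ereal t1 = T" using False t1(1) by (simp add: closed_times_def)
      have "continuous_on ?I (\<lambda>t. v (x, t) - v (y, t))"
        by (intro continuous_intros continuous_on_compose2[OF contv]) auto
      then have lim: "((\<lambda>t. v (x, t) - v (y, t)) \<longlongrightarrow> v (x, t1) - v (y, t1)) (at t1 within ?I)"
        using t1(1) by (simp add: continuous_on)
      have ev: "\<forall>\<^sub>F t in at_left t1. t0 < t \<and> t < t1"
        unfolding eventually_at_left_field using t1(2) ne by (intro exI[of _ t0]) auto
      have "at_left t1 \<le> at t1 within ?I"
      proof (rule filter_leI)
        fix P assume "eventually P (at t1 within ?I)"
        then obtain d where d: "d > 0" "\<And>s. s \<in> ?I \<Longrightarrow> s \<noteq> t1 \<Longrightarrow> dist s t1 < d \<Longrightarrow> P s" unfolding eventually_at by blast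
        have "P s" if "max t0 (t1 - d) < s" "s < t1" for s
          using that t00 eqT by (intro d(2)) (auto simp: closed_times_def dist_real_def)
        then show "eventually P (at_left t1)" unfolding eventually_at_left_field using d(1) t1(2) ne
          by (intro exI[of _ "max t0 (t1 - d)"]) auto
      qed
      then have "((\<lambda>t. v (x, t) - v (y, t)) \<longlongrightarrow> v (x, t1) - v (y, t1)) (at_left t1)" by (rule tendsto_mono[OF _ lim])
      moreover have "\<forall>\<^sub>F t in at_left t1. v (x, t) - v (y, t) \<le> norm (x - y)"
        using ev by (rule eventually_mono) (use inner eqT in auto)
      ultimately show ?thesis by (rule tendsto_upperbound) simp
    qed
  qed
  define s where "s = u (x, t1)"
  have "GDERIV (\<lambda>y. v (y, t1)) x :> r s *\<^sub>R D" unfolding v_def s_def by (rule GDERIV_DERIV_compose[OF D \<Phi>])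
  then have der: "((\<lambda>y. v (y, t1)) has_derivative (\<lambda>h. h \<bullet> (r s *\<^sub>R D))) (at x)" by (simp only: gderiv_def)
  \<comment> \<open>The derivative of \<open>v\<close> is tested in the direction of its own
    gradient, which yields \<open>r s * norm D \<le> 1\<close>.\<close>
  have "\<bar>D \<bullet> (r s *\<^sub>R D)\<bar> \<le> 1 * norm D"
  proof (rule lipschitz_has_derivative_bound[OF der])
    show "\<bar>v (y, t1) - v (x, t1)\<bar> \<le> 1 * norm (y - x)" for y
      using contr[of x y] contr[of y x] by (simp add: norm_minus_commute)
  qed
  then have "(r s * norm D) * norm D \<le> 1 * norm D" using r(1)[of s]
    by (simp add: abs_mult power2_norm_eq_inner[symmetric] power2_eq_square)
  then have rD: "r s * norm D \<le> 1" by (cases "norm D = 0") auto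
  have G: "r s * (c * F1 s) powr (1 / p) = 1" using F1(1)[of s] c by (simp add: r_def flip: powr_add)
  then have "norm D \<le> (c * F1 s) powr (1 / p)" using rD r(1)[of s] by (metis mult_le_cancel_left_pos)
  then have "norm D powr p \<le> ((c * F1 s) powr (1 / p)) powr p" using p by (intro powr_mono2) auto
  also have "\<dots> = c * F1 s" using p F1(1)[of s] c by (simp add: powr_powr)
  finally show ?thesis by (simp add: c_def F1_def s_def)
qed

theorem theorem1p3:
  fixes p \<beta> t0 :: real
    and F :: "real \<Rightarrow> real"
    and T :: ereal
    and u :: "(real ^ 'n) \<times> real \<Rightarrow> real"
  assumes "1 < p" and "p \<le> 2"
    and "\<beta> > 0" and "C2_Hoelder_loc \<beta> F" and "\<And>s. F s \<ge> 0"
    and "0 < T"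
    and "u \<in> class_H T"
    and "viscosity_solution p (deriv F) T u"
    and "t0 \<in> closed_times T"
    and "AE x in lebesgue. \<exists>D. GDERIV (\<lambda>y. u (y, t0)) x :> D \<and>
           norm D powr p \<le> p / (p - 1) * F (u (x, t0))"
  shows "\<forall>t\<in>closed_times T. t0 \<le> t \<longrightarrow>
           (AE x in lebesgue. \<exists>D. GDERIV (\<lambda>y. u (y, t)) x :> D \<and>
              norm D powr p \<le> p / (p - 1) * F (u (x, t)))"
proof (intro ballI impI)
  fix t assume t: "t \<in> closed_times T" "t0 \<le> t"
  have dF: "F differentiable (at s)" and cF: "isCont (deriv F) s" for s
    using assms(4) by (auto simp: C2_Hoelder_loc_def differentiable_imp_continuous_within)
  have cont: "continuous_on UNIV (deriv F)" using cF continuous_at_imp_continuous_on by blast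
  obtain L where "L-lipschitz_on UNIV (\<lambda>x. u (x, t))" using assms(7) t(1) by (auto simp: class_H_def)
  \<comment> \<open>The claim includes existence of the gradient at the later time; it comes from
    the Lipschitz continuity of \<open>u\<close> at time \<open>t\<close>.\<close>
  then have "negligible {x. \<not> (\<lambda>x. u (x, t)) differentiable (at x)}" by (rule Rademacher)
  then have "AE x in lebesgue. (\<lambda>x. u (x, t)) differentiable (at x)" unfolding AE_lebesgue_iff_negligible .
  then show "AE x in lebesgue. \<exists>D. GDERIV (\<lambda>y. u (y, t)) x :> D \<and> norm D powr p \<le> p / (p - 1) * F (u (x, t))"
  proof (rule AE_mp, intro AE_I2 impI)
    fix x assume "(\<lambda>x. u (x, t)) differentiable (at x)"
    then obtain D where D: "GDERIV (\<lambda>y. u (y, t)) x :> D" using gderiv_exists by blast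
    have "norm D powr p \<le> p / (p - 1) * F (u (x, t))"
    proof (rule field_le_epsilon)
      fix e :: real assume e: "e > 0"
      define c where "c = p / (p - 1)"
      have c: "c > 0" using assms(1) by (simp add: c_def)
      \<comment> \<open>The margin \<open>e / c\<close> costs exactly \<open>e\<close> after
        multiplication by \<open>c\<close>. It is chosen after \<open>x\<close> and
        \<open>D\<close>, so the exceptional set does not depend on it.\<close>
      have "e / c > 0" using e c by (rule divide_pos_pos)
      from gradient_bound_preserved[OF assms(1,2) dF cont assms(5) this assms(6-9) t assms(10) D]
      show "norm D powr p \<le> p / (p - 1) * F (u (x, t)) + e"
        unfolding c_def[symmetric] using c by (simp add: distrib_left)
    qed
    then show "\<exists>D. GDERIV (\<lambda>y. u (y, t)) x :> D \<and> norm D powr p \<le> p / (p - 1) * F (u (x, t))" using D by blast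
  qed
qed

end
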